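(* Let $\mathcal{H}\subset\mathbb{R}^n$ be a finite set of mutually non-parallel non-zero vectors, and let $$L=-\Delta+R(x),\qquad R(x)=\sum_{\alpha\in\mathcal{H}}\frac{C_\alpha}{\langle\alpha,x\rangle^2}+\widetilde R(x),$$ where $C_\alpha\neq0$ for every $\alpha\in\mathcal{H}$ and $\widetilde R$ is real analytic at $x=0$. Let $W$ be the group generated by the reflections $r_\alpha$, $\alpha\in\mathcal{H}$. Let $P$ be a linear differential operator whose principal symbol is constant in $x$ and is not a polynomial in $\sum_{i=1}^n\xi_i^2$. If $R(x)$ is generic and $\mathcal{H}$ is irreducible, then either $W$ is a finite reflection group or $[L,P]\neq0$.
   Context: $\langle\cdot,\cdot\rangle$ is the standard inner product on $\mathbb{R}^n$, $\Delta=\sum_{i=1}^n\partial^2/\partial x_i^2$, $H_\alpha=\{x:\langle\alpha,x\rangle=0\}$, and $r_\alpha$ is the orthogonal reflection with respect to $H_\alpha$. Constants and functions may be complex-valued. Let $U$ be an open ball centred at $0$ on which $\widetilde R$ is real analytic; $L$ is considered on $D=U\setminus\bigcup_{\beta\in\mathcal{H}}H_\beta$, and $P=\sum_{|p|\le m_0}a_p(x)\partial^p$ (order $m_0$) has real analytic coefficients on $D$; its principal symbol is $\sum_{|p|=m_0}a_p(x)\xi^p$. $R$ is called generic if $C_\alpha\neq k(k+1)\langle\alpha,\alpha\rangle$ for every integer $k$ and every $\alpha\in\mathcal{H}$. $\mathcal{H}$ is called irreducible if (I1) $\mathcal{H}$ spans $\mathbb{R}^n$ as a real vector space, and (I2)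 $\mathcal{H}$ cannot be partitioned into the union of two proper subsets such that each vector in one subset is orthogonal to each vector in the other. *)

theory Defs
  imports
    "HOL-Analysis.Analysis"
    "HOL-Algebra.Bij"
    "HOL-Algebra.Generated_Groups"
    "HOL-Computational_Algebra.Polynomial"
begin

section \<open>Hyperplanes, reflections and the group they generate\<close>

definition hyperplane :: "real ^ 'n \<Rightarrow> (real ^ 'n) set" where
  "hyperplane \<alpha> = {x. \<alpha> \<bullet> x = 0}"

definition reflection :: "real ^ 'n \<Rightarrow> real ^ 'n \<Rightarrow> real ^ 'n" where
  "reflection \<alpha> x = x - (2 * (\<alpha> \<bullet> x) / (\<alpha> \<bullet> \<alpha>)) *\<^sub>R \<alpha>"

text \<open>The ambient group is the group of all bijections of the space under composition.\<close>

definition reflection_group :: "(real ^ 'n) set \<Rightarrow> (real ^ 'n \<Rightarrow> real ^ 'n) set" where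
  "reflection_group A = generate (BijGroup UNIV) (reflection ` A)"

definition finite_reflection_group :: "(real ^ 'n \<Rightarrow> real ^ 'n) set \<Rightarrow> bool" where
  "finite_reflection_group W \<longleftrightarrow> finite W \<and> (\<exists>A. 0 \<notin> A \<and> W = reflection_group A)"

definition mutually_nonparallel :: "(real ^ 'n) set \<Rightarrow> bool" where
  "mutually_nonparallel A \<longleftrightarrow> (\<forall>\<alpha>\<in>A. \<forall>\<beta>\<in>A. \<alpha> \<noteq> \<beta> \<longrightarrow> \<not> (\<exists>c. \<alpha> = c *\<^sub>R \<beta>))"

definition irreducible_set :: "(real ^ 'n) set \<Rightarrow> bool" where
  "irreducible_set A \<longleftrightarrow>
     span A = UNIV \<and>
     \<not> (\<exists>A1 A2. A1 \<subset> A \<and> A2 \<subset> A \<and> A1 \<union> A2 = A \<and> A1 \<inter> A2 = {} \<and>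
          (\<forall>\<alpha>\<in>A1. \<forall>\<beta>\<in>A2. \<alpha> \<bullet> \<beta> = 0))"

definition generic :: "(real ^ 'n) set \<Rightarrow> (real ^ 'n \<Rightarrow> complex) \<Rightarrow> bool" where
  "generic A C \<longleftrightarrow>
     (\<forall>\<alpha>\<in>A. \<forall>k::int. C \<alpha> \<noteq> of_int (k * (k + 1)) * complex_of_real (\<alpha> \<bullet> \<alpha>))"


section \<open>Multi-indices and real analytic functions\<close>

text \<open>A multi-index is a function \<open>p :: 'n \<Rightarrow> nat\<close>; its length is \<open>sum p UNIV\<close>.\<close>

definition mpower :: "real ^ 'n \<Rightarrow> ('n \<Rightarrow> nat) \<Rightarrow> real" where
  "mpower x p = (\<Prod>i\<in>UNIV. (x $ i) ^ p i)"

definition real_analytic_at :: "(real ^ 'n \<Rightarrow> complex) \<Rightarrow> real ^ 'n \<Rightarrow> bool" where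
  "real_analytic_at f x0 \<longleftrightarrow>
     (\<exists>c r. r > 0 \<and>
        (\<forall>x\<in>ball x0 r. ((\<lambda>p. c p * complex_of_real (mpower (x - x0) p)) has_sum f x) UNIV))"

definition real_analytic_on :: "(real ^ 'n \<Rightarrow> complex) \<Rightarrow> (real ^ 'n) set \<Rightarrow> bool" where
  "real_analytic_on f S \<longleftrightarrow> (\<forall>x\<in>S. real_analytic_at f x)"


section \<open>Partial derivatives and differential operators\<close>

definition partial_deriv :: "'n \<Rightarrow> (real ^ 'n \<Rightarrow> complex) \<Rightarrow> real ^ 'n \<Rightarrow> complex" where
  "partial_deriv i f x = vector_derivative (\<lambda>t. f (x + t *\<^sub>R axis i 1)) (at 0)"

definition partials :: "'n list \<Rightarrow> (real ^ 'n \<Rightarrow> complex) \<Rightarrow> real ^ 'n \<Rightarrow> complex" where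
  "partials js f = foldr partial_deriv js f"

definition smooth_on :: "(real ^ 'n) set \<Rightarrow> (real ^ 'n \<Rightarrow> complex) \<Rightarrow> bool" where
  "smooth_on S f \<longleftrightarrow> (\<forall>js. partials js f differentiable_on S)"

text \<open>The derivative of multi-index \<open>p\<close> differentiates \<open>p i\<close> times in the direction \<open>i\<close>.
  The index type carries no order, so some order of differentiation is chosen; on an open set where
  the function is smooth, the choice is immaterial because partial derivatives commute.\<close>

definition mderiv :: "('n \<Rightarrow> nat) \<Rightarrow> (real ^ 'n \<Rightarrow> complex) \<Rightarrow> real ^ 'n \<Rightarrow> complex" where
  "mderiv p = partials (SOME js. \<forall>i. count_list js i = p i)"

definition diff_op ::
  "nat \<Rightarrow> (('n \<Rightarrow> nat) \<Rightarrow> real ^ 'n \<Rightarrow> complex) \<Rightarrow>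
   (real ^ 'n \<Rightarrow> complex) \<Rightarrow> real ^ 'n \<Rightarrow> complex" where
  "diff_op m a f x = (\<Sum>p | sum p UNIV \<le> m. a p x * mderiv p f x)"

definition principal_symbol ::
  "nat \<Rightarrow> (('n \<Rightarrow> nat) \<Rightarrow> real ^ 'n \<Rightarrow> complex) \<Rightarrow> real ^ 'n \<Rightarrow> real ^ 'n \<Rightarrow> complex" where
  "principal_symbol m a x \<xi> = (\<Sum>p | sum p UNIV = m. a p x * complex_of_real (mpower \<xi> p))"

definition laplacian :: "(real ^ 'n \<Rightarrow> complex) \<Rightarrow> real ^ 'n \<Rightarrow> complex" where
  "laplacian f x = (\<Sum>i\<in>UNIV. partial_deriv i (partial_deriv i f) x)"

definition schroedinger_op ::
  "(real ^ 'n \<Rightarrow> complex) \<Rightarrow> (real ^ 'n \<Rightarrow> complex) \<Rightarrow> real ^ 'n \<Rightarrow> complex" where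
  "schroedinger_op R f x = - laplacian f x + R x * f x"

definition potential ::
  "(real ^ 'n) set \<Rightarrow> (real ^ 'n \<Rightarrow> complex) \<Rightarrow> (real ^ 'n \<Rightarrow> complex) \<Rightarrow> real ^ 'n \<Rightarrow> complex" where
  "potential A C Rt x = (\<Sum>\<alpha>\<in>A. C \<alpha> / complex_of_real ((\<alpha> \<bullet> x)\<^sup>2)) + Rt x"

definition commutator ::
  "(('a \<Rightarrow> complex) \<Rightarrow> 'a \<Rightarrow> complex) \<Rightarrow> (('a \<Rightarrow> complex) \<Rightarrow> 'a \<Rightarrow> complex) \<Rightarrow>
   ('a \<Rightarrow> complex) \<Rightarrow> 'a \<Rightarrow> complex" where
  "commutator L P f x = L (P f) x - P (L f) x"

text \<open>An operator vanishes on \<open>D\<close> if it annihilates every smooth function on \<open>D\<close>. Functions are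
  total here, but for open \<open>D\<close> the values of differential operators on \<open>D\<close> depend only on the
  restriction of the function to \<open>D\<close>.\<close>

definition zero_operator_on ::
  "(real ^ 'n) set \<Rightarrow> ((real ^ 'n \<Rightarrow> complex) \<Rightarrow> real ^ 'n \<Rightarrow> complex) \<Rightarrow> bool" where
  "zero_operator_on D Q \<longleftrightarrow> (\<forall>f. smooth_on D f \<longrightarrow> (\<forall>x\<in>D. Q f x = 0))"

end

theory Submission
  imports Defs "HOL-Complex_Analysis.Complex_Analysis"
begin

text \<open>If the commutator vanishes, applying it to exponentials \<open>exp \<langle>\<zeta>, x\<rangle>\<close> and comparing powers of \<open>\<zeta>\<close> gives
  a differential equation for each homogeneous part of the symbol of \<open>P\<close>. Near a generic point of a hyperplane
  \<open>H\<^sub>\<alpha>\<close> with unit normal \<open>e\<close>, decompose \<open>\<zeta> = \<eta> + \<tau> e\<close> and descend from the constant principal symbol: each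
  coefficient is obtained by integrating in the direction \<open>e\<close>, so it has an expansion in powers of
  \<open>t = \<langle>e, x\<rangle>\<close> and \<open>ln t\<close> with finitely many negative powers. The leading terms satisfy a recursion in which only
  the pole \<open>c / t\<^sup>2\<close> of the potential survives, where \<open>c = C\<^sub>\<alpha> / \<langle>\<alpha>, \<alpha>\<rangle>\<close>. Since \<open>c\<close> is not of the form
  \<open>k (k + 1)\<close>, it forces the coefficients of odd powers of \<open>\<tau>\<close> in the principal symbol to vanish, so the symbol is
  invariant under \<open>r\<^sub>\<alpha>\<close>. If \<open>W\<close> is infinite, the symbol is invariant under infinitely many reflections; these
  accumulate, so that it is radial on a plane, and irreducibility enlarges this plane to the whole space.\<close>

text \<open>The obstacle is that integration gives only crude bounds on poles and may create
  logarithms. A weight repairs this: if the coefficient of degree k may have a pole of order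
  \<open>M - k\<close>, then in the equation of degree k just three kinds of terms reach order
  \<open>M - k + 2\<close>: the second normal derivative in degree k, the normal derivative in
  degree k - 1, and derivatives of the pole times coefficients of higher degree. Tangential
  derivatives and the regular part of the potential stay below. For a fixed difference of degree and
  power of \<tau>, the leading coefficients satisfy a one-index recursion. A constant has neither
  pole nor logarithm, so for M > m, and for M = m at positive powers of the logarithm, the recursion
  starts from 0 and kills all leading coefficients. At M = m without logarithm the value of the top
  coefficient itself enters, and only there genericity is used: with c = s (s - 1) it says that 2 s
  - 1 is not an odd integer, so in odd degree the left factor of the difference equation never
  vanishes at s + 2 j, and a polynomial with infinitely many zeros is 0.\<close>

no_notation fps_nth (infixl \<open>$\<close> 75)

section \<open>The indicial recursion\<close>

text \<open>The falling factorial t (t - 1) ... (t - i + 1). In this basis the index shift of the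
  recursion becomes multiplication by t - i, and its binomial sum becomes a translation of t by
  -2.\<close>

definition ffact :: "complex \<Rightarrow> nat \<Rightarrow> complex" where
  "ffact t i = (\<Prod>j<i. t - of_nat j)"

lemma ffact_0 [simp]: "ffact t 0 = 1"
  by (simp add: ffact_def)

lemma ffact_Suc: "ffact t (Suc i) = ffact t i * (t - of_nat i)"
  by (simp add: ffact_def)

lemma ffact_Suc_shift: "ffact t (Suc i) = t * ffact (t - 1) i"
  by (induction i) (simp_all add: ffact_Suc algebra_simps)

lemma ffact_eq_gbinomial: "ffact t i = fact i * (t gchoose i)"
  by (simp add: ffact_def gbinomial_prod_rev atLeast0LessThan)

text \<open>These are the constants in the l-th derivative of 1 / t ^ 2. Reading them as falling
  factorials of -2 makes the Vandermonde convolution applicable to the pole terms.\<close>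

lemma ffact_minus_two: "ffact (-2) l = (-1) ^ l * fact (Suc l)"
  by (induction l) (simp_all add: ffact_Suc algebra_simps)

lemma ffact_Vandermonde:
  "(\<Sum>l\<le>r. of_nat (r choose l) * ffact x l * ffact y (r - l)) = ffact (x + y) r"
proof -
  have "(\<Sum>l\<le>r. of_nat (r choose l) * ffact x l * ffact y (r - l))
      = (\<Sum>l\<le>r. fact r * ((x gchoose l) * (y gchoose (r - l))))"
  proof (rule sum.cong[OF refl])
    fix l assume "l \<in> {..r}"
    then have l: "l \<le> r" by simp
    have "of_nat (r choose l) * (fact l * fact (r - l)) = (fact r :: complex)"
      using binomial_fact[OF l, where 'a=complex] by (simp add: field_simps)
    then show "of_nat (r choose l) * ffact x l * ffact y (r - l) = fact r * ((x gchoose l) * (y gchoose (r - l)))"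
      unfolding ffact_eq_gbinomial by (metis (no_types, lifting) mult.assoc mult.left_commute)
  qed
  also have "\<dots> = ffact (x + y) r"
    by (simp add: ffact_eq_gbinomial gbinomial_Vandermonde[symmetric] atLeast0AtMost flip: sum_distrib_left)
  finally show ?thesis .
qed

text \<open>The recursion satisfied by the leading coefficients at a hyperplane with coefficient \<open>c\<close>:
  the potential \<open>c / t\<^sup>2\<close> contributes its \<open>l\<close>-th derivative \<open>(-1) ^ l * fact (Suc l) * c / t ^ (l + 2)\<close>.\<close>

definition indicial_rec :: "nat \<Rightarrow> complex \<Rightarrow> nat \<Rightarrow> (nat \<Rightarrow> complex) \<Rightarrow> nat \<Rightarrow> complex" where
  "indicial_rec N c d b i =
     (of_nat N - of_nat i) * (of_nat N - of_nat i + 1) * b i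
     - 2 * (of_nat N - of_nat i + 1) * (if i = 0 then 0 else b (i - 1))
     + c * (\<Sum>l=1..d-i. (-1) ^ l * fact (Suc l) * of_nat ((i + l) choose l) * b (i + l))"

text \<open>Let j be the largest index with \<open>b j\<close> nonzero. In the equation at j + 1 the
  diagonal term and the whole sum vanish, which leaves 2 (N - j) b j = 0, while j < d \<le>
  N.\<close>

lemma indicial_rec_low_degree:
  assumes eq: "\<And>i. i \<le> d \<Longrightarrow> indicial_rec N c d b i = 0"
    and top: "\<And>i. i \<ge> d \<Longrightarrow> b i = 0" and "d \<le> N"
  shows "b i = 0"
proof (rule ccontr)
  assume "b i \<noteq> 0"
  define A where "A = {i. b i \<noteq> 0}"
  have fin: "finite A" using top by (intro finite_subset[of A "{..<d}"]) (auto simp: A_def not_le[symmetric])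
  have "A \<noteq> {}" using \<open>b i \<noteq> 0\<close> by (auto simp: A_def)
  define j where "j = Max A"
  have j: "b j \<noteq> 0" using Max_in[OF fin \<open>A \<noteq> {}\<close>] by (simp add: A_def j_def)
  have above: "b l = 0" if "l > j" for l
    using Max_ge[OF fin, of l] that by (auto simp: A_def j_def)
  have "j < d" using j top by (meson not_le)
  then have "indicial_rec N c d b (Suc j) = 0" using eq by simp
  then have "2 * (of_nat N - of_nat j) * b j = 0"
    unfolding indicial_rec_def using above by (auto simp: algebra_simps)
  moreover have "of_nat N \<noteq> (of_nat j :: complex)"
    using \<open>j < d\<close> \<open>d \<le> N\<close> by simp
  ultimately show False using j by simp
qed

text \<open>Multiplying by falling factorials turns the recursion into the difference equation
  \<open>((t - N) (t - N - 1) - c) B t = (t (t - 1) - c) B (t - 2)\<close> for a polynomial \<open>B\<close> of degree \<open>N\<close>. For odd \<open>N\<close>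
  and generic \<open>c\<close>, it propagates a zero of \<open>B\<close> from the root \<open>s\<close> of \<open>c = s (s - 1)\<close> to all points \<open>s + 2 j\<close>.\<close>

lemma indicial_rec_odd_degree:
  assumes eq: "\<And>i. i \<le> N \<Longrightarrow> indicial_rec N c N b i = 0"
    and "odd N" and c: "\<And>k::int. c \<noteq> of_int (k * (k + 1))"
  shows "b N = 0"
proof -
  define B where "B t = (\<Sum>i\<le>N. b i * ffact t i)" for t
  \<comment> \<open>Each index is lowered by one. The term i = N of the new sum carries the factor N
    - i, so the range may still end at N.\<close>
  have shift: "(\<Sum>i\<le>N. 2 * (of_nat N - of_nat i + 1) * (if i = 0 then 0 else b (i - 1)) * ffact t i)
      = (\<Sum>i\<le>N. 2 * (of_nat N - of_nat i) * b i * (ffact t i * (t - of_nat i)))" for t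
  proof -
    obtain n where n: "N = Suc n" using \<open>odd N\<close> by (cases N) auto
    have "(\<Sum>i\<le>N. 2 * (of_nat N - of_nat i + 1) * (if i = 0 then 0 else b (i - 1)) * ffact t i)
      = (\<Sum>i\<le>n. 2 * (of_nat N - of_nat i) * b i * (ffact t i * (t - of_nat i)))"
      unfolding n by (subst sum.atMost_Suc_shift, simp add: ffact_Suc, intro sum.cong refl, simp add: algebra_simps)
    also have "\<dots> = (\<Sum>i\<le>N. 2 * (of_nat N - of_nat i) * b i * (ffact t i * (t - of_nat i)))"
      unfolding n by simp
    finally show ?thesis .
  qed
  have two: "t * (t - 1) * ffact (t - 2) i = ffact t i * (t - of_nat i) * (t - of_nat i - 1)" for t i
  proof -
    have "t * (t - 1) * ffact (t - 2) i = ffact t (Suc (Suc i))"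
      by (simp add: ffact_Suc_shift)
    then show ?thesis by (simp add: ffact_Suc algebra_simps)
  qed
  \<comment> \<open>With l = 0 included, the pole terms form the Vandermonde convolution for -2 and
    translate B. The recursion itself starts at l = 1, so it contributes B (t - 2) - B t.\<close>
  have conv: "(\<Sum>i\<le>N. \<Sum>l\<le>N-i. (-1) ^ l * fact (Suc l) * of_nat ((i + l) choose l) * b (i + l) * ffact t i)
       = B (t - 2)" for t
  proof -
    have "(\<Sum>i\<le>N. \<Sum>l\<le>N-i. (-1) ^ l * fact (Suc l) * of_nat ((i + l) choose l) * b (i + l) * ffact t i)
        = (\<Sum>(i,l)\<in>(SIGMA i:{..N}. {..N-i}). (-1) ^ l * fact (Suc l) * of_nat ((i + l) choose l) * b (i + l) * ffact t i)"
      by (simp add: sum.Sigma)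
    also have "(SIGMA i:{..N}. {..N-i}) = {(i,j). i + j \<le> N}" by auto
    also have "(\<Sum>(i,l)\<in>{(i,j). i + j \<le> N}. (-1) ^ l * fact (Suc l) * of_nat ((i + l) choose l) * b (i + l) * ffact t i)
        = (\<Sum>r\<le>N. \<Sum>i\<le>r. (-1) ^ (r - i) * fact (Suc (r - i)) * of_nat ((i + (r - i)) choose (r - i)) * b (i + (r - i)) * ffact t i)"
      by (rule sum.triangle_reindex_eq)
    also have "\<dots> = (\<Sum>r\<le>N. b r * (\<Sum>i\<le>r. of_nat (r choose i) * ffact t i * ffact (-2) (r - i)))"
      unfolding ffact_minus_two sum_distrib_left
      by (intro sum.cong refl) (auto simp: algebra_simps binomial_symmetric[symmetric])
    also have "\<dots> = B (t - 2)"
      unfolding ffact_Vandermonde B_def by (simp add: algebra_simps)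
    finally show ?thesis .
  qed
  have key: "((t - of_nat N) * (t - of_nat N - 1) - c) * B t = (t * (t - 1) - c) * B (t - 2)" for t
  proof -
    have "0 = (\<Sum>i\<le>N. indicial_rec N c N b i * ffact t i)"
      using eq by simp
    also have "\<dots> = (\<Sum>i\<le>N. (of_nat N - of_nat i) * (of_nat N - of_nat i + 1) * b i * ffact t i)
        - (\<Sum>i\<le>N. 2 * (of_nat N - of_nat i + 1) * (if i = 0 then 0 else b (i - 1)) * ffact t i)
        + c * (\<Sum>i\<le>N. \<Sum>l=1..N-i. (-1) ^ l * fact (Suc l) * of_nat ((i + l) choose l) * b (i + l) * ffact t i)"
      unfolding indicial_rec_def
      by (simp add: ring_distribs sum.distrib sum_subtractf sum_distrib_left sum_distrib_right mult.assoc)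
    also have "(\<Sum>i\<le>N. \<Sum>l=1..N-i. (-1) ^ l * fact (Suc l) * of_nat ((i + l) choose l) * b (i + l) * ffact t i)
        = B (t - 2) - B t"
    proof -
      have "(\<Sum>l\<le>n. g l) = g 0 + (\<Sum>l=1..n. g l)" for n and g :: "nat \<Rightarrow> complex"
        by (simp add: sum.atLeast_Suc_atMost[of 0] flip: atLeast0AtMost)
      then have "B (t - 2) = (\<Sum>i\<le>N. b i * ffact t i + (\<Sum>l=1..N-i. (-1) ^ l * fact (Suc l) * of_nat ((i + l) choose l) * b (i + l) * ffact t i))"
        unfolding conv[symmetric] by simp
      then show ?thesis by (simp add: sum.distrib B_def)
    qed
    also have "(\<Sum>i\<le>N. (of_nat N - of_nat i) * (of_nat N - of_nat i + 1) * b i * ffact t i)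
        - (\<Sum>i\<le>N. 2 * (of_nat N - of_nat i + 1) * (if i = 0 then 0 else b (i - 1)) * ffact t i)
        = (\<Sum>i\<le>N. b i * (((t - of_nat N) * (t - of_nat N - 1)) * ffact t i - t * (t - 1) * ffact (t - 2) i))"
      unfolding shift two sum_subtractf[symmetric]
      by (intro sum.cong refl) (simp add: algebra_simps)
    also have "\<dots> = (t - of_nat N) * (t - of_nat N - 1) * B t - t * (t - 1) * B (t - 2)"
      unfolding B_def sum_distrib_left sum_subtractf[symmetric]
      by (intro sum.cong refl) (simp add: algebra_simps)
    finally show ?thesis by (simp add: algebra_simps)
  qed
  \<comment> \<open>The roots of s (s - 1) = c are s and 1 - s, with difference w = 2 s - 1. The
    excluded values k (k + 1) of c are exactly those for which w is an odd integer.\<close>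
  define w where "w = csqrt (1 + 4 * c)"
  define s where "s = (1 + w) / 2"
  have w2: "w * w = 1 + 4 * c" unfolding w_def by (metis power2_csqrt power2_eq_square)
  have cs: "c = s * (s - 1)" unfolding s_def using w2 by (simp add: field_simps)
  have B0: "B (s + 2 * of_nat j) = 0" for j
  proof (induction j)
    case 0
    show ?case
    proof -
      \<comment> \<open>At t = s the factor in front of B (t - 2) is 0, so the chain of zeros starts
        without a previous zero.\<close>
      have "((s - of_nat N) * (s - of_nat N - 1) - c) * B s = 0"
        using key[of s] cs by simp
      moreover have "(s - of_nat N) * (s - of_nat N - 1) - c = of_nat N * (of_nat N - w)"
        unfolding cs by (simp add: s_def field_simps)
      moreover have "w \<noteq> of_nat N"
      proof
        assume a: "w = of_nat N"
        obtain k where k: "N = 2 * k + 1" using \<open>odd N\<close> by (auto elim: oddE)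
        have "4 * c = 4 * of_int (int k * (int k + 1))" using w2 unfolding a k by (simp add: algebra_simps)
        then show False using c[of "int k"] by simp
      qed
      moreover have "N \<noteq> 0" using \<open>odd N\<close> by (cases N) auto
      ultimately show ?thesis by simp
    qed
  next
    case (Suc j)
    define t where "t = s + 2 * of_nat (Suc j)"
    have "B (t - 2) = 0" using Suc by (simp add: t_def algebra_simps)
    then have "((t - of_nat N) * (t - of_nat N - 1) - c) * B t = 0"
      using key[of t] by simp
    \<comment> \<open>With n = 2 (j + 1) - N the factor equals n (n + w). Here n is odd, hence
      nonzero, and n + w = 0 would make w an odd integer.\<close>
    moreover have "(t - of_nat N) * (t - of_nat N - 1) - c
        = of_int (2 * int (Suc j) - int N) * (of_int (2 * int (Suc j) - int N) + w)"
      unfolding cs t_def by (simp add: s_def field_simps)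
    moreover have "2 * int (Suc j) - int N \<noteq> 0" using \<open>odd N\<close> by presburger
    moreover have "of_int (2 * int (Suc j) - int N) + w \<noteq> 0"
    proof
      assume a: "of_int (2 * int (Suc j) - int N) + w = 0"
      obtain k where k: "int N - 2 * int (Suc j) = 2 * k + 1"
        using \<open>odd N\<close> by (metis even_diff even_mult_iff even_numeral oddE of_nat_Suc even_of_nat odd_iff_mod_2_eq_one dvd_triv_left odd_add)
      have "w = of_int (int N - 2 * int (Suc j))" using a by (simp add: algebra_simps eq_neg_iff_add_eq_0)
      then have w': "w = of_int (2 * k + 1)" unfolding k .
      have "4 * c = 4 * of_int (k * (k + 1))" using w2 unfolding w' by (simp add: algebra_simps)
      then show False using c[of k] by simp
    qed
    ultimately have "B t = 0" by (metis mult_eq_0_iff of_int_eq_0_iff)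
    then show ?case by (simp add: t_def)
  qed
  \<comment> \<open>The basis polynomial of index i is monic of degree i, so the coefficient of
    degree N of the zero polynomial \<open>p\<close> is \<open>b N\<close>.\<close>
  define Q where "Q i = (\<Prod>j<i. [:- of_nat j, 1:] :: complex poly)" for i :: nat
  define p where "p = (\<Sum>i\<le>N. smult (b i) (Q i))"
  have pB: "poly p t = B t" for t
    by (simp add: p_def B_def Q_def poly_sum poly_prod ffact_def)
  have "p = 0"
  proof (rule ccontr)
    assume "p \<noteq> 0"
    then have "finite {t. poly p t = 0}" by (rule poly_roots_finite)
    moreover have "range (\<lambda>j. s + 2 * of_nat j) \<subseteq> {t. poly p t = 0}" using B0 pB by auto
    ultimately have "finite (range (\<lambda>j::nat. s + 2 * of_nat j))" by (rule finite_subset[rotated])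
    moreover have "inj (\<lambda>j::nat. s + 2 * of_nat j)" by (auto intro!: injI)
    ultimately show False using finite_imageD infinite_UNIV_nat by blast
  qed
  have degQ: "degree (Q i) = i" for i
    unfolding Q_def by (subst degree_prod_eq_sum_degree) auto
  have lcQ: "coeff (Q i) i = 1" for i
  proof -
    have "lead_coeff (Q i) = 1" unfolding Q_def by (simp add: lead_coeff_prod)
    then show ?thesis by (simp add: degQ)
  qed
  have "coeff p N = (\<Sum>i\<le>N. b i * coeff (Q i) N)" by (simp add: p_def coeff_sum)
  also have "\<dots> = (\<Sum>i\<le>N. if i = N then b N else 0)"
    by (intro sum.cong refl) (auto simp: lcQ coeff_eq_0 degQ)
  also have "\<dots> = b N" by simp
  finally show ?thesis using \<open>p = 0\<close> by simp
qed

section \<open>Logarithmic Laurent expansions\<close>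

text \<open>The pole may have order less than \<open>N\<close>: then the leading coefficients recorded by \<open>loglead\<close> are all zero.\<close>

definition loglaurent :: "real \<Rightarrow> nat \<Rightarrow> nat \<Rightarrow> (real \<Rightarrow> complex) \<Rightarrow> (nat \<Rightarrow> complex \<Rightarrow> complex) \<Rightarrow> bool" where
  "loglaurent \<epsilon> N S f h \<longleftrightarrow> (\<forall>s. h s holomorphic_on ball 0 \<epsilon>) \<and> (\<forall>s>S. h s = (\<lambda>_. 0)) \<and>
     (\<forall>t. 0 < t \<and> t < \<epsilon> \<longrightarrow>
        f t * of_real t ^ N = (\<Sum>s\<le>S. h s (of_real t) * of_real (ln t) ^ s))"

definition loglead :: "real \<Rightarrow> nat \<Rightarrow> nat \<Rightarrow> (real \<Rightarrow> complex) \<Rightarrow> (nat \<Rightarrow> complex) \<Rightarrow> bool" where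
  "loglead \<epsilon> N S f q \<longleftrightarrow> (\<exists>h. loglaurent \<epsilon> N S f h \<and> q = (\<lambda>s. h s 0))"

text \<open>The difference quotient at 0 has a removable singularity. This separates a leading
  coefficient from a remainder that is one power of t smaller.\<close>

lemma holomorphic_divide_linear:
  assumes "h holomorphic_on ball 0 \<epsilon>"
  obtains k where "k holomorphic_on ball 0 \<epsilon>" "\<And>z. h z = h 0 + z * k z"
proof
  let ?k = "\<lambda>z. if z = 0 then deriv h 0 else (h z - h 0) / (z - 0)"
  show "?k holomorphic_on ball 0 \<epsilon>" using pole_lemma_open[OF assms open_ball, of 0] .
  show "h z = h 0 + z * ?k z" for z by simp
qed

section \<open>Algebra of leading coefficients\<close>

lemma loglead_cong:
  assumes "loglead \<epsilon> N S f q" "\<And>t. 0 < t \<Longrightarrow> t < \<epsilon> \<Longrightarrow> f t = g t"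
  shows "loglead \<epsilon> N S g q"
proof -
  obtain h where h: "loglaurent \<epsilon> N S f h" "q = (\<lambda>s. h s 0)" using assms(1) unfolding loglead_def by auto
  then have "loglaurent \<epsilon> N S g h" using assms(2) unfolding loglaurent_def by auto
  then show ?thesis unfolding loglead_def using h(2) by auto
qed

lemma loglead_add:
  assumes "loglead \<epsilon> N S f q" "loglead \<epsilon> N S g r"
  shows "loglead \<epsilon> N S (\<lambda>t. f t + g t) (\<lambda>s. q s + r s)"
proof -
  obtain h k where hk: "loglaurent \<epsilon> N S f h" "q = (\<lambda>s. h s 0)" "loglaurent \<epsilon> N S g k" "r = (\<lambda>s. k s 0)"
    using assms unfolding loglead_def by auto
  then have "loglaurent \<epsilon> N S (\<lambda>t. f t + g t) (\<lambda>s z. h s z + k s z)"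
    unfolding loglaurent_def by (auto simp: ring_distribs sum.distrib intro!: holomorphic_intros)
  then show ?thesis unfolding loglead_def using hk by (auto intro!: exI[of _ "\<lambda>s z. h s z + k s z"])
qed

lemma loglead_mult:
  assumes "loglead \<epsilon> N S f q" "k holomorphic_on ball 0 \<epsilon>"
    "\<And>t. 0 < t \<Longrightarrow> t < \<epsilon> \<Longrightarrow> g t = k (of_real t)"
  shows "loglead \<epsilon> N S (\<lambda>t. g t * f t) (\<lambda>s. k 0 * q s)"
proof -
  obtain h where h: "loglaurent \<epsilon> N S f h" "q = (\<lambda>s. h s 0)"
    using assms unfolding loglead_def by auto
  then have "loglaurent \<epsilon> N S (\<lambda>t. g t * f t) (\<lambda>s z. k z * h s z)"
    unfolding loglaurent_def using assms(2,3)
    by (auto simp: sum_distrib_left mult.assoc intro!: holomorphic_intros)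
  then show ?thesis unfolding loglead_def using h by (auto intro!: exI[of _ "\<lambda>s z. k z * h s z"])
qed

lemma loglead_cmult:
  assumes "loglead \<epsilon> N S f q"
  shows "loglead \<epsilon> N S (\<lambda>t. c * f t) (\<lambda>s. c * q s)"
  by (rule loglead_mult[OF assms, of "\<lambda>_. c"]) auto

lemma loglead_zero: "loglead \<epsilon> N S (\<lambda>_. 0) (\<lambda>_. 0)"
  unfolding loglead_def loglaurent_def by (auto intro!: exI[of _ "\<lambda>s z. 0"])

lemma loglead_sum:
  assumes "\<And>i. i \<in> I \<Longrightarrow> loglead \<epsilon> N S (f i) (q i)"
  shows "loglead \<epsilon> N S (\<lambda>t. \<Sum>i\<in>I. f i t) (\<lambda>s. \<Sum>i\<in>I. q i s)"
  using assms by (induction I rule: infinite_finite_induct) (auto intro: loglead_zero loglead_add)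

lemma loglead_holomorphic:
  assumes "k holomorphic_on ball 0 \<epsilon>" "\<And>t. 0 < t \<Longrightarrow> t < \<epsilon> \<Longrightarrow> g t = k (of_real t)"
  shows "loglead \<epsilon> 0 S g (\<lambda>s. if s = 0 then k 0 else 0)"
proof -
  have "(\<Sum>s\<le>S. (if s = 0 then k else (\<lambda>_. 0)) (of_real t) * of_real (ln t) ^ s) = k (of_real t)" for t
  proof -
    have "(\<Sum>s\<le>S. (if s = 0 then k else (\<lambda>_. 0)) (of_real t) * of_real (ln t) ^ s)
        = (\<Sum>s\<le>S. if s = 0 then k (of_real t) else 0)"
      by (intro sum.cong refl) auto
    then show ?thesis by simp
  qed
  then have "loglaurent \<epsilon> 0 S g (\<lambda>s. if s = 0 then k else (\<lambda>_. 0))"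
    unfolding loglaurent_def using assms by auto
  then show ?thesis unfolding loglead_def by fastforce
qed

text \<open>Declaring a higher pole order multiplies every \<open>h s\<close> by z, so all leading
  coefficients become 0. Terms of lower order leave the leading equations in this way.\<close>

lemma loglead_Suc:
  assumes "loglead \<epsilon> N S f q"
  shows "loglead \<epsilon> (Suc N) S f (\<lambda>_. 0)"
proof -
  obtain h where h: "loglaurent \<epsilon> N S f h" using assms unfolding loglead_def by auto
  then have "loglaurent \<epsilon> (Suc N) S f (\<lambda>s z. z * h s z)"
    unfolding loglaurent_def
    by (auto simp: sum_distrib_left mult.assoc mult.left_commute intro!: holomorphic_intros)
  then show ?thesis unfolding loglead_def by (auto intro!: exI[of _ "\<lambda>s z. z * h s z"])
qed

lemma loglead_less:
  assumes "loglead \<epsilon> N S f q" "N < N'"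
  shows "loglead \<epsilon> N' S f (\<lambda>_. 0)"
  using assms(2,1) by (induction N' arbitrary: q) (auto simp: less_Suc_eq intro: loglead_Suc)

lemma loglead_le:
  assumes "loglead \<epsilon> N S f q" "N \<le> N'"
  shows "\<exists>q. loglead \<epsilon> N' S f q"
  using assms loglead_less le_neq_implies_less by blast

lemma loglead_mono_log:
  assumes "loglead \<epsilon> N S f q" "S \<le> S'"
  shows "loglead \<epsilon> N S' f q"
proof -
  obtain h where h: "loglaurent \<epsilon> N S f h" "q = (\<lambda>s. h s 0)" using assms unfolding loglead_def by auto
  have "(\<Sum>s\<le>S. h s z * w ^ s) = (\<Sum>s\<le>S'. h s z * w ^ s)" for z w
    using h(1) \<open>S \<le> S'\<close> unfolding loglaurent_def by (intro sum.mono_neutral_left) auto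
  then have "loglaurent \<epsilon> N S' f h" using h(1) \<open>S \<le> S'\<close> unfolding loglaurent_def by auto
  then show ?thesis unfolding loglead_def using h(2) by auto
qed

text \<open>The converse of \<open>loglead_Suc\<close>, by which pole orders are lowered in the
  descent: every \<open>h s\<close> vanishes at 0, so one factor z divides out.\<close>

lemma loglead_lower:
  assumes "loglead \<epsilon> (Suc N) S f (\<lambda>_. 0)"
  shows "\<exists>q. loglead \<epsilon> N S f q"
proof -
  obtain h where h: "loglaurent \<epsilon> (Suc N) S f h" "\<And>s. h s 0 = 0"
    using assms unfolding loglead_def by (metis (mono_tags))
  have "\<exists>k. k holomorphic_on ball 0 \<epsilon> \<and> (\<forall>z. h s z = z * k z) \<and> (s > S \<longrightarrow> k = (\<lambda>_. 0))" for s
  proof (cases "s > S")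
    case True
    then show ?thesis using h(1) unfolding loglaurent_def by (auto intro!: exI[of _ "\<lambda>_. 0"])
  next
    case False
    have "h s holomorphic_on ball 0 \<epsilon>" using h(1) unfolding loglaurent_def by auto
    then obtain k where "k holomorphic_on ball 0 \<epsilon>" "\<And>z. h s z = h s 0 + z * k z"
      using holomorphic_divide_linear by metis
    then show ?thesis using False h(2) by auto
  qed
  then obtain k where k: "\<And>s. k s holomorphic_on ball 0 \<epsilon>" "\<And>s z. h s z = z * k s z"
    "\<And>s. s > S \<Longrightarrow> k s = (\<lambda>_. 0)" by metis
  have "f t * of_real t ^ N = (\<Sum>s\<le>S. k s (of_real t) * of_real (ln t) ^ s)" if "0 < t" "t < \<epsilon>" for t
  proof -
    have "f t * of_real t ^ Suc N = (\<Sum>s\<le>S. h s (of_real t) * of_real (ln t) ^ s)"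
      using h(1) that unfolding loglaurent_def by blast
    also have "\<dots> = of_real t * (\<Sum>s\<le>S. k s (of_real t) * of_real (ln t) ^ s)"
      by (simp add: k(2) sum_distrib_left mult.assoc)
    finally have "of_real t * (f t * of_real t ^ N) = of_real t * (\<Sum>s\<le>S. k s (of_real t) * of_real (ln t) ^ s)"
      by (simp add: mult.left_commute)
    then show ?thesis using that by (simp only: mult_cancel_left) simp
  qed
  then have "loglaurent \<epsilon> N S f k" unfolding loglaurent_def using k by auto
  then show ?thesis unfolding loglead_def by auto
qed

lemma loglead_divide_power:
  assumes "loglead \<epsilon> N S f q"
  shows "loglead \<epsilon> (N + l) S (\<lambda>t. f t / of_real t ^ l) q"
proof -
  obtain h where h: "loglaurent \<epsilon> N S f h" "q = (\<lambda>s. h s 0)" using assms unfolding loglead_def by auto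
  have "f t / of_real t ^ l * of_real t ^ (N + l) = f t * of_real t ^ N" if "0 < t" for t
    using that by (simp add: power_add)
  then have "loglaurent \<epsilon> (N + l) S (\<lambda>t. f t / of_real t ^ l) h"
    using h(1) unfolding loglaurent_def by auto
  then show ?thesis unfolding loglead_def using h(2) by auto
qed

section \<open>Uniqueness of leading coefficients\<close>

lemma filterlim_neg_ln_at_right_0: "filterlim (\<lambda>t::real. - ln t) at_top (at_right 0)"
  using ln_at_0 by (simp add: filterlim_uminus_at_top)

lemma tendsto_times_ln_power:
  "((\<lambda>t::real. t * ln t ^ j) \<longlongrightarrow> 0) (at_right 0)"
proof -
  have "((\<lambda>t::real. (- ln t) ^ j / exp (- ln t)) \<longlongrightarrow> 0) (at_right 0)"
    by (rule filterlim_compose[OF tendsto_power_div_exp_0 filterlim_neg_ln_at_right_0])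
  then have "((\<lambda>t::real. (-1) ^ j * ((- ln t) ^ j / exp (- ln t))) \<longlongrightarrow> (-1) ^ j * 0) (at_right 0)"
    by (intro tendsto_intros)
  moreover have "\<forall>\<^sub>F t::real in at_right 0. (-1) ^ j * ((- ln t) ^ j / exp (- ln t)) = t * ln t ^ j"
    using eventually_at_right_less[of "0::real"]
  proof eventually_elim
    case (elim t)
    have "(-1) ^ j * (- ln t) ^ j = ln t ^ j" by (simp flip: power_mult_distrib)
    then show ?case using elim by (simp add: exp_minus field_simps)
  qed
  ultimately show ?thesis by (simp add: tendsto_cong)
qed

text \<open>Divide by ln t ^ m, where m is the largest power of the logarithm with nonzero leading
  coefficient, and let t tend to 0. Smaller powers die with 1 / ln t; for larger powers
  \<open>h l\<close> is divisible by z, and t beats every power of ln t. The limit is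
  \<open>h m 0\<close>, which must then be 0.\<close>

lemma loglead_unique_zero:
  assumes "loglead \<epsilon> N S f q" "\<epsilon> > 0" "\<And>t. 0 < t \<Longrightarrow> t < \<epsilon> \<Longrightarrow> f t = 0"
  shows "q s = 0"
proof (rule ccontr)
  obtain h where h: "loglaurent \<epsilon> N S f h" "q = (\<lambda>s. h s 0)" using assms unfolding loglead_def by auto
  assume "q s \<noteq> 0"
  define A where "A = {s. h s 0 \<noteq> 0}"
  have "A \<subseteq> {..S}" using h(1) unfolding loglaurent_def A_def by (auto simp: not_less[symmetric])
  then have fin: "finite A" by (rule finite_subset) simp
  have "A \<noteq> {}" using \<open>q s \<noteq> 0\<close> h(2) by (auto simp: A_def)
  define m where "m = Max A"
  have m: "h m 0 \<noteq> 0" "m \<le> S" using Max_in[OF fin \<open>A \<noteq> {}\<close>] \<open>A \<subseteq> {..S}\<close> by (auto simp: A_def m_def)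
  have above: "h l 0 = 0" if "l > m" for l
    using Max_ge[OF fin, of l] that by (auto simp: A_def m_def)
  have hol: "h l holomorphic_on ball 0 \<epsilon>" for l using h(1) unfolding loglaurent_def by auto
  have of_real0: "((\<lambda>t::real. complex_of_real t) \<longlongrightarrow> 0) (at_right 0)"
    using tendsto_of_real[OF tendsto_ident_at[of "0::real" "{0<..}"], where 'a = complex] by simp
  have lim_hol: "((\<lambda>t. k (complex_of_real t)) \<longlongrightarrow> k 0) (at_right 0)" if "k holomorphic_on ball 0 \<epsilon>" for k
  proof -
    have "isCont k 0" using that \<open>\<epsilon> > 0\<close>
      by (meson centre_in_ball continuous_on_eq_continuous_at holomorphic_on_imp_continuous_on open_ball)
    then show ?thesis using of_real0 by (rule isCont_tendsto_compose)
  qed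
  have inv_ln: "((\<lambda>t::real. inverse (ln t)) \<longlongrightarrow> 0) (at_right 0)"
    by (rule tendsto_inverse_0[THEN filterlim_compose])
       (rule filterlim_mono[OF ln_at_0 _ order_refl], simp add: at_bot_le_at_infinity)
  have lim: "((\<lambda>t. h l (of_real t) * of_real (ln t) ^ l / of_real (ln t) ^ m) \<longlongrightarrow> (if l = m then h m 0 else 0)) (at_right 0)" for l
  proof -
    have ev: "\<forall>\<^sub>F t::real in at_right 0. ln t \<noteq> 0"
      using eventually_at_right_real[of 0 1] by (auto elim!: eventually_mono)
    consider "l = m" | "l < m" | "l > m" by linarith
    then show ?thesis
    proof cases
      case 1
      have "\<forall>\<^sub>F t in at_right 0. h m (of_real t) = h m (of_real t) * of_real (ln t) ^ m / of_real (ln t) ^ m"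
        using ev by eventually_elim simp
      then show ?thesis using lim_hol[OF hol[of m]] 1 by (simp add: tendsto_cong)
    next
      case 2
      have "((\<lambda>t. h l (of_real t) * of_real (inverse (ln t) ^ (m - l))) \<longlongrightarrow> h l 0 * of_real (0 ^ (m - l))) (at_right 0)"
        by (intro tendsto_intros lim_hol hol inv_ln)
      moreover have "\<forall>\<^sub>F t in at_right 0. h l (of_real t) * of_real (inverse (ln t) ^ (m - l)) = h l (of_real t) * of_real (ln t) ^ l / of_real (ln t) ^ m"
        using ev
      proof eventually_elim
        case (elim t)
        have "complex_of_real (ln t) ^ m = of_real (ln t) ^ l * of_real (ln t) ^ (m - l)" 
          using 2 by (simp flip: power_add)
        then show ?case using elim by (simp add: field_simps)
      qed
      ultimately have "((\<lambda>t. h l (of_real t) * of_real (ln t) ^ l / of_real (ln t) ^ m) \<longlongrightarrow> h l 0 * of_real (0 ^ (m - l))) (at_right 0)"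
        by (rule Lim_transform_eventually)
      moreover have "h l 0 * of_real (0 ^ (m - l)) = (if l = m then h m 0 else 0)" using 2 by simp
      ultimately show ?thesis by (simp only:)
    next
      case 3
      obtain k where k: "k holomorphic_on ball 0 \<epsilon>" "\<And>z. h l z = h l 0 + z * k z"
        using holomorphic_divide_linear[OF hol[of l]] by metis
      have "((\<lambda>t. k (of_real t) * of_real (t * ln t ^ (l - m))) \<longlongrightarrow> k 0 * of_real 0) (at_right 0)"
        by (intro tendsto_intros lim_hol k tendsto_times_ln_power)
      moreover have "\<forall>\<^sub>F t in at_right 0. k (of_real t) * of_real (t * ln t ^ (l - m)) = h l (of_real t) * of_real (ln t) ^ l / of_real (ln t) ^ m"
        using ev
      proof eventually_elim
        case (elim t)
        have "complex_of_real (ln t) ^ l = of_real (ln t) ^ m * of_real (ln t) ^ (l - m)" 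
          using 3 by (simp flip: power_add)
        then show ?case using elim k(2)[of "of_real t"] above[OF 3] by simp
      qed
      ultimately have "((\<lambda>t. h l (of_real t) * of_real (ln t) ^ l / of_real (ln t) ^ m) \<longlongrightarrow> k 0 * of_real 0) (at_right 0)"
        by (rule Lim_transform_eventually)
      moreover have "k 0 * of_real 0 = (if l = m then h m 0 else 0)" using 3 by simp
      ultimately show ?thesis by (simp only:)
    qed
  qed
  have "((\<lambda>t. \<Sum>l\<le>S. h l (of_real t) * of_real (ln t) ^ l / of_real (ln t) ^ m) \<longlongrightarrow> (\<Sum>l\<le>S. if l = m then h m 0 else 0)) (at_right 0)"
    by (intro tendsto_sum lim)
  moreover have "\<forall>\<^sub>F t in at_right 0. (\<Sum>l\<le>S. h l (of_real t) * of_real (ln t) ^ l / of_real (ln t) ^ m) = 0"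
    using eventually_at_right_real[OF \<open>\<epsilon> > 0\<close>]
  proof eventually_elim
    case (elim t)
    then have "(\<Sum>l\<le>S. h l (of_real t) * of_real (ln t) ^ l) = 0"
      using h(1) assms(3)[of t] unfolding loglaurent_def by (metis greaterThanLessThan_iff mult_zero_left)
    then show ?case unfolding sum_divide_distrib[symmetric] by simp
  qed
  ultimately have "((\<lambda>t::real. 0::complex) \<longlongrightarrow> (\<Sum>l\<le>S. if l = m then h m 0 else 0)) (at_right 0)"
    by (rule Lim_transform_eventually)
  then have "((\<lambda>t::real. 0::complex) \<longlongrightarrow> h m 0) (at_right 0)"
    using m(2) by (simp add: sum.delta)
  then have "0 = h m 0" by (rule tendsto_unique[OF trivial_limit_at_right_real tendsto_const])
  then show False using m by simp
qed

lemma loglead_unique: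
  assumes "loglead \<epsilon> N S f q" "loglead \<epsilon> N S f r" "\<epsilon> > 0"
  shows "q = r"
proof
  fix s
  have "loglead \<epsilon> N S (\<lambda>t. f t + (-1) * f t) (\<lambda>s. q s + (-1) * r s)"
    using assms by (intro loglead_add loglead_cmult)
  then have "q s + (-1) * r s = 0"
    by (rule loglead_unique_zero) (use assms in auto)
  then show "q s = r s" by simp
qed

section \<open>Differentiation and integration of expansions\<close>

text \<open>Put g = f t ^ N. Then f' t ^ (N + 1) = t g' - N g, and t d/dt maps ln t ^ s to s ln t ^
  (s - 1), so the coefficient at s receives a contribution from s + 1. At z = 0 the term with
  \<open>deriv\<close> disappears, so leading coefficients are determined by leading
  coefficients.\<close>

lemma loglaurent_deriv:
  assumes "loglaurent \<epsilon> N S f h"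
    and "\<And>t. 0 < t \<Longrightarrow> t < \<epsilon> \<Longrightarrow> (f has_vector_derivative f' t) (at t)"
  shows "loglaurent \<epsilon> (Suc N) S f'
    (\<lambda>s z. z * deriv (h s) z + of_nat (Suc s) * h (Suc s) z - of_nat N * h s z)"
    (is "loglaurent _ _ _ _ ?k")
proof -
  have hol: "h s holomorphic_on ball 0 \<epsilon>" for s using assms(1) unfolding loglaurent_def by auto
  have above: "h s = (\<lambda>_. 0)" if "s > S" for s using assms(1) that unfolding loglaurent_def by auto
  have A1: "?k s holomorphic_on ball 0 \<epsilon>" for s
    by (intro holomorphic_intros hol) auto
  have A2: "?k s = (\<lambda>_. 0)" if "S < s" for s using above[OF that] above[of "Suc s"] that by (auto simp: deriv_const)
  have A3: "f' t * of_real t ^ Suc N = (\<Sum>s\<le>S. ?k s (of_real t) * of_real (ln t) ^ s)"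
    if t: "0 < t \<and> t < \<epsilon>" for t
  proof -
  define z where "z = complex_of_real t"
  define w where "w = complex_of_real (ln t)"
  have z: "z \<in> ball 0 \<epsilon>" "z \<noteq> 0" using t by (auto simp: z_def)
  have 1: "((\<lambda>t. f t * of_real t ^ N) has_vector_derivative f t * (of_nat N * z ^ (N - 1)) + f' t * z ^ N) (at t)"
  proof -
    have "((\<lambda>t. complex_of_real t ^ N) has_vector_derivative (of_nat N * z ^ (N - 1))) (at t)"
      by (rule has_vector_derivative_real_field) (auto intro!: derivative_eq_intros simp: z_def)
    then show ?thesis using has_vector_derivative_mult[OF assms(2)] t by (fastforce simp: z_def)
  qed
  have 2: "((\<lambda>t. \<Sum>s\<le>S. h s (of_real t) * of_real (ln t) ^ s) has_vector_derivative
      (\<Sum>s\<le>S. h s z * (of_nat s * w ^ (s - 1) * of_real (1 / t)) + deriv (h s) z * w ^ s)) (at t)"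
  proof (rule has_vector_derivative_sum)
    fix s
    have "(h s has_field_derivative deriv (h s) z) (at z)"
      using holomorphic_derivI[OF hol open_ball z(1)] .
    then have a: "((\<lambda>t. h s (of_real t)) has_vector_derivative deriv (h s) z) (at t)"
      unfolding z_def by (rule has_vector_derivative_real_field)
    have "((\<lambda>t. complex_of_real (ln t ^ s)) has_vector_derivative of_real (of_nat s * ln t ^ (s - 1) * (1 / t))) (at t)"
      using t by (intro has_vector_derivative_of_real) (auto intro!: derivative_eq_intros simp: field_simps)
    then have b: "((\<lambda>t. complex_of_real (ln t) ^ s) has_vector_derivative of_nat s * w ^ (s - 1) * of_real (1 / t)) (at t)"
      by (simp add: w_def)
    show "((\<lambda>t. h s (of_real t) * of_real (ln t) ^ s) has_vector_derivative
       h s z * (of_nat s * w ^ (s - 1) * of_real (1 / t)) + deriv (h s) z * w ^ s) (at t)"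
      using has_vector_derivative_mult[OF a b] by (simp add: z_def w_def)
  qed
  have eq: "f u * of_real u ^ N = (\<Sum>s\<le>S. h s (of_real u) * of_real (ln u) ^ s)" if "u \<in> {0<..<\<epsilon>}" for u
    using assms(1) that unfolding loglaurent_def by auto
  have "((\<lambda>t. f t * of_real t ^ N) has_vector_derivative
      (\<Sum>s\<le>S. h s z * (of_nat s * w ^ (s - 1) * of_real (1 / t)) + deriv (h s) z * w ^ s)) (at t)"
    by (rule has_vector_derivative_transform_within_open[OF 2, of "{0<..<\<epsilon>}"]) (use t eq in auto)
  then have der: "f t * (of_nat N * z ^ (N - 1)) + f' t * z ^ N
     = (\<Sum>s\<le>S. h s z * (of_nat s * w ^ (s - 1) * of_real (1 / t)) + deriv (h s) z * w ^ s)"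
    using 1 vector_derivative_unique_at by blast
  have "of_nat N * (\<Sum>s\<le>S. h s z * w ^ s) + f' t * z ^ Suc N
     = z * (f t * (of_nat N * z ^ (N - 1)) + f' t * z ^ N)"
  proof (cases N)
    case (Suc n)
    then show ?thesis using eq[of t] t by (simp add: algebra_simps z_def w_def)
  qed simp
  also have "\<dots> = (\<Sum>s\<le>S. of_nat s * h s z * w ^ (s - 1)) + (\<Sum>s\<le>S. z * deriv (h s) z * w ^ s)"
    unfolding der sum_distrib_left sum.distrib[symmetric] using z(2)
    by (intro sum.cong refl) (simp add: z_def field_simps)
  \<comment> \<open>The extra summand is 0 because \<open>h (Suc S)\<close> is identically 0, and
    the term s = 0 carries the factor 0; this lets the index shift close up.\<close>
  also have "(\<Sum>s\<le>S. of_nat s * h s z * w ^ (s - 1)) = (\<Sum>s\<le>Suc S. of_nat s * h s z * w ^ (s - 1))"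
    using above[of "Suc S"] by simp
  also have "\<dots> = (\<Sum>s\<le>S. of_nat (Suc s) * h (Suc s) z * w ^ s)"
    unfolding sum.atMost_Suc_shift[of _ S] by simp
  finally show ?thesis
    unfolding z_def[symmetric] w_def[symmetric]
    by (simp add: algebra_simps sum.distrib sum_subtractf sum_distrib_left)
  qed
  show ?thesis unfolding loglaurent_def using A1 A2 A3 by blast
qed

lemma loglead_deriv:
  assumes "loglead \<epsilon> N S f q"
    and "\<And>t. 0 < t \<Longrightarrow> t < \<epsilon> \<Longrightarrow> (f has_vector_derivative f' t) (at t)"
  shows "loglead \<epsilon> (Suc N) S f' (\<lambda>s. of_nat (Suc s) * q (Suc s) - of_nat N * q s)"
proof -
  obtain h where h: "loglaurent \<epsilon> N S f h" "q = (\<lambda>s. h s 0)" using assms unfolding loglead_def by auto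
  show ?thesis unfolding loglead_def
    using loglaurent_deriv[OF h(1) assms(2)] h(2) by fastforce
qed

lemma loglead_monomial:
  assumes "k holomorphic_on ball 0 \<epsilon>"
  shows "\<exists>q. loglead \<epsilon> N s (\<lambda>t. k (of_real t) * of_real (ln t) ^ s / of_real t ^ N) q"
proof -
  have "(\<Sum>i\<le>s. (if i = s then k else (\<lambda>_. 0)) (of_real t) * of_real (ln t) ^ i) = k (of_real t) * of_real (ln t) ^ s" for t
  proof -
    have "(\<Sum>i\<le>s. (if i = s then k else (\<lambda>_. 0)) (of_real t) * of_real (ln t) ^ i)
        = (\<Sum>i\<le>s. if i = s then k (of_real t) * of_real (ln t) ^ s else 0)"
      by (intro sum.cong refl) auto
    then show ?thesis by simp
  qed
  then have "loglaurent \<epsilon> N s (\<lambda>t. k (of_real t) * of_real (ln t) ^ s / of_real t ^ N) (\<lambda>i. if i = s then k else (\<lambda>_. 0))"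
    unfolding loglaurent_def using assms by auto
  then show ?thesis unfolding loglead_def by blast
qed

text \<open>The bounds N and S concern the primitive, not g itself.\<close>

definition logprim :: "real \<Rightarrow> nat \<Rightarrow> nat \<Rightarrow> (real \<Rightarrow> complex) \<Rightarrow> bool" where
  "logprim \<epsilon> N S g \<longleftrightarrow> (\<exists>F q. loglead \<epsilon> N S F q \<and>
     (\<forall>t. 0 < t \<and> t < \<epsilon> \<longrightarrow> (F has_vector_derivative g t) (at t)))"

lemma logprim_lincomb:
  assumes "logprim \<epsilon> N S g" "logprim \<epsilon> N S g'"
    "\<And>t. 0 < t \<Longrightarrow> t < \<epsilon> \<Longrightarrow> k t = a * g t + b * g' t"
  shows "logprim \<epsilon> N S k"
proof -
  obtain F q F' q' where *: "loglead \<epsilon> N S F q" "loglead \<epsilon> N S F' q'"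
    "\<And>t. 0 < t \<Longrightarrow> t < \<epsilon> \<Longrightarrow> (F has_vector_derivative g t) (at t)"
    "\<And>t. 0 < t \<Longrightarrow> t < \<epsilon> \<Longrightarrow> (F' has_vector_derivative g' t) (at t)"
    using assms unfolding logprim_def by blast
  have "loglead \<epsilon> N S (\<lambda>t. a * F t + b * F' t) (\<lambda>s. a * q s + b * q' s)"
    by (intro loglead_add loglead_cmult *)
  moreover have "((\<lambda>t. a * F t + b * F' t) has_vector_derivative k t) (at t)" if "0 < t" "t < \<epsilon>" for t
    unfolding assms(3)[OF that] by (intro derivative_intros * that)
  ultimately show ?thesis unfolding logprim_def by blast
qed

lemma logprim_mono:
  assumes "logprim \<epsilon> N S g" "N \<le> N'" "S \<le> S'"
  shows "logprim \<epsilon> N' S' g"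
  using assms unfolding logprim_def by (meson loglead_le loglead_mono_log)

lemma logprimI:
  assumes "loglead \<epsilon> N S F q" "\<And>t. 0 < t \<Longrightarrow> t < \<epsilon> \<Longrightarrow> (F has_vector_derivative g t) (at t)"
  shows "logprim \<epsilon> N S g"
  using assms unfolding logprim_def by blast

lemma has_vector_derivative_ln_power:
  assumes "0 < t"
  shows "((\<lambda>t. complex_of_real (ln t) ^ s) has_vector_derivative of_nat s * of_real (ln t) ^ (s - 1) / of_real t) (at t)"
proof -
  have "((\<lambda>t. complex_of_real (ln t ^ s)) has_vector_derivative of_real (of_nat s * ln t ^ (s - 1) * (1 / t))) (at t)"
    using assms by (intro has_vector_derivative_of_real) (auto intro!: derivative_eq_intros simp: field_simps)
  then show ?thesis by simp
qed

text \<open>Integration by parts, by induction on the power s of the logarithm and, inside it, on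
  the pole order N. A positive pole order splits off k 0, so that only pure terms ln t ^ s / t ^ N
  have to be integrated directly; among these the order 1 alone raises the power of the
  logarithm.\<close>

lemma logprim_monomial:
  assumes "\<epsilon> > 0" "k holomorphic_on ball 0 \<epsilon>"
  shows "logprim \<epsilon> N (Suc s) (\<lambda>t. k (of_real t) * of_real (ln t) ^ s / of_real t ^ N)"
  using assms(2)
proof (induction s arbitrary: N k)
  have zero: "logprim \<epsilon> N S (\<lambda>_. 0)" for N S
    by (rule logprimI[OF loglead_zero]) auto
  have pow: "((\<lambda>t. 1 / complex_of_real t ^ Suc N) has_vector_derivative - of_nat (Suc N) / of_real t ^ Suc (Suc N)) (at t)"
    if "0 < t" for t N
  proof (rule has_vector_derivative_real_field)
    have *: "(- 1 - of_nat N) * z ^ N = - (z ^ N) - of_nat N * z ^ (N - Suc 0) * z" for z :: complex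
      by (cases N) (auto simp: algebra_simps)
    show "((\<lambda>z. 1 / z ^ Suc N) has_field_derivative - of_nat (Suc N) / of_real t ^ Suc (Suc N)) (at (complex_of_real t))"
      using that by (auto intro!: derivative_eq_intros simp: divide_simps *)
  qed
  \<comment> \<open>The factor \<open>of_nat s\<close> in the hypothesis lets one argument serve the
    base case as well: for s = 0 the hypothesis is about the zero function, and the truncated s - 1
    is harmless.\<close>
  have step: "logprim \<epsilon> N (Suc s) (\<lambda>t. k (of_real t) * of_real (ln t) ^ s / of_real t ^ N)"
    if IH: "\<And>k N. k holomorphic_on ball 0 \<epsilon> \<Longrightarrow>
       logprim \<epsilon> N (Suc s) (\<lambda>t. of_nat s * (k (of_real t) * of_real (ln t) ^ (s - 1) / of_real t ^ N))"
      and k: "k holomorphic_on ball 0 \<epsilon>"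
    for s N k
    using k
  proof (induction N arbitrary: k)
    case 0
    obtain K0 where K0: "\<And>z. z \<in> ball 0 \<epsilon> \<Longrightarrow> (K0 has_field_derivative k z) (at z within ball 0 \<epsilon>)"
      using holomorphic_convex_primitive'[OF convex_ball open_ball 0] by metis
    \<comment> \<open>The primitive is normalised to vanish at 0, so that K z / z, which integration
      by parts produces, is again holomorphic.\<close>
    define K where "K z = K0 z - K0 0" for z
    have K: "(K has_field_derivative k z) (at z)" if "z \<in> ball 0 \<epsilon>" for z
      unfolding K_def using K0[OF that] that
      by (auto intro!: derivative_eq_intros simp: at_within_open[OF that open_ball])
    have hK: "K holomorphic_on ball 0 \<epsilon>" using K by (metis holomorphic_onI field_differentiable_def field_differentiable_at_within)
    obtain K1 where K1: "K1 holomorphic_on ball 0 \<epsilon>" "\<And>z. K z = K 0 + z * K1 z"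
      using holomorphic_divide_linear[OF hK] by metis
    obtain q where "loglead \<epsilon> 0 s (\<lambda>t. K (of_real t) * of_real (ln t) ^ s / of_real t ^ 0) q"
      using loglead_monomial[OF hK] by blast
    then have "loglead \<epsilon> 0 (Suc s) (\<lambda>t. K (of_real t) * of_real (ln t) ^ s) q"
      using loglead_mono_log[of \<epsilon> 0 s _ q "Suc s"] by simp
    moreover have "((\<lambda>t. K (of_real t) * of_real (ln t) ^ s) has_vector_derivative
       K (of_real t) * (of_nat s * of_real (ln t) ^ (s - 1) / of_real t) + k (of_real t) * of_real (ln t) ^ s) (at t)"
      if "0 < t" "t < \<epsilon>" for t
      by (intro has_vector_derivative_mult has_vector_derivative_real_field K has_vector_derivative_ln_power)
         (use that in auto)
    ultimately have A: "logprim \<epsilon> 0 (Suc s) (\<lambda>t. K (of_real t) * (of_nat s * of_real (ln t) ^ (s - 1) / of_real t) + k (of_real t) * of_real (ln t) ^ s)"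
      by (rule logprimI)
    have KK1: "K z = z * K1 z" for z using K1(2)[of z] by (simp add: K_def)
    show ?case
    proof (rule logprim_lincomb[OF A IH[OF K1(1), of 0]])
      fix t :: real assume "0 < t"
      then show "k (of_real t) * of_real (ln t) ^ s / of_real t ^ 0 = 1 * (K (of_real t) * (of_nat s * of_real (ln t) ^ (s - 1) / of_real t)
        + k (of_real t) * of_real (ln t) ^ s) + (-1) * (of_nat s * (K1 (of_real t) * of_real (ln t) ^ (s - 1) / of_real t ^ 0))"
        by (simp add: KK1)
    qed
  next
    case (Suc N)
    obtain k1 where k1: "k1 holomorphic_on ball 0 \<epsilon>" "\<And>z. k z = k 0 + z * k1 z"
      using holomorphic_divide_linear[OF Suc.prems] by metis
    have A: "logprim \<epsilon> (Suc N) (Suc s) (\<lambda>t. k1 (of_real t) * of_real (ln t) ^ s / of_real t ^ N)"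
      using logprim_mono[OF Suc.IH[OF k1(1)]] by simp
    have B: "logprim \<epsilon> (Suc N) (Suc s) (\<lambda>t. of_real (ln t) ^ s / of_real t ^ Suc N)"
    proof (cases N)
      case 0
      \<comment> \<open>For 1 / t the primitive of ln t ^ s / t is ln t ^ (s + 1) / (s + 1). This is
        why the number of logarithms must be allowed to grow.\<close>
      obtain q where q: "loglead \<epsilon> 0 (Suc s) (\<lambda>t. 1 * of_real (ln t) ^ Suc s / of_real t ^ 0) q"
        using loglead_monomial[of "\<lambda>_. 1" \<epsilon> 0 "Suc s"] by auto
      define c where "c = (of_nat (Suc s) :: complex)"
      have c: "c \<noteq> 0" unfolding c_def by (rule of_nat_neq_0)
      have "((\<lambda>t. 1 * of_real (ln t) ^ Suc s / of_real t ^ 0) has_vector_derivative c * of_real (ln t) ^ s / of_real t) (at t)"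
        if "0 < t" "t < \<epsilon>" for t
        using has_vector_derivative_ln_power[OF that(1), of "Suc s"] unfolding c_def power_0 mult_1 div_by_1 diff_Suc_1 .
      then have "logprim \<epsilon> 0 (Suc s) (\<lambda>t. c * of_real (ln t) ^ s / of_real t)"
        by (rule logprimI[OF q])
      then have A: "logprim \<epsilon> (Suc N) (Suc s) (\<lambda>t. c * of_real (ln t) ^ s / of_real t)"
        by (rule logprim_mono) auto
      show ?thesis
      proof (rule logprim_lincomb[OF A zero])
        show "of_real (ln t) ^ s / of_real t ^ Suc N = (1 / c) * (c * of_real (ln t) ^ s / of_real t) + 0 * 0" for t
          using c 0 by simp
      qed
    next
      case (Suc n)
      \<comment> \<open>For pole order at least 2 the power of t is integrated instead, and the
        boundary term keeps the power s of the logarithm.\<close>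
      obtain q where q: "loglead \<epsilon> N s (\<lambda>t. of_real (ln t) ^ s * (1 / of_real t ^ Suc n)) q"
      proof -
        obtain q where q: "loglead \<epsilon> N s (\<lambda>t. 1 * of_real (ln t) ^ s / of_real t ^ N) q"
          using loglead_monomial[of "\<lambda>_. 1" \<epsilon> N s] by auto
        have "1 * of_real (ln t) ^ s / of_real t ^ N = complex_of_real (ln t) ^ s * (1 / of_real t ^ Suc n)" for t
          unfolding Suc by simp
        from loglead_cong[OF q this] show ?thesis by (rule that)
      qed
      have C: "((\<lambda>t. complex_of_real (ln t) ^ s * (1 / of_real t ^ Suc n)) has_vector_derivative
          of_real (ln t) ^ s * (- of_nat N / of_real t ^ Suc N) + (of_nat s * of_real (ln t) ^ (s - 1) / of_real t) * (1 / of_real t ^ N)) (at t)"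
        if "0 < t" "t < \<epsilon>" for t
      proof -
        note C1 = has_vector_derivative_ln_power[OF that(1), of s]
        have C2: "((\<lambda>t. 1 / complex_of_real t ^ Suc n) has_vector_derivative - of_nat (Suc n) / of_real t ^ Suc (Suc n)) (at t)"
          by (rule pow[OF that(1)])
        show ?thesis unfolding Suc by (rule has_vector_derivative_mult[OF C1 C2])
      qed
      define c where "c = (of_nat N :: complex)"
      have c: "c \<noteq> 0" unfolding c_def Suc by (rule of_nat_neq_0)
      have D: "logprim \<epsilon> (Suc N) (Suc s) (\<lambda>t. of_real (ln t) ^ s * (- c / of_real t ^ Suc N) + (of_nat s * of_real (ln t) ^ (s - 1) / of_real t) * (1 / of_real t ^ N))"
        unfolding c_def by (rule logprim_mono[OF logprimI[OF q C]]) auto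
      have E: "logprim \<epsilon> (Suc N) (Suc s) (\<lambda>t. of_nat s * (1 * of_real (ln t) ^ (s - 1) / of_real t ^ Suc N))"
        using IH[of "\<lambda>_. 1" "Suc N"] by simp
      show ?thesis
      proof (rule logprim_lincomb[OF D E])
        show "of_real (ln t) ^ s / of_real t ^ Suc N = (- 1 / c) * (of_real (ln t) ^ s * (- c / of_real t ^ Suc N)
             + (of_nat s * of_real (ln t) ^ (s - 1) / of_real t) * (1 / of_real t ^ N))
             + (1 / c) * (of_nat s * (1 * of_real (ln t) ^ (s - 1) / of_real t ^ Suc N))" for t
          using c by (simp add: distrib_left diff_divide_distrib)
      qed
    qed
    show ?case
    proof (rule logprim_lincomb[OF A B])
      fix t :: real assume "0 < t"
      define a where "a = complex_of_real (ln t) ^ s"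
      define b where "b = complex_of_real t ^ N"
      define z where "z = complex_of_real t"
      have "(k 0 + z * k1 z) * a / (z * b) = 1 * (k1 z * a / b) + k 0 * (a / (z * b))"
        using \<open>0 < t\<close> by (simp add: z_def add_divide_distrib distrib_right)
      then show "k (of_real t) * of_real (ln t) ^ s / of_real t ^ Suc N
        = 1 * (k1 (of_real t) * of_real (ln t) ^ s / of_real t ^ N) + k 0 * (of_real (ln t) ^ s / of_real t ^ Suc N)"
        using k1(2)[of z] by (simp add: a_def b_def z_def)
    qed
  qed
  {
    case 0
    show ?case by (rule step[OF _ 0]) (use zero in simp)
  next
    case (Suc s)
    show ?case
    proof (rule step[OF _ Suc.prems])
      fix k N assume "k holomorphic_on ball 0 \<epsilon>"
      then have A: "logprim \<epsilon> N (Suc (Suc s)) (\<lambda>t. k (of_real t) * of_real (ln t) ^ s / of_real t ^ N)"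
        using logprim_mono[OF Suc.IH] by simp
      show "logprim \<epsilon> N (Suc (Suc s)) (\<lambda>t. of_nat (Suc s) * (k (of_real t) * of_real (ln t) ^ (Suc s - 1) / of_real t ^ N))"
      proof (rule logprim_lincomb[OF A zero])
        show "of_nat (Suc s) * (k (of_real t) * of_real (ln t) ^ (Suc s - 1) / of_real t ^ N)
          = of_nat (Suc s) * (k (of_real t) * of_real (ln t) ^ s / of_real t ^ N) + 0 * 0" for t by simp
      qed
    qed
  }
qed

text \<open>The given f differs from the sum of the termwise primitives by a function with zero
  derivative on the interval, hence by a constant, and a constant has an expansion too. One
  integration thus adds one logarithm and leaves the bound on the pole unchanged.\<close>

lemma loglead_antideriv:
  assumes "\<epsilon> > 0" "loglead \<epsilon> N S g q"
    and der: "\<And>t. 0 < t \<Longrightarrow> t < \<epsilon> \<Longrightarrow> (f has_vector_derivative g t) (at t)"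
  shows "\<exists>q. loglead \<epsilon> N (Suc S) f q"
proof -
  obtain h where h: "loglaurent \<epsilon> N S g h" using assms unfolding loglead_def by auto
  have "logprim \<epsilon> N (Suc S) (\<lambda>t. h s (of_real t) * of_real (ln t) ^ s / of_real t ^ N)" if "s \<le> S" for s
    by (rule logprim_mono[OF logprim_monomial]) (use assms(1) h that in \<open>auto simp: loglaurent_def\<close>)
  then obtain F r where F: "\<And>s. s \<le> S \<Longrightarrow> loglead \<epsilon> N (Suc S) (F s) (r s)"
    "\<And>s t. s \<le> S \<Longrightarrow> 0 < t \<Longrightarrow> t < \<epsilon> \<Longrightarrow> (F s has_vector_derivative h s (of_real t) * of_real (ln t) ^ s / of_real t ^ N) (at t)"
    unfolding logprim_def by metis
  have "loglead \<epsilon> N (Suc S) (\<lambda>t. \<Sum>s\<le>S. F s t) (\<lambda>i. \<Sum>s\<le>S. r s i)"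
    by (intro loglead_sum F) auto
  have derF: "((\<lambda>t. f t - (\<Sum>s\<le>S. F s t)) has_vector_derivative 0) (at t)" if t: "0 < t" "t < \<epsilon>" for t
  proof -
    have "g t = (\<Sum>s\<le>S. h s (of_real t) * of_real (ln t) ^ s) / of_real t ^ N"
      using h t unfolding loglaurent_def by (simp add: field_simps)
    also have "\<dots> = (\<Sum>s\<le>S. h s (of_real t) * of_real (ln t) ^ s / of_real t ^ N)"
      by (simp add: sum_divide_distrib)
    finally have g: "g t = \<dots>" .
    have "((\<lambda>t. f t - (\<Sum>s\<le>S. F s t)) has_vector_derivative g t - (\<Sum>s\<le>S. h s (of_real t) * of_real (ln t) ^ s / of_real t ^ N)) (at t)"
      by (intro derivative_intros der F t) auto
    then show ?thesis unfolding g by simp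
  qed
  have D: "((\<lambda>t. f t - (\<Sum>s\<le>S. F s t)) has_vector_derivative 0) (at t within {0<..<\<epsilon>})"
    if "t \<in> {0<..<\<epsilon>}" for t
    by (rule has_vector_derivative_at_within[OF derF]) (use that in auto)
  have "\<exists>c. \<forall>t\<in>{0<..<\<epsilon>}. f t - (\<Sum>s\<le>S. F s t) = c"
    by (rule has_vector_derivative_zero_constant[OF convex_real_interval(8) D]) blast+
  then obtain c where "\<And>t. t \<in> {0<..<\<epsilon>} \<Longrightarrow> f t - (\<Sum>s\<le>S. F s t) = c"
    by blast
  then have c: "\<And>t. 0 < t \<Longrightarrow> t < \<epsilon> \<Longrightarrow> f t = (\<Sum>s\<le>S. F s t) + c"
    by (metis add.commute diff_add_cancel greaterThanLessThan_iff)
  have "loglead \<epsilon> 0 (Suc S) (\<lambda>_. c) (\<lambda>s. if s = 0 then c else 0)"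
    by (rule loglead_holomorphic[of "\<lambda>_. c"]) auto
  then obtain r' where r': "loglead \<epsilon> N (Suc S) (\<lambda>_. c) r'" using loglead_le by blast
  have "loglead \<epsilon> N (Suc S) (\<lambda>t. (\<Sum>s\<le>S. F s t) + c) (\<lambda>i. (\<Sum>s\<le>S. r s i) + r' i)"
    by (intro loglead_add) fact+
  from loglead_cong[OF this c[symmetric]] show ?thesis by blast
qed

section \<open>Directional derivatives of smooth functions\<close>

text \<open>Unlike a directional derivative defined as a limit, this combination of partial derivatives is linear
  in the direction without any assumption on \<open>f\<close>.\<close>

definition dd :: "real ^ 'n \<Rightarrow> (real ^ 'n \<Rightarrow> complex) \<Rightarrow> real ^ 'n \<Rightarrow> complex" where
  "dd v f x = (\<Sum>i\<in>UNIV. of_real (v $ i) * partial_deriv i f x)"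

lemma partial_deriv_eq_dd: "partial_deriv i f = dd (axis i 1) f"
  by (auto simp: dd_def axis_def if_distrib if_distribR sum.delta cong: if_cong)

lemma partial_deriv_has_derivative:
  assumes "(f has_derivative f') (at x)"
  shows "partial_deriv i f x = f' (axis i 1)"
proof -
  have "((\<lambda>t::real. x + t *\<^sub>R axis i 1) has_derivative (\<lambda>t. t *\<^sub>R axis i 1)) (at 0)"
    by (auto intro!: derivative_eq_intros)
  then have "((\<lambda>t. f (x + t *\<^sub>R axis i 1)) has_derivative (\<lambda>t. f' (t *\<^sub>R axis i 1))) (at 0)"
    by (rule has_derivative_compose) (use assms in simp)
  moreover have "f' (t *\<^sub>R v) = t *\<^sub>R f' v" for t v
    using assms has_derivative_linear linear_scale by blast
  ultimately have "((\<lambda>t. f (x + t *\<^sub>R axis i 1)) has_vector_derivative f' (axis i 1)) (at 0)"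
    by (simp add: has_vector_derivative_def)
  then show ?thesis unfolding partial_deriv_def by (rule vector_derivative_at)
qed

lemma dd_has_derivative:
  assumes "(f has_derivative f') (at x)"
  shows "dd v f x = f' v"
proof -
  have lin: "linear f'" using assms has_derivative_linear by blast
  have "v = (\<Sum>i\<in>UNIV. v $ i *\<^sub>R axis i 1)"
    by (simp add: vec_eq_iff axis_def if_distrib sum.delta' cong: if_cong)
  then have "f' v = f' (\<Sum>i\<in>UNIV. v $ i *\<^sub>R axis i 1)"
    by (rule arg_cong)
  also have "\<dots> = (\<Sum>i\<in>UNIV. v $ i *\<^sub>R f' (axis i 1))"
    by (simp add: linear_sum[OF lin] linear_scale[OF lin])
  finally show ?thesis
    unfolding dd_def partial_deriv_has_derivative[OF assms] by (simp add: scaleR_conv_of_real)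
qed

lemma differentiable_imp_has_derivative_dd:
  assumes "f differentiable at x"
  shows "(f has_derivative (\<lambda>v. dd v f x)) (at x)"
proof -
  obtain f' where f': "(f has_derivative f') (at x)" using assms unfolding differentiable_def by auto
  then have "(\<lambda>v. dd v f x) = f'" using dd_has_derivative by blast
  then show ?thesis using f' by simp
qed

lemma dd_cong_open:
  assumes "open S" "x \<in> S" "\<And>z. z \<in> S \<Longrightarrow> f z = g z"
  shows "dd v f x = dd v g x"
proof -
  have "partial_deriv i f x = partial_deriv i g x" for i
  proof -
    have "((\<lambda>t. x + t *\<^sub>R axis i 1) \<longlongrightarrow> x + 0 *\<^sub>R axis i 1) (nhds (0::real))"
      by (intro tendsto_intros filterlim_ident)
    then have "\<forall>\<^sub>F t in nhds (0::real). x + t *\<^sub>R axis i 1 \<in> S"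
      using topological_tendstoD[OF _ assms(1)] assms(2) by simp
    then have "\<forall>\<^sub>F t in nhds (0::real). f (x + t *\<^sub>R axis i 1) = g (x + t *\<^sub>R axis i 1)"
      by (rule eventually_mono) (use assms(3) in blast)
    then show ?thesis unfolding partial_deriv_def
      by (intro vector_derivative_cong_eq) (auto simp: eventually_nhds_conv_at)
  qed
  then show ?thesis by (simp add: dd_def)
qed

section \<open>Smoothness by coinduction\<close>

lemma partials_simps [simp]:
  "partials [] f = f" "partials (i # js) f = partial_deriv i (partials js f)"
  by (simp_all add: partials_def)

lemma partials_append: "partials (is @ js) f = partials is (partials js f)"
  by (simp add: partials_def)

text \<open>A class closed under partial derivatives consists of smooth functions. Closure is only
  required up to equality on S, because functions are total and formulas for derivatives hold on S
  only; openness of S lets the derivatives follow this equality.\<close>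

lemma smooth_on_coinduct:
  assumes "open S" "Q f"
    and step: "\<And>f. Q f \<Longrightarrow> f differentiable_on S \<and> (\<forall>i. \<exists>g. Q g \<and> (\<forall>x\<in>S. partial_deriv i f x = g x))"
  shows "smooth_on S f"
  unfolding smooth_on_def
proof
  fix js
  have "\<exists>g. Q g \<and> (\<forall>x\<in>S. partials js f x = g x)"
  proof (induction js)
    case Nil
    then show ?case using \<open>Q f\<close> by auto
  next
    case (Cons j js)
    then obtain g where g: "Q g" "\<forall>x\<in>S. partials js f x = g x" by auto
    obtain g' where g': "Q g'" "\<forall>x\<in>S. partial_deriv j g x = g' x" using step[OF g(1)] by auto
    have "partials (j # js) f x = g' x" if "x \<in> S" for x
      using g' dd_cong_open[OF \<open>open S\<close> that, of "partials js f" g "axis j 1"] g(2) that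
      by (simp add: partial_deriv_eq_dd)
    then show ?case using g'(1) by auto
  qed
  then obtain g where g: "Q g" "\<forall>x\<in>S. partials js f x = g x" by auto
  have "g differentiable_on S" using step[OF g(1)] by auto
  then show "partials js f differentiable_on S"
    using g(2) unfolding differentiable_on_def differentiable_def
    by (metis has_derivative_transform)
qed

lemma smooth_on_partial_deriv: "smooth_on S f \<Longrightarrow> smooth_on S (partial_deriv i f)"
  unfolding smooth_on_def using partials_append[of _ "[i]" f] by (metis partials_simps)

lemma smooth_on_differentiable: "smooth_on S f \<Longrightarrow> f differentiable_on S"
  unfolding smooth_on_def by (metis partials_simps(1))

lemma smooth_on_has_derivative:
  assumes "open S" "smooth_on S f" "x \<in> S"
  shows "(f has_derivative (\<lambda>v. dd v f x)) (at x)"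
  using assms smooth_on_differentiable differentiable_imp_has_derivative_dd
  by (metis at_within_open differentiable_on_def)

text \<open>The derivative of a product is a sum of products, so products alone are not invariant.
  Closing under both operations at once gives a class to which \<open>smooth_on_coinduct\<close>
  applies.\<close>

inductive ring_closure :: "((real ^ 'n \<Rightarrow> complex) \<Rightarrow> bool) \<Rightarrow> (real ^ 'n \<Rightarrow> complex) \<Rightarrow> bool"
  for Q :: "(real ^ 'n \<Rightarrow> complex) \<Rightarrow> bool" where
  base: "Q f \<Longrightarrow> ring_closure Q f"
| plus: "ring_closure Q f \<Longrightarrow> ring_closure Q g \<Longrightarrow> ring_closure Q (\<lambda>x. f x + g x)"
| times: "ring_closure Q f \<Longrightarrow> ring_closure Q g \<Longrightarrow> ring_closure Q (\<lambda>x. f x * g x)"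

lemma differentiable_onD_open:
  assumes "open S" "f differentiable_on S" "x \<in> S"
  shows "(f has_derivative (\<lambda>v. dd v f x)) (at x)"
  using assms differentiable_imp_has_derivative_dd by (metis at_within_open differentiable_on_def)

lemma smooth_on_ring_closure:
  fixes f :: "real ^ 'n \<Rightarrow> complex"
  assumes "open S" "ring_closure (smooth_on S) f"
  shows "smooth_on S f"
  using assms
proof (rule smooth_on_coinduct)
  fix f :: "real ^ 'n \<Rightarrow> complex" assume "ring_closure (smooth_on S) f"
  then show "f differentiable_on S \<and> (\<forall>i. \<exists>g. ring_closure (smooth_on S) g \<and> (\<forall>x\<in>S. partial_deriv i f x = g x))"
  proof induction
    case (base f)
    then show ?case using smooth_on_partial_deriv ring_closure.base smooth_on_differentiable by blast
  next
    case (plus f g)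
    have d: "((\<lambda>x. f x + g x) has_derivative (\<lambda>v. dd v f x + dd v g x)) (at x)" if "x \<in> S" for x
      by (intro derivative_intros differentiable_onD_open[OF \<open>open S\<close> _ that]) (use plus in auto)
    then have "(\<lambda>x. f x + g x) differentiable_on S"
      using plus by (auto intro: differentiable_on_add)
    moreover have "\<exists>h. ring_closure (smooth_on S) h \<and> (\<forall>x\<in>S. partial_deriv i (\<lambda>x. f x + g x) x = h x)" for i
    proof -
      obtain f' g' where "ring_closure (smooth_on S) f'" "\<forall>x\<in>S. partial_deriv i f x = f' x"
        "ring_closure (smooth_on S) g'" "\<forall>x\<in>S. partial_deriv i g x = g' x"
        using plus.IH by metis
      moreover have "partial_deriv i (\<lambda>x. f x + g x) x = partial_deriv i f x + partial_deriv i g x" if "x \<in> S" for x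
        using partial_deriv_has_derivative[OF d[OF that], of i] by (simp flip: partial_deriv_eq_dd)
      ultimately show ?thesis
        by (intro exI[of _ "\<lambda>x. f' x + g' x"]) (simp add: ring_closure.plus)
    qed
    ultimately show ?case by blast
  next
    case (times f g)
    have d: "((\<lambda>x. f x * g x) has_derivative (\<lambda>v. f x * dd v g x + dd v f x * g x)) (at x)" if "x \<in> S" for x
      by (intro has_derivative_mult differentiable_onD_open[OF \<open>open S\<close> _ that]) (use times in auto)
    then have "(\<lambda>x. f x * g x) differentiable_on S"
      using times by (auto intro: differentiable_on_mult)
    moreover have "\<exists>h. ring_closure (smooth_on S) h \<and> (\<forall>x\<in>S. partial_deriv i (\<lambda>x. f x * g x) x = h x)" for i
    proof -
      obtain f' g' where "ring_closure (smooth_on S) f'" "\<forall>x\<in>S. partial_deriv i f x = f' x"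
        "ring_closure (smooth_on S) g'" "\<forall>x\<in>S. partial_deriv i g x = g' x"
        using times.IH by metis
      moreover have "partial_deriv i (\<lambda>x. f x * g x) x = f x * partial_deriv i g x + partial_deriv i f x * g x" if "x \<in> S" for x
        using partial_deriv_has_derivative[OF d[OF that], of i] by (simp flip: partial_deriv_eq_dd)
      ultimately show ?thesis using times.hyps
        by (intro exI[of _ "\<lambda>x. f x * g' x + f' x * g x"]) (simp add: ring_closure.plus ring_closure.times)
    qed
    ultimately show ?case by blast
  qed
qed

lemma smooth_on_add:
  assumes "open S" "smooth_on S f" "smooth_on S g"
  shows "smooth_on S (\<lambda>x. f x + g x)"
  by (rule smooth_on_ring_closure[OF assms(1) ring_closure.plus[OF ring_closure.base ring_closure.base]]) fact+

lemma smooth_on_mult: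
  assumes "open S" "smooth_on S f" "smooth_on S g"
  shows "smooth_on S (\<lambda>x. f x * g x)"
  by (rule smooth_on_ring_closure[OF assms(1) ring_closure.times[OF ring_closure.base ring_closure.base]]) fact+

lemma smooth_on_const: "open S \<Longrightarrow> smooth_on S (\<lambda>_. c)"
  by (rule smooth_on_coinduct[of _ "\<lambda>f. \<exists>c. f = (\<lambda>_. c)"])
     (auto simp: partial_deriv_has_derivative[OF has_derivative_const])

lemma smooth_on_sum:
  assumes "open S" "\<And>i. i \<in> I \<Longrightarrow> smooth_on S (f i)"
  shows "smooth_on S (\<lambda>x. \<Sum>i\<in>I. f i x)"
  using assms(2) by (induction I rule: infinite_finite_induct)
    (auto intro: smooth_on_const smooth_on_add assms(1))

lemma smooth_on_subset: "smooth_on S f \<Longrightarrow> T \<subseteq> S \<Longrightarrow> smooth_on T f"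
  unfolding smooth_on_def using differentiable_on_subset by blast

lemma smooth_on_dd:
  assumes "open S" "smooth_on S f"
  shows "smooth_on S (dd v f)"
  using assms unfolding dd_def[abs_def]
  by (intro smooth_on_sum smooth_on_mult smooth_on_const smooth_on_partial_deriv)

lemma smooth_on_cong:
  assumes "open S" "smooth_on S f" "\<And>x. x \<in> S \<Longrightarrow> f x = g x"
  shows "smooth_on S g"
  using assms(1)
proof (rule smooth_on_coinduct[of _ "\<lambda>g. \<exists>f. smooth_on S f \<and> (\<forall>x\<in>S. f x = g x)"])
  show "\<exists>f. smooth_on S f \<and> (\<forall>x\<in>S. f x = g x)" using assms by blast
  fix g assume "\<exists>f. smooth_on S f \<and> (\<forall>x\<in>S. f x = g x)"
  then obtain f where f: "smooth_on S f" "\<And>x. x \<in> S \<Longrightarrow> f x = g x" by auto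
  have "g differentiable_on S" using smooth_on_differentiable[OF f(1)] f(2)
    unfolding differentiable_on_def differentiable_def by (metis has_derivative_transform)
  moreover have "partial_deriv i f x = partial_deriv i g x" if "x \<in> S" for x i
    using dd_cong_open[OF \<open>open S\<close> that f(2)] by (simp add: partial_deriv_eq_dd)
  ultimately show "g differentiable_on S \<and> (\<forall>i. \<exists>h. (\<exists>f. smooth_on S f \<and> (\<forall>x\<in>S. f x = h x)) \<and> (\<forall>x\<in>S. partial_deriv i g x = h x))"
    using smooth_on_partial_deriv[OF f(1)] by metis
qed

lemma dd_add:
  assumes "open S" "smooth_on S f" "smooth_on S g" "x \<in> S"
  shows "dd v (\<lambda>x. f x + g x) x = dd v f x + dd v g x"
  by (rule dd_has_derivative) (intro derivative_intros smooth_on_has_derivative[OF assms(1)] assms)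

lemma dd_mult:
  assumes "open S" "smooth_on S f" "smooth_on S g" "x \<in> S"
  shows "dd v (\<lambda>x. f x * g x) x = f x * dd v g x + dd v f x * g x"
  by (rule dd_has_derivative) (intro has_derivative_mult smooth_on_has_derivative[OF assms(1)] assms)

lemma dd_const [simp]: "dd v (\<lambda>_. c) x = 0"
  by (rule dd_has_derivative) simp

lemma dd_cmult:
  assumes "open S" "smooth_on S f" "x \<in> S"
  shows "dd v (\<lambda>x. c * f x) x = c * dd v f x"
  using dd_mult[OF assms(1) smooth_on_const assms(2,3)] assms(1) by simp

lemma dd_sum:
  assumes "open S" "\<And>i. i \<in> I \<Longrightarrow> smooth_on S (f i)" "x \<in> S"
  shows "dd v (\<lambda>x. \<Sum>i\<in>I. f i x) x = (\<Sum>i\<in>I. dd v (f i) x)"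
  by (rule dd_has_derivative) (intro derivative_intros smooth_on_has_derivative[OF assms(1)] assms)

lemma dd_vector_add: "dd (v + w) f x = dd v f x + dd w f x"
  by (simp add: dd_def ring_distribs sum.distrib)

lemma dd_vector_scale: "dd (c *\<^sub>R v) f x = of_real c * dd v f x"
  by (simp add: dd_def sum_distrib_left mult.assoc)

lemma dd_vector_sum: "dd (\<Sum>i\<in>I. v i) f x = (\<Sum>i\<in>I. dd (v i) f x)"
  by (simp add: dd_def sum_distrib_right) (rule sum.swap)

section \<open>Symmetry of second derivatives\<close>

text \<open>The mean value inequality is applied to the difference of two increments of f in
  direction v. Both derivatives that occur are compared with f' x v through the linearisation G at
  x, and their difference is s G u up to a small multiple of s.\<close>

lemma second_difference_bound:
  fixes f :: "'a::real_normed_vector \<Rightarrow> 'b::real_normed_vector"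
  assumes "open S" "x \<in> S" "e > 0"
    and der: "\<And>z. z \<in> S \<Longrightarrow> (f has_derivative f' z) (at z)"
    and der2: "((\<lambda>z. f' z v) has_derivative G) (at x)"
  shows "\<exists>d>0. \<forall>s. 0 < s \<and> s < d \<longrightarrow>
     norm (f (x + s *\<^sub>R u + s *\<^sub>R v) - f (x + s *\<^sub>R u) - f (x + s *\<^sub>R v) + f x - (s * s) *\<^sub>R G u) \<le> e * (s * s)"
proof -
  \<comment> \<open>Each of the two comparisons costs e' s (norm u + norm v), so e' = e / K leaves a
    total of at most e s; the summand 1 keeps K positive when u and v are 0.\<close>
  define K where "K = 2 * (norm u + norm v) + 1"
  have "K > 0" by (auto simp: K_def intro: add_nonneg_pos)
  define e' where "e' = e / K"
  have "e' > 0" using \<open>K > 0\<close> \<open>e > 0\<close> by (simp add: e'_def)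
  have linG: "linear G" using der2 has_derivative_linear by blast
  obtain d1 where d1: "d1 > 0" "\<And>z. norm (z - x) < d1 \<Longrightarrow> norm (f' z v - f' x v - G (z - x)) \<le> e' * norm (z - x)"
    using der2 \<open>e' > 0\<close> unfolding has_derivative_at_alt by blast
  obtain d2 where d2: "d2 > 0" "ball x d2 \<subseteq> S" using assms(1,2) openE by blast
  define d where "d = min d1 d2 / K"
  have "d > 0" using \<open>K > 0\<close> d1 d2 by (simp add: d_def)
  moreover have "norm (f (x + s *\<^sub>R u + s *\<^sub>R v) - f (x + s *\<^sub>R u) - f (x + s *\<^sub>R v) + f x - (s * s) *\<^sub>R G u) \<le> e * (s * s)"
    if s: "0 < s" "s < d" for s
  proof -
    have sK: "s * K < d1" "s * K < d2" using s \<open>K > 0\<close> by (auto simp: d_def field_simps)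
    have n1: "norm (s *\<^sub>R u + t *\<^sub>R v) \<le> s * (norm u + norm v)" "norm (t *\<^sub>R v) \<le> s * (norm u + norm v)" if "t \<in> {0..s}" for t
    proof -
      have "norm (s *\<^sub>R u + t *\<^sub>R v) \<le> s * norm u + t * norm v"
        using norm_triangle_ineq[of "s *\<^sub>R u" "t *\<^sub>R v"] s that by simp
      also have "\<dots> \<le> s * (norm u + norm v)" using that by (simp add: ring_distribs mult_right_mono)
      finally show "norm (s *\<^sub>R u + t *\<^sub>R v) \<le> s * (norm u + norm v)" .
      have "t * norm v \<le> s * norm v" using that by (simp add: mult_right_mono)
      then show "norm (t *\<^sub>R v) \<le> s * (norm u + norm v)" using that s by (simp add: ring_distribs add_increasing)
    qed
    have lt: "s * (norm u + norm v) < d1" "s * (norm u + norm v) < d2"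
    proof -
      have "s * (norm u + norm v) \<le> s * K" using s by (intro mult_left_mono) (auto simp: K_def)
      then show "s * (norm u + norm v) < d1" "s * (norm u + norm v) < d2" using sK by auto
    qed
    have inS: "x + h \<in> S" if "norm h < d2" for h
    proof -
      have "x + h \<in> ball x d2" using that by (simp add: dist_norm)
      then show ?thesis using d2(2) by blast
    qed
    have n2: "norm (s *\<^sub>R u + t *\<^sub>R v) < d2" "norm (t *\<^sub>R v) < d2" "norm (s *\<^sub>R u + t *\<^sub>R v) < d1" "norm (t *\<^sub>R v) < d1"
      if "t \<in> {0..s}" for t
      using n1(1)[OF that] n1(2)[OF that] lt by linarith+
    have in1: "x + s *\<^sub>R u + t *\<^sub>R v \<in> S" "x + t *\<^sub>R v \<in> S" if "t \<in> {0..s}" for t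
      using inS[OF n2(1)[OF that]] inS[OF n2(2)[OF that]] unfolding add.assoc .
    \<comment> \<open>The expected linear growth in t is subtracted in advance, so a bound on the
      derivative of \<phi> is already a bound on the error.\<close>
    define \<phi> where "\<phi> t = f (x + s *\<^sub>R u + t *\<^sub>R v) - f (x + t *\<^sub>R v) - (t * s) *\<^sub>R G u" for t
    have d\<phi>: "(\<phi> has_derivative (\<lambda>h. f' (x + s *\<^sub>R u + t *\<^sub>R v) (h *\<^sub>R v) - f' (x + t *\<^sub>R v) (h *\<^sub>R v) - (h * s) *\<^sub>R G u)) (at t within {0..s})"
      if t: "t \<in> {0..s}" for t
    proof -
      have L: "((\<lambda>t. z + t *\<^sub>R v) has_derivative (\<lambda>h. h *\<^sub>R v)) (at t within {0..s})" for z
        by (rule derivative_eq_intros refl)+ simp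
      have a: "((\<lambda>t. f (x + s *\<^sub>R u + t *\<^sub>R v)) has_derivative (\<lambda>h. f' (x + s *\<^sub>R u + t *\<^sub>R v) (h *\<^sub>R v))) (at t within {0..s})"
        by (rule has_derivative_compose[OF L der[OF in1(1)[OF t]]])
      have b: "((\<lambda>t. f (x + t *\<^sub>R v)) has_derivative (\<lambda>h. f' (x + t *\<^sub>R v) (h *\<^sub>R v))) (at t within {0..s})"
        by (rule has_derivative_compose[OF L der[OF in1(2)[OF t]]])
      show ?thesis unfolding \<phi>_def
        by (intro has_derivative_diff a b has_derivative_scaleR_left has_derivative_mult_left has_derivative_ident)
    qed
    have "norm (\<phi> s - \<phi> 0) \<le> (e' * (2 * (s * (norm u + norm v)))) * norm (s - 0)"
    proof (rule differentiable_bound[OF _ d\<phi>])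
      fix t assume t: "t \<in> {0..s}"
      have lin: "linear (f' (x + s *\<^sub>R u + t *\<^sub>R v))" "linear (f' (x + t *\<^sub>R v))"
        using has_derivative_linear[OF der[OF in1(1)[OF t]]] has_derivative_linear[OF der[OF in1(2)[OF t]]] .
      have z1: "norm (f' (x + s *\<^sub>R u + t *\<^sub>R v) v - f' x v - G (s *\<^sub>R u + t *\<^sub>R v)) \<le> e' * (s * (norm u + norm v))"
      proof -
        have "norm (f' (x + s *\<^sub>R u + t *\<^sub>R v) v - f' x v - G (s *\<^sub>R u + t *\<^sub>R v)) \<le> e' * norm (s *\<^sub>R u + t *\<^sub>R v)"
          using d1(2)[of "x + s *\<^sub>R u + t *\<^sub>R v"] n2(3)[OF t] by (simp add: algebra_simps)
        also have "\<dots> \<le> e' * (s * (norm u + norm v))" using n1(1)[OF t] \<open>e' > 0\<close> by (intro mult_left_mono) auto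
        finally show ?thesis .
      qed
      have z2: "norm (f' (x + t *\<^sub>R v) v - f' x v - G (t *\<^sub>R v)) \<le> e' * (s * (norm u + norm v))"
      proof -
        have "norm (f' (x + t *\<^sub>R v) v - f' x v - G (t *\<^sub>R v)) \<le> e' * norm (t *\<^sub>R v)"
          using d1(2)[of "x + t *\<^sub>R v"] n2(4)[OF t] by simp
        also have "\<dots> \<le> e' * (s * (norm u + norm v))" using n1(2)[OF t] \<open>e' > 0\<close> by (intro mult_left_mono) auto
        finally show ?thesis .
      qed
      have "f' (x + s *\<^sub>R u + t *\<^sub>R v) v - f' (x + t *\<^sub>R v) v - s *\<^sub>R G u
         = (f' (x + s *\<^sub>R u + t *\<^sub>R v) v - f' x v - G (s *\<^sub>R u + t *\<^sub>R v)) - (f' (x + t *\<^sub>R v) v - f' x v - G (t *\<^sub>R v))"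
        by (simp add: linear_add[OF linG] linear_scale[OF linG])
      then have "norm (f' (x + s *\<^sub>R u + t *\<^sub>R v) v - f' (x + t *\<^sub>R v) v - s *\<^sub>R G u)
         \<le> norm (f' (x + s *\<^sub>R u + t *\<^sub>R v) v - f' x v - G (s *\<^sub>R u + t *\<^sub>R v)) + norm (f' (x + t *\<^sub>R v) v - f' x v - G (t *\<^sub>R v))"
        by (metis norm_triangle_ineq4)
      then have n: "norm (f' (x + s *\<^sub>R u + t *\<^sub>R v) v - f' (x + t *\<^sub>R v) v - s *\<^sub>R G u) \<le> e' * (2 * (s * (norm u + norm v)))"
        using z1 z2 by linarith
      show "onorm (\<lambda>h. f' (x + s *\<^sub>R u + t *\<^sub>R v) (h *\<^sub>R v) - f' (x + t *\<^sub>R v) (h *\<^sub>R v) - (h * s) *\<^sub>R G u) \<le> e' * (2 * (s * (norm u + norm v)))"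
      proof (rule onorm_bound)
        show "0 \<le> e' * (2 * (s * (norm u + norm v)))" using \<open>e' > 0\<close> s by simp
        fix h :: real
        have "f' (x + s *\<^sub>R u + t *\<^sub>R v) (h *\<^sub>R v) - f' (x + t *\<^sub>R v) (h *\<^sub>R v) - (h * s) *\<^sub>R G u
          = h *\<^sub>R (f' (x + s *\<^sub>R u + t *\<^sub>R v) v - f' (x + t *\<^sub>R v) v - s *\<^sub>R G u)"
          by (simp add: linear_scale[OF lin(1)] linear_scale[OF lin(2)] scaleR_diff_right)
        then show "norm (f' (x + s *\<^sub>R u + t *\<^sub>R v) (h *\<^sub>R v) - f' (x + t *\<^sub>R v) (h *\<^sub>R v) - (h * s) *\<^sub>R G u) \<le> e' * (2 * (s * (norm u + norm v))) * norm h"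
          using n by (simp add: mult.commute mult_left_mono)
      qed
    qed (use s in auto)
    also have "\<dots> = e' * (2 * (norm u + norm v)) * (s * s)" using s by simp
    also have "\<dots> \<le> e' * K * (s * s)" using \<open>e' > 0\<close> s by (intro mult_right_mono mult_left_mono) (auto simp: K_def)
    also have "\<dots> = e * (s * s)" using \<open>K > 0\<close> by (simp add: e'_def)
    finally show ?thesis by (simp add: \<phi>_def algebra_simps)
  qed
  ultimately show ?thesis by blast
qed

text \<open>The second difference is symmetric in u and v, and after division by s * s it
  approximates both mixed derivatives with arbitrarily small error.\<close>

lemma symmetric_second_derivative:
  fixes f :: "'a::real_normed_vector \<Rightarrow> 'b::real_normed_vector"
  assumes "open S" "x \<in> S"
    and der: "\<And>z. z \<in> S \<Longrightarrow> (f has_derivative f' z) (at z)"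
    and Gv: "((\<lambda>z. f' z v) has_derivative Gv) (at x)"
    and Gu: "((\<lambda>z. f' z u) has_derivative Gu) (at x)"
  shows "Gv u = Gu v"
proof -
  have "norm (Gv u - Gu v) \<le> 2 * e" if e: "e > 0" for e
  proof -
    obtain d1 where d1: "d1 > 0" "\<And>s. 0 < s \<Longrightarrow> s < d1 \<Longrightarrow>
      norm (f (x + s *\<^sub>R u + s *\<^sub>R v) - f (x + s *\<^sub>R u) - f (x + s *\<^sub>R v) + f x - (s * s) *\<^sub>R Gv u) \<le> e * (s * s)"
      using second_difference_bound[OF assms(1,2) e der Gv] by blast
    obtain d2 where d2: "d2 > 0" "\<And>s. 0 < s \<Longrightarrow> s < d2 \<Longrightarrow>
      norm (f (x + s *\<^sub>R v + s *\<^sub>R u) - f (x + s *\<^sub>R v) - f (x + s *\<^sub>R u) + f x - (s * s) *\<^sub>R Gu v) \<le> e * (s * s)"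
      using second_difference_bound[OF assms(1,2) e der Gu] by blast
    define s where "s = min d1 d2 / 2"
    have s: "0 < s" "s < d1" "s < d2" using d1 d2 by (auto simp: s_def)
    define T where "T = f (x + s *\<^sub>R u + s *\<^sub>R v) - f (x + s *\<^sub>R u) - f (x + s *\<^sub>R v) + f x"
    have 1: "norm (T - (s * s) *\<^sub>R Gv u) \<le> e * (s * s)" using d1(2) s by (simp add: T_def)
    have 2: "norm (T - (s * s) *\<^sub>R Gu v) \<le> e * (s * s)" using d2(2)[of s] s by (simp add: T_def algebra_simps)
    have "(s * s) * norm (Gv u - Gu v) = norm ((T - (s * s) *\<^sub>R Gu v) - (T - (s * s) *\<^sub>R Gv u))"
      using s by (simp flip: scaleR_diff_right)
    also have "\<dots> \<le> e * (s * s) + e * (s * s)"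
      using norm_triangle_ineq4[of "T - (s * s) *\<^sub>R Gu v" "T - (s * s) *\<^sub>R Gv u"] 1 2 by linarith
    also have "\<dots> = (s * s) * (2 * e)" by simp
    finally show ?thesis using s by (simp only: mult_le_cancel_left_pos mult_pos_pos)
  qed
  then have "norm (Gv u - Gu v) \<le> 0"
    using field_le_epsilon[of "norm (Gv u - Gu v)" 0] by (metis add_0 half_gt_zero field_sum_of_halves mult_2)
  then show ?thesis by simp
qed

lemma dd_commute:
  assumes "open S" "smooth_on S f" "x \<in> S"
  shows "dd u (dd v f) x = dd v (dd u f) x"
proof -
  have "((\<lambda>z. dd w f z) has_derivative (\<lambda>u. dd u (dd w f) x)) (at x)" for w
    by (intro smooth_on_has_derivative[OF assms(1)] smooth_on_dd assms)
  then show ?thesis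
    using symmetric_second_derivative[OF assms(1,3) smooth_on_has_derivative[OF assms(1,2)]] by blast
qed

section \<open>Iterated directional derivatives\<close>

definition dds :: "(real ^ 'n) list \<Rightarrow> (real ^ 'n \<Rightarrow> complex) \<Rightarrow> real ^ 'n \<Rightarrow> complex" where
  "dds vs f = foldr dd vs f"

lemma dds_simps [simp]: "dds [] f = f" "dds (v # vs) f = dd v (dds vs f)"
  by (simp_all add: dds_def)

lemma dds_append: "dds (vs @ ws) f = dds vs (dds ws f)"
  by (simp add: dds_def)

lemma smooth_on_dds: "open S \<Longrightarrow> smooth_on S f \<Longrightarrow> smooth_on S (dds vs f)"
  by (induction vs) (auto intro: smooth_on_dd)

lemma dds_cong_open:
  assumes "open S" "\<And>z. z \<in> S \<Longrightarrow> f z = g z" "x \<in> S"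
  shows "dds vs f x = dds vs g x"
  using assms(3)
proof (induction vs arbitrary: x)
  case (Cons v vs)
  then show ?case using dd_cong_open[OF assms(1) Cons.prems, of "dds vs f" "dds vs g"] by simp
qed (use assms in auto)

lemma dds_add:
  assumes "open S" "smooth_on S f" "smooth_on S g" "x \<in> S"
  shows "dds vs (\<lambda>x. f x + g x) x = dds vs f x + dds vs g x"
  using assms(4)
proof (induction vs arbitrary: x)
  case (Cons v vs)
  have "dd v (dds vs (\<lambda>x. f x + g x)) x = dd v (\<lambda>x. dds vs f x + dds vs g x) x"
    by (rule dd_cong_open[OF assms(1) Cons.prems Cons.IH])
  then show ?case using dd_add[OF assms(1) smooth_on_dds smooth_on_dds] assms Cons.prems by simp
qed auto

lemma dds_sum:
  assumes "open S" "\<And>i. i \<in> I \<Longrightarrow> smooth_on S (f i)" "x \<in> S"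
  shows "dds vs (\<lambda>x. \<Sum>i\<in>I. f i x) x = (\<Sum>i\<in>I. dds vs (f i) x)"
  using assms(3)
proof (induction vs arbitrary: x)
  case (Cons v vs)
  have "dd v (dds vs (\<lambda>x. \<Sum>i\<in>I. f i x)) x = dd v (\<lambda>x. \<Sum>i\<in>I. dds vs (f i) x) x"
    by (rule dd_cong_open[OF assms(1) Cons.prems Cons.IH])
  also have "\<dots> = (\<Sum>i\<in>I. dd v (dds vs (f i)) x)"
    by (rule dd_sum[OF assms(1) smooth_on_dds[OF assms(1,2)] Cons.prems])
  finally show ?case by simp
qed auto

lemma dds_cmult:
  assumes "open S" "smooth_on S f" "x \<in> S"
  shows "dds vs (\<lambda>x. c * f x) x = c * dds vs f x"
  using assms(3)
proof (induction vs arbitrary: x)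
  case (Cons v vs)
  have "dd v (dds vs (\<lambda>x. c * f x)) x = dd v (\<lambda>x. c * dds vs f x) x"
    by (rule dd_cong_open[OF assms(1) Cons.prems Cons.IH])
  then show ?case using dd_cmult[OF assms(1) smooth_on_dds] assms Cons.prems by simp
qed auto

lemma dds_dd_commute:
  assumes "open S" "smooth_on S f" "x \<in> S"
  shows "dds vs (dd v f) x = dd v (dds vs f) x"
  using assms(3)
proof (induction vs arbitrary: x)
  case (Cons w vs)
  have "dd w (dds vs (dd v f)) x = dd w (dd v (dds vs f)) x"
    by (rule dd_cong_open[OF assms(1) Cons.prems Cons.IH])
  then show ?case using dd_commute[OF assms(1) smooth_on_dds] assms Cons.prems by simp
qed auto

lemma dd_along_line:
  assumes "open S" "smooth_on S f" "y + t *\<^sub>R e \<in> S"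
  shows "((\<lambda>t. f (y + t *\<^sub>R e)) has_vector_derivative dd e f (y + t *\<^sub>R e)) (at t)"
proof -
  have "((\<lambda>t. y + t *\<^sub>R e) has_derivative (\<lambda>h. 0 + h *\<^sub>R e)) (at t)"
    by (intro has_derivative_add has_derivative_const has_derivative_scaleR_left has_derivative_ident)
  from has_derivative_compose[OF this smooth_on_has_derivative[OF assms]]
  have "((\<lambda>t. f (y + t *\<^sub>R e)) has_derivative (\<lambda>h. dd (h *\<^sub>R e) f (y + t *\<^sub>R e))) (at t)"
    by (simp only: add_0)
  then show ?thesis unfolding has_vector_derivative_def dd_vector_scale scaleR_conv_of_real[where 'a = complex] .
qed

lemma laplacian_dd: "laplacian f x = (\<Sum>i\<in>UNIV. dd (axis i 1) (dd (axis i 1) f) x)"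
  by (simp add: laplacian_def partial_deriv_eq_dd)

section \<open>Real analytic functions\<close>

text \<open>Centre and radius are explicit, unlike in \<open>real_analytic_at\<close>, because all
  derivatives must be expanded on one common ball.\<close>

definition has_power_series :: "(real ^ 'n \<Rightarrow> complex) \<Rightarrow> real ^ 'n \<Rightarrow> real \<Rightarrow> bool" where
  "has_power_series f y r \<longleftrightarrow>
     (\<exists>c. \<forall>x\<in>ball y r. ((\<lambda>p. c p * complex_of_real (mpower (x - y) p)) has_sum f x) UNIV)"

section \<open>Termwise differentiation of multivariate power series\<close>

lemma has_derivative_mpower:
  fixes y :: "real ^ 'n"
  shows
  "((\<lambda>x. mpower (x - y) p) has_derivative
     (\<lambda>h. \<Sum>i\<in>UNIV. h $ i * (of_nat (p i) * mpower (x - y) (p(i := p i - 1))))) (at x within S)"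
proof -
  have *: "((\<lambda>x. (x $ i - y $ i) ^ p i) has_derivative (\<lambda>h. h $ i * (of_nat (p i) * (x $ i - y $ i) ^ (p i - 1)))) (at x within S)" for i
    by (auto intro!: derivative_eq_intros bounded_linear_imp_has_derivative[OF bounded_linear_vec_nth] simp: algebra_simps)
  have "((\<lambda>x. \<Prod>i\<in>UNIV. (x $ i - y $ i) ^ p i) has_derivative
     (\<lambda>h. \<Sum>i\<in>UNIV. (h $ i * (of_nat (p i) * (x $ i - y $ i) ^ (p i - 1))) * (\<Prod>j\<in>UNIV - {i}. (x $ j - y $ j) ^ p j))) (at x within S)"
    by (rule has_derivative_prod) (rule *)
  moreover have "mpower (x - y) (p(i := p i - 1)) = (x $ i - y $ i) ^ (p i - 1) * (\<Prod>j\<in>UNIV - {i}. (x $ j - y $ j) ^ p j)" for i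
    unfolding mpower_def by (subst prod.remove[of _ i]) (auto intro!: prod.cong)
  ultimately show ?thesis by (simp add: mpower_def mult.assoc)
qed

lemma mpower_scaleR: "mpower (t *\<^sub>R e) p = t ^ sum p UNIV * mpower e p"
  by (simp add: mpower_def power_mult_distrib prod.distrib power_sum)

lemma mpower_nonneg:
  fixes z :: "real ^ 'n"
  shows "(\<And>i. 0 \<le> z $ i) \<Longrightarrow> 0 \<le> mpower z p"
  by (auto simp: mpower_def intro!: prod_nonneg)

text \<open>The core is n u ^ (n - 1) \<delta> \<le> (u + \<delta>) ^ n for u \<ge> 0. Hence
  convergence at a point z that is larger by \<delta> in each coordinate majorises the derivative
  series at x.\<close>

lemma abs_mpower_deriv_le:
  fixes x z :: "real ^ 'n"
  assumes "\<delta> > 0" and x: "\<And>j. \<bar>x $ j\<bar> + \<delta> \<le> z $ j"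
  shows "of_nat (p i) * \<bar>mpower x (p(i := p i - 1))\<bar> \<le> mpower z p / \<delta>"
proof -
  have z: "z $ j > 0" for j using x[of j] \<open>\<delta> > 0\<close> by linarith
  have le: "\<bar>x $ j\<bar> \<le> z $ j" for j using x[of j] \<open>\<delta> > 0\<close> by linarith
  have one: "of_nat n * \<bar>x $ i\<bar> ^ (n - 1) \<le> (z $ i) ^ n / \<delta>" for n
  proof (induction n)
    case 0
    then show ?case using \<open>\<delta> > 0\<close> z[of i] by simp
  next
    case (Suc n)
    have "of_nat (Suc n) * \<bar>x $ i\<bar> ^ n * \<delta> \<le> (z $ i) ^ Suc n"
    proof (cases n)
      case 0
      then show ?thesis using x[of i] by simp
    next
      case (Suc m)
      have "of_nat n * \<bar>x $ i\<bar> ^ m * \<delta> \<le> (z $ i) ^ n"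
        using Suc.IH \<open>\<delta> > 0\<close> Suc by (simp add: field_simps)
      then have "\<bar>x $ i\<bar> * (of_nat n * \<bar>x $ i\<bar> ^ m * \<delta>) \<le> \<bar>x $ i\<bar> * (z $ i) ^ n"
        by (intro mult_left_mono) auto
      moreover have "\<bar>x $ i\<bar> ^ n * \<delta> \<le> (z $ i) ^ n * \<delta>"
        using \<open>\<delta> > 0\<close> le by (intro mult_right_mono power_mono) auto
      moreover have "(\<bar>x $ i\<bar> + \<delta>) * (z $ i) ^ n \<le> z $ i * (z $ i) ^ n"
        using x z[of i] by (intro mult_right_mono) auto
      ultimately show ?thesis by (simp add: Suc algebra_simps)
    qed
    then show ?case using \<open>\<delta> > 0\<close> by (simp add: field_simps)
  qed
  have "mpower w (p(i := n)) = (w $ i) ^ n * (\<Prod>j\<in>UNIV - {i}. (w $ j) ^ p j)" for w :: "real ^ 'n" and n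
    unfolding mpower_def by (subst prod.remove[of _ i]) (auto intro!: prod.cong)
  note m = this this[of _ "p i", unfolded fun_upd_triv]
  have "of_nat (p i) * \<bar>mpower x (p(i := p i - 1))\<bar> = (of_nat (p i) * \<bar>x $ i\<bar> ^ (p i - 1)) * \<bar>\<Prod>j\<in>UNIV - {i}. (x $ j) ^ p j\<bar>"
    unfolding m(1) by (simp add: abs_mult power_abs)
  also have "\<dots> \<le> ((z $ i) ^ p i / \<delta>) * (\<Prod>j\<in>UNIV - {i}. (z $ j) ^ p j)"
    using one[of "p i"] le z \<open>\<delta> > 0\<close>
    by (intro mult_mono) (auto simp: abs_prod power_abs less_imp_le intro!: prod_mono power_mono prod_nonneg)
  finally show ?thesis unfolding m(2)[of z] by simp
qed

text \<open>Absolute convergence at one point slightly further out than x0 majorises the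
  differentiated series uniformly on a box around x0, so it may be differentiated term by term. The
  radius does not shrink because x0 is arbitrary in the ball.\<close>

lemma has_power_series_partial_deriv:
  fixes f :: "real ^ 'n \<Rightarrow> complex"
  assumes "has_power_series f y r"
  shows "f differentiable_on ball y r"
    and "\<exists>g. has_power_series g y r \<and> (\<forall>x\<in>ball y r. partial_deriv i f x = g x)"
proof -
  obtain c where c: "\<And>x. x \<in> ball y r \<Longrightarrow> ((\<lambda>p. c p * complex_of_real (mpower (x - y) p)) has_sum f x) UNIV"
    using assms unfolding has_power_series_def by blast
  define T where "T i x p = c p * complex_of_real (of_nat (p i) * mpower (x - y) (p(i := p i - 1)))" for i x and p :: "'n \<Rightarrow> nat"
  define G where "G i x = infsum (T i x) UNIV" for i x
  have main: "(f has_derivative (\<lambda>h. \<Sum>i\<in>UNIV. of_real (h $ i) * G i x0)) (at x0) \<and> (\<forall>i. (T i x0 has_sum G i x0) UNIV)"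
    if x0: "x0 \<in> ball y r" for x0
  proof -
    define d where "d = r - norm (x0 - y)"
    have "d > 0" using x0 by (simp add: d_def dist_norm norm_minus_commute)
    \<comment> \<open>The vector with all entries 2 \<delta> has norm at most 2 \<delta> CARD('n),
      which is less than d; so y + z stays inside the ball.\<close>
    define \<delta> where "\<delta> = d / (2 * (CARD('n) + 1))"
    have "\<delta> > 0" using \<open>d > 0\<close> by (simp add: \<delta>_def)
    define z where "z = ((\<chi> i. \<bar>x0 $ i - y $ i\<bar> + 2 * \<delta>) :: real ^ 'n)"
    have "norm z \<le> norm (x0 - y) + norm ((\<chi> i. 2 * \<delta>) :: real ^ 'n)"
    proof -
      have "z = (\<chi> i. \<bar>x0 $ i - y $ i\<bar>) + (\<chi> i. 2 * \<delta>)" by (simp add: z_def vec_eq_iff)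
      then have "norm z \<le> norm ((\<chi> i. \<bar>x0 $ i - y $ i\<bar>) :: real ^ 'n) + norm ((\<chi> i. 2 * \<delta>) :: real ^ 'n)"
        using norm_triangle_ineq by metis
      moreover have "norm ((\<chi> i. \<bar>x0 $ i - y $ i\<bar>) :: real ^ 'n) = norm (x0 - y)"
        by (simp add: norm_vec_def L2_set_def)
      ultimately show ?thesis by simp
    qed
    also have "norm ((\<chi> i. 2 * \<delta>) :: real ^ 'n) \<le> (\<Sum>i\<in>(UNIV :: 'n set). 2 * \<delta>)"
      using norm_le_l1_cart[of "(\<chi> i. 2 * \<delta>) :: real ^ 'n"] \<open>\<delta> > 0\<close> by simp
    also have "\<dots> < d"
    proof -
      have "2 * \<delta> * (real CARD('n) + 1) = d" by (simp add: \<delta>_def field_simps)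
      then show ?thesis using \<open>\<delta> > 0\<close> by (simp add: algebra_simps)
    qed
    finally have zr: "norm z < r" by (simp add: d_def)
    have "y + z \<in> ball y r" using zr by (simp add: dist_norm)
    then have "((\<lambda>p. c p * complex_of_real (mpower z p)) has_sum f (y + z)) UNIV"
      using c[of "y + z"] by (simp only: add_diff_cancel_left')
    then have "(\<lambda>p. c p * complex_of_real (mpower z p)) summable_on UNIV"
      by (rule has_sum_imp_summable)
    then have "(\<lambda>p. norm (c p * complex_of_real (mpower z p))) summable_on UNIV"
      by (rule summable_on_iff_abs_summable_on_complex[THEN iffD1])
    moreover have "norm (c p * complex_of_real (mpower z p)) = norm (c p) * mpower z p" for p
      using mpower_nonneg[of z p] \<open>\<delta> > 0\<close> by (simp add: norm_mult z_def)
    ultimately have sumz: "(\<lambda>p. norm (c p) * mpower z p) summable_on UNIV" by simp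
    \<comment> \<open>The box uses a margin \<delta> and z a margin 2 \<delta>; the remaining
      \<delta> is what \<open>abs_mpower_deriv_le\<close> needs.\<close>
    define S where "S = {x :: real ^ 'n. \<forall>i. x $ i \<in> {y $ i - (\<bar>x0 $ i - y $ i\<bar> + \<delta>) <..< y $ i + (\<bar>x0 $ i - y $ i\<bar> + \<delta>)}}"
    have S_le: "\<bar>(x - y) $ i\<bar> + \<delta> \<le> z $ i" if "x \<in> S" for x :: "real ^ 'n" and i
      using that unfolding S_def z_def by (auto simp: abs_if dest!: spec[of _ i])
    have "x0 \<in> S" unfolding S_def using \<open>\<delta> > 0\<close> by (auto simp: abs_if)
    have Sbox: "S = box (\<chi> i. y $ i - (\<bar>x0 $ i - y $ i\<bar> + \<delta>)) (\<chi> i. y $ i + (\<bar>x0 $ i - y $ i\<bar> + \<delta>))"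
      by (auto simp: S_def mem_box_cart)
    have "open S" unfolding Sbox by (rule open_box)
    have "convex S" unfolding Sbox by (rule convex_box)
    have S_ball: "x \<in> ball y r" if "x \<in> S" for x
    proof -
      have "\<bar>(x - y) $ i\<bar> \<le> \<bar>z $ i\<bar>" for i using S_le[OF that, of i] \<open>\<delta> > 0\<close> by linarith
      then have "norm (x - y) \<le> norm z" by (intro norm_le_componentwise_cart) auto
      then show ?thesis using zr by (simp add: dist_norm norm_minus_commute)
    qed
    have T_le: "norm (T i x p) \<le> norm (c p) * mpower z p / \<delta>" if "x \<in> S" for x i p
    proof -
      have "norm (T i x p) = norm (c p) * (of_nat (p i) * \<bar>mpower (x - y) (p(i := p i - 1))\<bar>)"
        by (simp add: T_def norm_mult)
      also have "\<dots> \<le> norm (c p) * (mpower z p / \<delta>)"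
        by (intro mult_left_mono abs_mpower_deriv_le[OF \<open>\<delta> > 0\<close> S_le[OF that]]) auto
      finally show ?thesis by simp
    qed
    have sumz': "(\<lambda>p. norm (c p) * mpower z p / \<delta>) summable_on UNIV"
      using summable_on_cmult_left[OF sumz, of "1 / \<delta>"] by simp
    have T_sum: "(T i x has_sum G i x) UNIV" if "x \<in> S" for i x
    proof -
      have "(\<lambda>p. norm (T i x p)) summable_on UNIV"
        by (rule summable_on_comparison_test[OF sumz']) (use T_le[OF that] in auto)
      then have "T i x summable_on UNIV" by (rule summable_on_iff_abs_summable_on_complex[THEN iffD2])
      then show ?thesis unfolding G_def by (rule has_sum_infsum)
    qed
    have inf: "infinite (UNIV :: ('n \<Rightarrow> nat) set)"
    proof -
      have "inj (\<lambda>k :: nat. \<lambda>_ :: 'n. k)" by (auto intro!: injI dest: fun_cong)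
      then have "infinite (range (\<lambda>k :: nat. \<lambda>_ :: 'n. k))" by (simp add: finite_image_iff)
      then show ?thesis using finite_subset subset_UNIV by blast
    qed
    \<comment> \<open>Multi-indices are enumerated so that unordered sums become series, to which
      the Weierstrass test and \<open>has_derivative_series\<close> apply.\<close>
    define e where "e = from_nat_into (UNIV :: ('n \<Rightarrow> nat) set)"
    have e: "bij_betw e UNIV UNIV" unfolding e_def by (rule bij_betw_from_nat_into[OF _ inf]) simp
    have T_unif: "uniform_limit S (\<lambda>n x. \<Sum>k<n. T i x (e k)) (\<lambda>x. G i x) sequentially" for i
    proof -
      have "summable (\<lambda>k. norm (c (e k)) * mpower z (e k) / \<delta>)"
      proof (rule summable_on_imp_summable)
        show "(\<lambda>k. norm (c (e k)) * mpower z (e k) / \<delta>) summable_on UNIV"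
          using sumz' summable_on_reindex_bij_betw[OF e, of "\<lambda>p. norm (c p) * mpower z p / \<delta>"] by simp
      qed
      then have "uniform_limit S (\<lambda>n x. \<Sum>k<n. T i x (e k)) (\<lambda>x. \<Sum>k. T i x (e k)) sequentially"
        by (intro Weierstrass_m_test[of _ _ "\<lambda>k. norm (c (e k)) * mpower z (e k) / \<delta>"] T_le)
      moreover have "(\<Sum>k. T i x (e k)) = G i x" if "x \<in> S" for x
      proof -
        have "((\<lambda>k. T i x (e k)) has_sum G i x) UNIV"
          using T_sum[OF that] has_sum_reindex_bij_betw[OF e, of "T i x"] by simp
        then show ?thesis by (metis has_sum_imp_sums sums_unique)
      qed
      ultimately show ?thesis by (auto cong: uniform_limit_cong')
    qed
    have f_sums: "(\<lambda>k. c (e k) * complex_of_real (mpower (x - y) (e k))) sums f x" if "x \<in> S" for x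
      using c[OF S_ball[OF that]] has_sum_reindex_bij_betw[OF e, of "\<lambda>p. c p * complex_of_real (mpower (x - y) p)"]
      by (intro has_sum_imp_sums) simp
    have "\<exists>g. \<forall>x\<in>S. (\<lambda>k. c (e k) * complex_of_real (mpower (x - y) (e k))) sums g x \<and>
       (g has_derivative (\<lambda>h. \<Sum>i\<in>UNIV. of_real (h $ i) * G i x)) (at x within S)"
    proof (rule has_derivative_series[where f' = "\<lambda>k x h. \<Sum>i\<in>UNIV. of_real (h $ i) * T i x (e k)"
          and g' = "\<lambda>x h. \<Sum>i\<in>UNIV. of_real (h $ i) * G i x" and x = x0 and l = "f x0"])
      show "convex S" "x0 \<in> S" by fact+
      show "(\<lambda>k. c (e k) * complex_of_real (mpower (x0 - y) (e k))) sums f x0" by (rule f_sums) fact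
    next
      fix k x assume "x \<in> S"
      have "((\<lambda>x. complex_of_real (mpower (x - y) (e k))) has_derivative
         (\<lambda>h. complex_of_real (\<Sum>i\<in>UNIV. h $ i * (of_nat (e k i) * mpower (x - y) ((e k)(i := e k i - 1)))))) (at x within S)"
        by (rule has_derivative_of_real) (rule has_derivative_mpower)
      then have "((\<lambda>x. c (e k) * complex_of_real (mpower (x - y) (e k))) has_derivative
         (\<lambda>h. c (e k) * complex_of_real (\<Sum>i\<in>UNIV. h $ i * (of_nat (e k i) * mpower (x - y) ((e k)(i := e k i - 1)))))) (at x within S)"
        by (rule has_derivative_mult_right)
      moreover have "c (e k) * complex_of_real (\<Sum>i\<in>UNIV. h $ i * (of_nat (e k i) * mpower (x - y) ((e k)(i := e k i - 1))))
          = (\<Sum>i\<in>UNIV. of_real (h $ i) * T i x (e k))" for h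
        by (simp add: T_def sum_distrib_left mult_ac)
      ultimately show "((\<lambda>x. c (e k) * complex_of_real (mpower (x - y) (e k))) has_derivative
         (\<lambda>h. \<Sum>i\<in>UNIV. of_real (h $ i) * T i x (e k))) (at x within S)" by (simp only:)
    next
      fix \<epsilon> :: real assume "\<epsilon> > 0"
      define \<epsilon>' where "\<epsilon>' = \<epsilon> / CARD('n)"
      have "\<epsilon>' > 0" using \<open>\<epsilon> > 0\<close> by (simp add: \<epsilon>'_def)
      have "\<forall>\<^sub>F n in sequentially. \<forall>i. \<forall>x\<in>S. dist (\<Sum>k<n. T i x (e k)) (G i x) < \<epsilon>'"
        by (rule eventually_all_finite) (rule uniform_limitD[OF T_unif \<open>\<epsilon>' > 0\<close>])
      then show "\<forall>\<^sub>F n in sequentially. \<forall>x\<in>S. \<forall>h. norm ((\<Sum>k<n. \<Sum>i\<in>UNIV. of_real (h $ i) * T i x (e k)) - (\<Sum>i\<in>UNIV. of_real (h $ i) * G i x)) \<le> \<epsilon> * norm h"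
      proof eventually_elim
        case (elim n)
        show ?case
        proof (intro ballI allI)
          fix x and h :: "real ^ 'n" assume "x \<in> S"
          have "(\<Sum>k<n. \<Sum>i\<in>UNIV. of_real (h $ i) * T i x (e k)) - (\<Sum>i\<in>UNIV. of_real (h $ i) * G i x)
            = (\<Sum>i\<in>UNIV. of_real (h $ i) * ((\<Sum>k<n. T i x (e k)) - G i x))"
            by (subst sum.swap) (simp add: sum_distrib_left right_diff_distrib sum_subtractf)
          also have "norm \<dots> \<le> (\<Sum>i\<in>(UNIV :: 'n set). norm h * \<epsilon>')"
          proof (rule sum_norm_le)
            fix i
            have "norm ((\<Sum>k<n. T i x (e k)) - G i x) \<le> \<epsilon>'" using elim \<open>x \<in> S\<close> by (auto simp: dist_norm less_imp_le)
            then show "norm (of_real (h $ i) * ((\<Sum>k<n. T i x (e k)) - G i x)) \<le> norm h * \<epsilon>'"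
              unfolding norm_mult using component_le_norm_cart[of h i] by (intro mult_mono) auto
          qed
          also have "\<dots> = \<epsilon> * norm h" by (simp add: \<epsilon>'_def)
          finally show "norm ((\<Sum>k<n. \<Sum>i\<in>UNIV. of_real (h $ i) * T i x (e k)) - (\<Sum>i\<in>UNIV. of_real (h $ i) * G i x)) \<le> \<epsilon> * norm h" .
        qed
      qed
    qed
    then obtain g where g: "\<And>x. x \<in> S \<Longrightarrow> (\<lambda>k. c (e k) * complex_of_real (mpower (x - y) (e k))) sums g x"
       "\<And>x. x \<in> S \<Longrightarrow> (g has_derivative (\<lambda>h. \<Sum>i\<in>UNIV. of_real (h $ i) * G i x)) (at x within S)" by blast
    have fg: "f x = g x" if "x \<in> S" for x by (rule sums_unique2[OF f_sums[OF that] g(1)[OF that]])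
    have "(f has_derivative (\<lambda>h. \<Sum>i\<in>UNIV. of_real (h $ i) * G i x0)) (at x0 within S)"
      by (rule has_derivative_transform[OF \<open>x0 \<in> S\<close> fg g(2)[OF \<open>x0 \<in> S\<close>]])
    then show ?thesis using T_sum[OF \<open>x0 \<in> S\<close>] unfolding at_within_open[OF \<open>x0 \<in> S\<close> \<open>open S\<close>] by blast
  qed
  show "f differentiable_on ball y r"
    unfolding differentiable_on_def
  proof
    fix x assume "x \<in> ball y r"
    from main[OF this] have "f differentiable at x" unfolding differentiable_def by blast
    then show "f differentiable at x within ball y r" by (rule differentiable_at_withinI)
  qed
  have "partial_deriv i f x = G i x" if "x \<in> ball y r" for x
  proof -
    have "partial_deriv i f x = (\<Sum>j\<in>UNIV. of_real (axis i 1 $ j) * G j x)"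
      by (rule partial_deriv_has_derivative[OF conjunct1[OF main[OF that]]])
    also have "\<dots> = (\<Sum>j\<in>UNIV. if j = i then G j x else 0)"
      by (intro sum.cong refl) (auto simp: axis_def)
    finally show ?thesis by simp
  qed
  moreover have "has_power_series (G i) y r"
    unfolding has_power_series_def
  proof (intro exI ballI)
    fix x assume x: "x \<in> ball y r"
    \<comment> \<open>Terms with p i = 0 are killed by differentiation. The remaining multi-indices
      are the image of raising the i-th entry, so reindexing exhibits a power series again.\<close>
    define s where "s q = q(i := Suc (q i))" for q :: "'n \<Rightarrow> nat"
    have "inj s" unfolding s_def by (auto intro!: injI simp: fun_eq_iff split: if_splits)
    have rng: "range s = {p. p i \<noteq> 0}"
    proof safe
      fix p :: "'n \<Rightarrow> nat" assume "0 < p i"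
      then have "p = s (p(i := p i - 1))" by (auto simp: s_def)
      then show "p \<in> range s" by blast
    qed (auto simp: s_def)
    have "(T i x has_sum G i x) UNIV" using main[OF x] by blast
    then have "(T i x has_sum G i x) (range s)"
      by (rule has_sum_cong_neutral[THEN iffD1, rotated 3]) (auto simp: rng T_def)
    then have "((T i x \<circ> s) has_sum G i x) UNIV"
      using has_sum_reindex[OF \<open>inj s\<close>] by blast
    moreover have "T i x (s q) = (c (s q) * of_nat (Suc (q i))) * complex_of_real (mpower (x - y) q)" for q
      by (simp add: T_def s_def)
    ultimately show "((\<lambda>q. (c (q(i := Suc (q i))) * of_nat (Suc (q i))) * complex_of_real (mpower (x - y) q)) has_sum G i x) UNIV"
      by (simp add: o_def s_def)
  qed
  ultimately show "\<exists>g. has_power_series g y r \<and> (\<forall>x\<in>ball y r. partial_deriv i f x = g x)" by blast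
qed

lemma has_power_series_smooth:
  assumes "has_power_series f y r"
  shows "smooth_on (ball y r) f"
  by (rule smooth_on_coinduct[of _ "\<lambda>f. has_power_series f y r"])
     (use assms has_power_series_partial_deriv in blast)+

section \<open>Linear operations on power series and restriction to lines\<close>

lemma has_power_series_cong:
  assumes "has_power_series f y r" "\<And>x. x \<in> ball y r \<Longrightarrow> f x = g x"
  shows "has_power_series g y r"
  using assms unfolding has_power_series_def by metis

lemma has_power_series_zero: "has_power_series (\<lambda>_. 0) y r"
  unfolding has_power_series_def by (rule exI[of _ "\<lambda>_. 0"]) simp

lemma has_power_series_add:
  assumes "has_power_series f y r" "has_power_series g y r"
  shows "has_power_series (\<lambda>x. f x + g x) y r"
proof -
  obtain c d where *: "\<And>x. x \<in> ball y r \<Longrightarrow> ((\<lambda>p. c p * complex_of_real (mpower (x - y) p)) has_sum f x) UNIV"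
    "\<And>x. x \<in> ball y r \<Longrightarrow> ((\<lambda>p. d p * complex_of_real (mpower (x - y) p)) has_sum g x) UNIV"
    using assms unfolding has_power_series_def by blast
  have "((\<lambda>p. (c p + d p) * complex_of_real (mpower (x - y) p)) has_sum (f x + g x)) UNIV" if "x \<in> ball y r" for x
    using has_sum_add[OF *(1)[OF that] *(2)[OF that]] by (simp add: ring_distribs)
  then show ?thesis unfolding has_power_series_def by (intro exI[of _ "\<lambda>p. c p + d p"] ballI)
qed

lemma has_power_series_cmult:
  assumes "has_power_series f y r"
  shows "has_power_series (\<lambda>x. a * f x) y r"
proof -
  obtain c where *: "\<And>x. x \<in> ball y r \<Longrightarrow> ((\<lambda>p. c p * complex_of_real (mpower (x - y) p)) has_sum f x) UNIV"
    using assms unfolding has_power_series_def by blast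
  have "((\<lambda>p. (a * c p) * complex_of_real (mpower (x - y) p)) has_sum (a * f x)) UNIV" if "x \<in> ball y r" for x
    using has_sum_cmult_right[OF *[OF that], of a] by (simp add: mult.assoc)
  then show ?thesis unfolding has_power_series_def by (intro exI[of _ "\<lambda>p. a * c p"] ballI)
qed

lemma has_power_series_sum:
  assumes "\<And>i. i \<in> I \<Longrightarrow> has_power_series (f i) y r"
  shows "has_power_series (\<lambda>x. \<Sum>i\<in>I. f i x) y r"
  using assms by (induction I rule: infinite_finite_induct)
    (auto intro: has_power_series_zero has_power_series_add)

lemma has_power_series_dd:
  assumes "has_power_series f y r"
  shows "has_power_series (dd v f) y r"
proof -
  have "has_power_series (partial_deriv i f) y r" for i
    using has_power_series_partial_deriv(2)[OF assms, of i] has_power_series_cong by metis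
  then show ?thesis unfolding dd_def[abs_def]
    by (intro has_power_series_sum has_power_series_cmult)
qed

lemma has_power_series_dds: "has_power_series f y r \<Longrightarrow> has_power_series (dds vs f) y r"
  by (induction vs) (auto intro: has_power_series_dd)

text \<open>On a line through the centre the terms of equal total degree combine into a series in
  one variable. The norm of a term depends on w only through its modulus, so absolute convergence at
  the real point norm w carries over to complex w, and the extension lives on the full disc.\<close>

lemma has_power_series_line:
  fixes f :: "real ^ 'n \<Rightarrow> complex"
  assumes "has_power_series f y r" "norm e = 1"
  shows "\<exists>k. k holomorphic_on ball 0 r \<and> (\<forall>t. \<bar>t\<bar> < r \<longrightarrow> f (y + t *\<^sub>R e) = k (of_real t))"
proof -
  obtain c where c: "\<And>x. x \<in> ball y r \<Longrightarrow> ((\<lambda>p. c p * complex_of_real (mpower (x - y) p)) has_sum f x) UNIV"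
    using assms unfolding has_power_series_def by blast
  define \<phi> where "\<phi> w p = c p * complex_of_real (mpower e p) * w ^ sum p UNIV" for w p
  define k where "k w = infsum (\<phi> w) UNIV" for w
  define a where "a j = (\<Sum>p | sum p UNIV = j. c p * complex_of_real (mpower e p))" for j
  have on_line: "((\<lambda>p. \<phi> (of_real t) p) has_sum f (y + t *\<^sub>R e)) UNIV" if "\<bar>t\<bar> < r" for t
    using c[of "y + t *\<^sub>R e"] that assms(2) by (simp add: \<phi>_def mpower_scaleR dist_norm mult_ac)
  have fin: "finite {p :: 'n \<Rightarrow> nat. sum p UNIV = j}" for j
  proof (rule finite_subset)
    show "{p :: 'n \<Rightarrow> nat. sum p UNIV = j} \<subseteq> PiE UNIV (\<lambda>_. {..j})"
      by (auto intro!: member_le_sum)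
  qed (intro finite_PiE; simp)
  have "(\<lambda>j. a j * (w - 0) ^ j) sums k w" if w: "w \<in> ball 0 r" for w
  proof -
    have "(\<lambda>p. norm (\<phi> (of_real (norm w)) p)) summable_on UNIV"
      by (intro summable_on_iff_abs_summable_on_complex[THEN iffD1] has_sum_imp_summable[OF on_line]) (use w in simp)
    then have "(\<lambda>p. norm (\<phi> w p)) summable_on UNIV"
      by (simp add: \<phi>_def norm_mult norm_power)
    then have "\<phi> w summable_on UNIV" by (rule summable_on_iff_abs_summable_on_complex[THEN iffD2])
    then have "(\<phi> w has_sum k w) UNIV" unfolding k_def by (rule has_sum_infsum)
    moreover have "bij_betw snd (SIGMA j:UNIV. {p :: 'n \<Rightarrow> nat. sum p UNIV = j}) UNIV"
      by (auto simp: bij_betw_def inj_on_def image_iff)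
    ultimately have "((\<lambda>x. \<phi> w (snd x)) has_sum k w) (SIGMA j:UNIV. {p :: 'n \<Rightarrow> nat. sum p UNIV = j})"
      using has_sum_reindex_bij_betw by blast
    then have "((\<lambda>j. a j * w ^ j) has_sum k w) UNIV"
    proof (rule has_sum_SigmaD)
      fix j
      have "((\<lambda>p. \<phi> w p) has_sum (\<Sum>p | sum p UNIV = j. \<phi> w p)) {p. sum p UNIV = j}"
        using fin by (rule has_sum_finite)
      then show "((\<lambda>p. \<phi> w (snd (j, p))) has_sum a j * w ^ j) {p. sum p UNIV = j}"
        by (simp add: a_def \<phi>_def sum_distrib_right)
    qed
    then show ?thesis by (simp add: has_sum_imp_sums)
  qed
  then have "k holomorphic_on ball 0 r" by (rule power_series_holomorphic)
  moreover have "f (y + t *\<^sub>R e) = k (of_real t)" if "\<bar>t\<bar> < r" for t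
    using on_line[OF that] unfolding k_def by (metis infsumI)
  ultimately show ?thesis by blast
qed

lemma real_analytic_on_imp_smooth_on:
  assumes "open D" "real_analytic_on f D"
  shows "smooth_on D f"
  unfolding smooth_on_def
proof (intro allI, unfold differentiable_on_def, intro ballI)
  fix js x assume "x \<in> D"
  then obtain c r where "r > 0" "\<forall>z\<in>ball x r. ((\<lambda>p. c p * complex_of_real (mpower (z - x) p)) has_sum f z) UNIV"
    using assms(2) unfolding real_analytic_on_def real_analytic_at_def by blast
  then have "smooth_on (ball x r) f"
    by (intro has_power_series_smooth) (auto simp: has_power_series_def)
  then have "partials js f differentiable (at x within ball x r)"
    using \<open>r > 0\<close> unfolding smooth_on_def differentiable_on_def by simp
  then show "partials js f differentiable (at x within D)"
    using \<open>r > 0\<close> by (simp add: at_within_open[OF _ open_ball] differentiable_at_withinI)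
qed

section \<open>The commutator on exponential functions\<close>

text \<open>Real frequencies suffice as test functions, since the identities derived from them are
  polynomial in a real parameter.\<close>

definition expo :: "real ^ 'n \<Rightarrow> real ^ 'n \<Rightarrow> complex" where
  "expo \<zeta> x = exp (complex_of_real (\<zeta> \<bullet> x))"

lemma expo_nonzero [simp]: "expo \<zeta> x \<noteq> 0"
  by (simp add: expo_def)

lemma has_derivative_expo: "(expo \<zeta> has_derivative (\<lambda>h. complex_of_real (\<zeta> \<bullet> h) * expo \<zeta> x)) (at x)"
proof -
  have "((\<lambda>x. complex_of_real (\<zeta> \<bullet> x)) has_derivative (\<lambda>h. complex_of_real (\<zeta> \<bullet> h))) (at x)"
    by (intro has_derivative_of_real has_derivative_inner_right has_derivative_ident)
  moreover have "(exp has_derivative (\<lambda>h. exp (complex_of_real (\<zeta> \<bullet> x)) * h)) (at (complex_of_real (\<zeta> \<bullet> x)))"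
    using DERIV_exp unfolding has_field_derivative_def by blast
  ultimately have "((\<lambda>x. exp (complex_of_real (\<zeta> \<bullet> x))) has_derivative (\<lambda>h. exp (complex_of_real (\<zeta> \<bullet> x)) * complex_of_real (\<zeta> \<bullet> h))) (at x)"
    by (rule has_derivative_compose)
  then show ?thesis unfolding expo_def[abs_def] by (simp only: mult.commute)
qed

lemma dd_expo: "dd v (expo \<zeta>) x = complex_of_real (\<zeta> \<bullet> v) * expo \<zeta> x"
  by (rule dd_has_derivative[OF has_derivative_expo])

lemma dd_cmult_expo: "dd v (\<lambda>x. c * expo \<zeta> x) x = c * (complex_of_real (\<zeta> \<bullet> v) * expo \<zeta> x)"
  by (rule dd_has_derivative[OF has_derivative_mult_right[OF has_derivative_expo]])

lemma partial_deriv_cmult_expo: "partial_deriv i (\<lambda>x. c * expo \<zeta> x) = (\<lambda>x. (c * complex_of_real (\<zeta> $ i)) * expo \<zeta> x)"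
  by (rule ext) (simp add: partial_deriv_eq_dd dd_cmult_expo inner_axis)

lemma smooth_on_expo:
  assumes "open S"
  shows "smooth_on S (expo \<zeta>)"
  using assms
proof (rule smooth_on_coinduct[of _ "\<lambda>f. \<exists>c. f = (\<lambda>x. c * expo \<zeta> x)"])
  show "\<exists>c. expo \<zeta> = (\<lambda>x. c * expo \<zeta> x)" by (rule exI[of _ 1]) simp
next
  fix f assume "\<exists>c. f = (\<lambda>x. c * expo \<zeta> x)"
  then obtain c where c: "f = (\<lambda>x. c * expo \<zeta> x)" by blast
  have "f differentiable_on S" unfolding differentiable_on_def
  proof
    fix x show "f differentiable at x within S"
      unfolding c by (rule differentiableI[OF has_derivative_at_withinI[OF has_derivative_mult_right[OF has_derivative_expo]]])
  qed
  moreover have "partial_deriv i f = (\<lambda>x. (c * complex_of_real (\<zeta> $ i)) * expo \<zeta> x)" for i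
    unfolding c by (rule partial_deriv_cmult_expo)
  ultimately show "f differentiable_on S \<and> (\<forall>i. \<exists>g. (\<exists>c. g = (\<lambda>x. c * expo \<zeta> x)) \<and> (\<forall>x\<in>S. partial_deriv i f x = g x))"
    by metis
qed

lemma partials_expo: "partials js (expo \<zeta>) = (\<lambda>x. (\<Prod>j\<leftarrow>js. complex_of_real (\<zeta> $ j)) * expo \<zeta> x)"
proof (induction js)
  case (Cons j js)
  show ?case unfolding partials_simps Cons.IH partial_deriv_cmult_expo by (simp add: mult.commute)
qed simp

section \<open>Multi-indices as lists of coordinates\<close>

definition index_list :: "('n \<Rightarrow> nat) \<Rightarrow> 'n list" where
  "index_list p = (SOME js. \<forall>i. count_list js i = p i)"

lemma count_list_index_list: "count_list (index_list p) i = p (i :: 'n :: finite)"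
proof -
  obtain xs where xs: "mset xs = Abs_multiset p" using ex_mset by blast
  have "count (Abs_multiset p) = p" by (rule count_Abs_multiset) simp
  then have "\<forall>i. count_list xs i = p i" using xs by (metis count_mset)
  then have "\<forall>i. count_list (index_list p) i = p i" unfolding index_list_def by (rule someI)
  then show ?thesis by blast
qed

lemma mderiv_eq: "mderiv p = partials (index_list p)"
  by (simp add: mderiv_def index_list_def)

lemma prod_list_eq_prod_count:
  fixes f :: "'n :: finite \<Rightarrow> 'a :: comm_monoid_mult"
  shows "(\<Prod>j\<leftarrow>js. f j) = (\<Prod>i\<in>UNIV. f i ^ count_list js i)"
proof (induction js)
  case (Cons j js)
  have "(\<Prod>i\<in>UNIV. f i ^ count_list (j # js) i) = (\<Prod>i\<in>UNIV. (if i = j then f i else 1) * f i ^ count_list js i)"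
    by (intro prod.cong refl) auto
  also have "\<dots> = f j * (\<Prod>i\<in>UNIV. f i ^ count_list js i)"
    by (simp add: prod.distrib prod.delta)
  finally show ?case using Cons by simp
qed simp

lemma length_eq_sum_count: "length js = (\<Sum>i\<in>UNIV. count_list js (i :: 'n :: finite))"
proof (induction js)
  case (Cons j js)
  have "(\<Sum>i\<in>UNIV. count_list (j # js) i) = (\<Sum>i\<in>UNIV. (if i = j then 1 else 0) + count_list js i)"
    by (intro sum.cong refl) auto
  also have "\<dots> = 1 + (\<Sum>i\<in>UNIV. count_list js i)" by (simp add: sum.distrib sum.delta)
  finally show ?case using Cons by simp
qed simp

lemma prod_list_index_list: "(\<Prod>j\<leftarrow>index_list p. f j) = (\<Prod>i\<in>UNIV. f (i :: 'n :: finite) ^ p i)"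
  by (simp add: prod_list_eq_prod_count count_list_index_list)

lemma length_index_list: "length (index_list p) = sum p (UNIV :: 'n :: finite set)"
  by (simp add: length_eq_sum_count count_list_index_list)

lemma mderiv_expo: "mderiv p (expo \<zeta>) = (\<lambda>x. complex_of_real (mpower \<zeta> p) * expo \<zeta> x)"
  unfolding mderiv_eq partials_expo prod_list_index_list by (simp add: mpower_def)

lemma partials_eq_dds: "partials js f = dds (map (\<lambda>j. axis j 1) js) f"
  by (induction js) (simp_all add: partial_deriv_eq_dd)

text \<open>\<open>twist \<zeta> g js k\<close> is the part of degree \<open>k\<close> in \<open>\<zeta>\<close> of the function
  obtained from \<open>g\<close> by applying the operators \<open>\<partial>\<^sub>j + \<zeta>\<^sub>j\<close>, \<open>j \<in> js\<close>.\<close>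

fun twist :: "real ^ 'n \<Rightarrow> (real ^ 'n \<Rightarrow> complex) \<Rightarrow> 'n list \<Rightarrow> nat \<Rightarrow> real ^ 'n \<Rightarrow> complex" where
  "twist \<zeta> g [] k = (if k = 0 then g else (\<lambda>_. 0))"
| "twist \<zeta> g (j # js) 0 = dd (axis j 1) (twist \<zeta> g js 0)"
| "twist \<zeta> g (j # js) (Suc k) = (\<lambda>x. dd (axis j 1) (twist \<zeta> g js (Suc k)) x + complex_of_real (\<zeta> $ j) * twist \<zeta> g js k x)"

lemma smooth_on_twist:
  assumes "open S" "smooth_on S g"
  shows "smooth_on S (twist \<zeta> g js k)"
proof (induction js arbitrary: k)
  case Nil
  show ?case using assms by (simp add: smooth_on_const)
next
  case (Cons j js)
  show ?case
  proof (cases k)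
    case 0
    then show ?thesis using smooth_on_dd[OF assms(1) Cons] by simp
  next
    case (Suc k')
    then show ?thesis
      using smooth_on_add[OF assms(1) smooth_on_dd[OF assms(1) Cons] smooth_on_mult[OF assms(1) smooth_on_const[OF assms(1)] Cons]] by simp
  qed
qed

lemma twist_eq_0: "k > length js \<Longrightarrow> twist \<zeta> g js k = (\<lambda>_. 0)"
proof (induction js arbitrary: k)
  case (Cons j js)
  then obtain k' where k: "k = Suc k'" by (cases k) auto
  have "twist \<zeta> g js k = (\<lambda>_. 0)" "twist \<zeta> g js k' = (\<lambda>_. 0)" using Cons k by auto
  then show ?case unfolding k by simp
qed simp

lemma twist_top: "twist \<zeta> g js (length js) x = (\<Prod>j\<leftarrow>js. complex_of_real (\<zeta> $ j)) * g x"
proof (induction js)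
  case (Cons j js)
  have "twist \<zeta> g js (Suc (length js)) = (\<lambda>_. 0)" by (rule twist_eq_0) simp
  then show ?case using Cons by simp
qed simp

lemma twist_add:
  assumes "open S" "smooth_on S g" "smooth_on S h" "x \<in> S"
  shows "twist \<zeta> (\<lambda>x. g x + h x) js k x = twist \<zeta> g js k x + twist \<zeta> h js k x"
  using assms(4)
proof (induction js arbitrary: k x)
  case (Cons j js)
  have *: "dd v (twist \<zeta> (\<lambda>x. g x + h x) js k) x = dd v (twist \<zeta> g js k) x + dd v (twist \<zeta> h js k) x" for k v
  proof -
    have "dd v (twist \<zeta> (\<lambda>x. g x + h x) js k) x = dd v (\<lambda>x. twist \<zeta> g js k x + twist \<zeta> h js k x) x"
      by (rule dd_cong_open[OF assms(1) Cons.prems Cons.IH])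
    also have "\<dots> = dd v (twist \<zeta> g js k) x + dd v (twist \<zeta> h js k) x"
      by (rule dd_add[OF assms(1) smooth_on_twist[OF assms(1,2)] smooth_on_twist[OF assms(1,3)] Cons.prems])
    finally show ?thesis .
  qed
  show ?case
    by (cases k) (simp_all add: * Cons.IH[OF Cons.prems] distrib_left)
qed simp

lemma twist_cong:
  assumes "open S" "\<And>x. x \<in> S \<Longrightarrow> g x = h x" "x \<in> S"
  shows "twist \<zeta> g js k x = twist \<zeta> h js k x"
  using assms(3)
proof (induction js arbitrary: k x)
  case Nil
  then show ?case using assms(2) by simp
next
  case (Cons j js)
  have *: "dd v (twist \<zeta> g js k) x = dd v (twist \<zeta> h js k) x" for k v
    by (rule dd_cong_open[OF assms(1) Cons.prems Cons.IH])
  show ?case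
    by (cases k) (simp_all add: * Cons.IH[OF Cons.prems])
qed

text \<open>Conjugation with the exponential turns each derivative in direction j into itself plus
  multiplication by l times the j-th component of \<zeta>. The scalar l records the degree in
  \<zeta>, so comparing powers of l will separate the parts \<open>twist\<close>.\<close>

lemma partials_times_expo:
  assumes "open S" "smooth_on S g" "x \<in> S"
  shows "partials js (\<lambda>x. g x * expo (l *\<^sub>R \<zeta>) x) x
    = (\<Sum>k\<le>length js. complex_of_real l ^ k * twist \<zeta> g js k x) * expo (l *\<^sub>R \<zeta>) x"
  using assms(3)
proof (induction js arbitrary: x)
  case (Cons j js)
  define Q where "Q x = (\<Sum>k\<le>length js. complex_of_real l ^ k * twist \<zeta> g js k x)" for x
  have smQ: "smooth_on S Q" unfolding Q_def[abs_def]
    by (intro smooth_on_sum smooth_on_mult smooth_on_const smooth_on_twist assms)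
  have "partials (j # js) (\<lambda>x. g x * expo (l *\<^sub>R \<zeta>) x) x = dd (axis j 1) (\<lambda>x. Q x * expo (l *\<^sub>R \<zeta>) x) x"
    unfolding partials_simps partial_deriv_eq_dd
    by (rule dd_cong_open[OF assms(1) Cons.prems]) (simp only: Cons.IH Q_def)
  also have "\<dots> = (complex_of_real l * complex_of_real (\<zeta> $ j) * Q x + dd (axis j 1) Q x) * expo (l *\<^sub>R \<zeta>) x"
    unfolding dd_mult[OF assms(1) smQ smooth_on_expo[OF assms(1)] Cons.prems] dd_expo
    by (simp add: inner_axis algebra_simps)
  also have "dd (axis j 1) Q x = (\<Sum>k\<le>length js. complex_of_real l ^ k * dd (axis j 1) (twist \<zeta> g js k) x)"
    unfolding Q_def[abs_def]
    by (subst dd_sum[OF assms(1) _ Cons.prems])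
       (simp_all add: dd_cmult[OF assms(1) smooth_on_twist[OF assms(1,2)] Cons.prems] smooth_on_mult smooth_on_const smooth_on_twist assms)
  also have "complex_of_real l * complex_of_real (\<zeta> $ j) * Q x + (\<Sum>k\<le>length js. complex_of_real l ^ k * dd (axis j 1) (twist \<zeta> g js k) x)
     = (\<Sum>k\<le>Suc (length js). complex_of_real l ^ k * twist \<zeta> g (j # js) k x)"
  proof -
    have z: "twist \<zeta> g js (Suc (length js)) = (\<lambda>_. 0)" by (rule twist_eq_0) simp
    have "(\<Sum>k\<le>length js. complex_of_real l ^ k * dd (axis j 1) (twist \<zeta> g js k) x)
       = (\<Sum>k\<le>Suc (length js). complex_of_real l ^ k * dd (axis j 1) (twist \<zeta> g js k) x)"
      by (simp add: z)
    also have "\<dots> = dd (axis j 1) (twist \<zeta> g js 0) x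
       + (\<Sum>k\<le>length js. complex_of_real l ^ Suc k * dd (axis j 1) (twist \<zeta> g js (Suc k)) x)"
      by (subst sum.atMost_Suc_shift) simp
    finally show ?thesis
      unfolding sum.atMost_Suc_shift[of _ "length js"] Q_def
      by (simp add: sum_distrib_left distrib_left sum.distrib mult_ac)
  qed
  finally show ?case by simp
qed simp

lemma real_polynomial_zero:
  fixes c :: "nat \<Rightarrow> complex"
  assumes "\<And>t::real. (\<Sum>k\<le>n. c k * complex_of_real t ^ k) = 0" and "k \<le> n"
  shows "c k = 0"
proof -
  define p where "p = (\<Sum>k\<le>n. monom (c k) k)"
  have "poly p (complex_of_real t) = 0" for t
    using assms(1)[of t] by (simp add: p_def poly_sum poly_monom)
  then have "range complex_of_real \<subseteq> {z. poly p z = 0}" by auto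
  moreover have "infinite (range complex_of_real)"
    using finite_imageD[of complex_of_real UNIV] infinite_UNIV_char_0 by (auto simp: inj_on_def)
  ultimately have "p = 0" using poly_roots_finite finite_subset by blast
  moreover have "coeff p k = c k" using assms(2) by (simp add: p_def coeff_sum)
  ultimately show ?thesis by simp
qed

lemma finite_multi_indices: "finite {p :: 'n :: finite \<Rightarrow> nat. sum p UNIV \<le> m}"
proof (rule finite_subset)
  show "{p :: 'n \<Rightarrow> nat. sum p UNIV \<le> m} \<subseteq> PiE UNIV (\<lambda>_. {..m})"
  proof
    fix p :: "'n \<Rightarrow> nat" assume "p \<in> {p. sum p UNIV \<le> m}"
    then have "p i \<le> m" for i using member_le_sum[of i UNIV p] by simp
    then show "p \<in> PiE UNIV (\<lambda>_. {..m})" by (simp add: PiE_iff)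
  qed
qed (intro finite_PiE; simp)

lemma finite_multi_indices_eq: "finite {p :: 'n :: finite \<Rightarrow> nat. sum p UNIV = m}"
  by (rule finite_subset[OF _ finite_multi_indices[of m]]) auto

lemma sum_multi_indices_by_degree:
  fixes f :: "('n :: finite \<Rightarrow> nat) \<Rightarrow> 'a :: comm_monoid_add"
  shows "(\<Sum>p | sum p UNIV \<le> m. f p) = (\<Sum>k\<le>m. \<Sum>p | sum p UNIV = k. f p)"
proof -
  have "(\<Sum>p | sum p UNIV \<le> m. f p) = (\<Sum>k\<le>m. \<Sum>p | p \<in> {p. sum p UNIV \<le> m} \<and> sum p UNIV = k. f p)"
    by (rule sum.group[symmetric]) (auto simp: finite_multi_indices)
  also have "\<dots> = (\<Sum>k\<le>m. \<Sum>p | sum p UNIV = k. f p)"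
    by (intro sum.cong refl) auto
  finally show ?thesis .
qed

text \<open>The homogeneous part of degree k of the full symbol. The frequency comes before the
  point so that \<open>symbol_part a k \<zeta>\<close> can be differentiated in x.\<close>

definition symbol_part :: "(('n \<Rightarrow> nat) \<Rightarrow> real ^ 'n \<Rightarrow> complex) \<Rightarrow> nat \<Rightarrow> real ^ 'n \<Rightarrow> real ^ 'n \<Rightarrow> complex" where
  "symbol_part a k \<zeta> x = (\<Sum>p | sum p UNIV = k. a p x * complex_of_real (mpower \<zeta> p))"

lemma smooth_on_symbol_part:
  assumes "open S" "\<And>p. sum p UNIV = k \<Longrightarrow> smooth_on S (a p)"
  shows "smooth_on S (symbol_part a k \<zeta>)"
  unfolding symbol_part_def[abs_def]
  by (intro smooth_on_sum smooth_on_mult smooth_on_const) (use assms in auto)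

lemma laplacian_sum:
  assumes "open S" "\<And>i. i \<in> I \<Longrightarrow> smooth_on S (f i)" "x \<in> S"
  shows "laplacian (\<lambda>x. \<Sum>i\<in>I. c i * f i x) x = (\<Sum>i\<in>I. c i * laplacian (f i) x)"
proof -
  have sm: "smooth_on S (\<lambda>x. c i * f i x)" if "i \<in> I" for i
    by (intro smooth_on_mult smooth_on_const assms that)
  have "dds [v, w] (\<lambda>x. \<Sum>i\<in>I. c i * f i x) x = (\<Sum>i\<in>I. c i * dds [v, w] (f i) x)" for v w
  proof -
    have "dds [v, w] (\<lambda>x. \<Sum>i\<in>I. c i * f i x) x = (\<Sum>i\<in>I. dds [v, w] (\<lambda>x. c i * f i x) x)"
      by (rule dds_sum[OF assms(1) sm assms(3)])
    also have "\<dots> = (\<Sum>i\<in>I. c i * dds [v, w] (f i) x)"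
      by (intro sum.cong refl dds_cmult[OF assms(1) assms(2) assms(3)])
    finally show ?thesis .
  qed
  then show ?thesis unfolding laplacian_dd sum_distrib_left by (simp add: sum.swap[of _ UNIV])
qed

lemma laplacian_times_expo:
  assumes "open S" "smooth_on S Q" "x \<in> S"
  shows "laplacian (\<lambda>x. Q x * expo \<zeta> x) x
    = (laplacian Q x + 2 * dd \<zeta> Q x + complex_of_real (\<zeta> \<bullet> \<zeta>) * Q x) * expo \<zeta> x"
proof -
  have d1: "dd v (\<lambda>x. Q x * expo \<zeta> x) z = (dd v Q z + complex_of_real (\<zeta> \<bullet> v) * Q z) * expo \<zeta> z" if "smooth_on S Q" "z \<in> S" for Q v z
    unfolding dd_mult[OF assms(1) that(1) smooth_on_expo[OF assms(1)] that(2)] dd_expo by (simp add: algebra_simps)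
  have d2: "dd v (dd v (\<lambda>x. Q x * expo \<zeta> x)) x
     = (dd v (dd v Q) x + 2 * (complex_of_real (\<zeta> \<bullet> v) * dd v Q x) + complex_of_real ((\<zeta> \<bullet> v) * (\<zeta> \<bullet> v)) * Q x) * expo \<zeta> x" for v
  proof -
    define Q1 where "Q1 z = dd v Q z + complex_of_real (\<zeta> \<bullet> v) * Q z" for z
    have sm: "smooth_on S (\<lambda>z. complex_of_real (\<zeta> \<bullet> v) * Q z)" by (intro smooth_on_mult smooth_on_const assms)
    have smQ1: "smooth_on S Q1" unfolding Q1_def[abs_def]
      by (intro smooth_on_add smooth_on_dd assms sm)
    have "dd v (dd v (\<lambda>x. Q x * expo \<zeta> x)) x = dd v (\<lambda>x. Q1 x * expo \<zeta> x) x"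
      by (rule dd_cong_open[OF assms(1,3)]) (simp only: d1[OF assms(2)] Q1_def)
    also have "\<dots> = (dd v Q1 x + complex_of_real (\<zeta> \<bullet> v) * Q1 x) * expo \<zeta> x"
      by (rule d1[OF smQ1 assms(3)])
    also have "dd v Q1 x = dd v (dd v Q) x + complex_of_real (\<zeta> \<bullet> v) * dd v Q x"
      unfolding Q1_def[abs_def] dd_add[OF assms(1) smooth_on_dd[OF assms(1,2)] sm assms(3)]
        dd_cmult[OF assms] ..
    finally show ?thesis by (simp add: Q1_def algebra_simps)
  qed
  have z: "(\<Sum>i\<in>UNIV. complex_of_real (\<zeta> $ i) * dd (axis i 1) Q x) = dd \<zeta> Q x"
    by (simp add: dd_def[of \<zeta>] partial_deriv_eq_dd)
  have n: "(\<Sum>i\<in>UNIV. complex_of_real (\<zeta> $ i * \<zeta> $ i)) = complex_of_real (\<zeta> \<bullet> \<zeta>)"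
    by (simp add: inner_vec_def)
  have "laplacian (\<lambda>x. Q x * expo \<zeta> x) x = (\<Sum>i\<in>UNIV. (dd (axis i 1) (dd (axis i 1) Q) x
     + 2 * (complex_of_real (\<zeta> $ i) * dd (axis i 1) Q x) + complex_of_real (\<zeta> $ i * \<zeta> $ i) * Q x) * expo \<zeta> x)"
    unfolding laplacian_dd d2 by (simp add: inner_axis)
  also have "\<dots> = (laplacian Q x + 2 * (\<Sum>i\<in>UNIV. complex_of_real (\<zeta> $ i) * dd (axis i 1) Q x) + (\<Sum>i\<in>UNIV. complex_of_real (\<zeta> $ i * \<zeta> $ i)) * Q x) * expo \<zeta> x"
    unfolding laplacian_dd by (simp add: sum.distrib sum_distrib_left sum_distrib_right distrib_right)
  finally show ?thesis unfolding z n .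
qed

text \<open>Both products are evaluated on exp \<langle>l \<zeta>, x\<rangle> and the exponential is
  cancelled. The terms with the square of the frequency drop out of the commutator, and R times the
  symbol cancels against the undifferentiated part of \<open>twist\<close>; this is why the last sum
  runs only over k < sum p UNIV.\<close>

lemma commutator_symbol_sum:
  fixes a :: "('n \<Rightarrow> nat) \<Rightarrow> real ^ 'n \<Rightarrow> complex"
  assumes "open D" and a: "\<And>p. sum p UNIV \<le> m \<Longrightarrow> smooth_on D (a p)" and R: "smooth_on D R"
    and comm: "zero_operator_on D (commutator (schroedinger_op R) (diff_op m a))" and x: "x \<in> D"
  shows "(\<Sum>k\<le>m. complex_of_real l ^ k * laplacian (symbol_part a k \<zeta>) x)
     + 2 * complex_of_real l * (\<Sum>k\<le>m. complex_of_real l ^ k * dd \<zeta> (symbol_part a k \<zeta>) x)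
     + (\<Sum>p | sum p UNIV \<le> m. a p x * (\<Sum>k<sum p UNIV. complex_of_real l ^ k * twist \<zeta> R (index_list p) k x)) = 0"
proof -
  define \<eta> where "\<eta> = l *\<^sub>R \<zeta>"
  define Q where "Q x = (\<Sum>k\<le>m. complex_of_real l ^ k * symbol_part a k \<zeta> x)" for x
  have smk: "smooth_on D (symbol_part a k \<zeta>)" if "k \<in> {..m}" for k
    by (rule smooth_on_symbol_part[OF assms(1)]) (use a that in auto)
  have smQ: "smooth_on D Q" unfolding Q_def[abs_def]
    by (intro smooth_on_sum smooth_on_mult smooth_on_const smk assms)
  have mp: "complex_of_real (mpower \<eta> p) = complex_of_real l ^ sum p UNIV * complex_of_real (mpower \<zeta> p)" for p
    by (simp add: \<eta>_def mpower_def power_mult_distrib prod.distrib power_sum)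
  have Q_alt: "Q x = (\<Sum>p | sum p UNIV \<le> m. a p x * complex_of_real (mpower \<eta> p))" for x
    unfolding sum_multi_indices_by_degree Q_def symbol_part_def sum_distrib_left mp
    by (intro sum.cong refl) (auto simp: mult_ac)
  have PE: "diff_op m a (expo \<eta>) = (\<lambda>x. Q x * expo \<eta> x)"
    unfolding diff_op_def[abs_def] mderiv_expo Q_alt sum_distrib_right by (simp add: mult.assoc)
  define c where "c = complex_of_real (\<eta> \<bullet> \<eta>)"
  have lapE: "laplacian (expo \<eta>) x = c * expo \<eta> x" for x
  proof -
    have "laplacian (\<lambda>x. 1 * expo \<eta> x) x = (laplacian (\<lambda>_. 1) x + 2 * dd \<eta> (\<lambda>_. 1) x + c * 1) * expo \<eta> x"
      unfolding c_def by (rule laplacian_times_expo[OF open_UNIV smooth_on_const[OF open_UNIV]]) simp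
    also have "laplacian (\<lambda>_. 1) x = 0"
    proof -
      have "dd v (\<lambda>_. 1) = (\<lambda>_. 0)" for v :: "real ^ 'n" by (rule ext) simp
      then show ?thesis by (simp add: laplacian_dd)
    qed
    finally show ?thesis by simp
  qed
  have LE: "schroedinger_op R (expo \<eta>) = (\<lambda>x. R x * expo \<eta> x + (- c) * expo \<eta> x)"
    unfolding schroedinger_op_def[abs_def] lapE by simp
  have smRE: "smooth_on D (\<lambda>x. R x * expo \<eta> x)" by (intro smooth_on_mult R smooth_on_expo assms(1))
  have smcE: "smooth_on D (\<lambda>x. (- c) * expo \<eta> x)" by (intro smooth_on_mult smooth_on_const smooth_on_expo assms(1))
  have part: "mderiv p (schroedinger_op R (expo \<eta>)) x
    = (\<Sum>k\<le>sum p UNIV. complex_of_real l ^ k * twist \<zeta> R (index_list p) k x) * expo \<eta> x - c * (complex_of_real (mpower \<eta> p) * expo \<eta> x)" for p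
  proof -
    have "mderiv p (schroedinger_op R (expo \<eta>)) x
      = mderiv p (\<lambda>x. R x * expo \<eta> x) x + (- c) * mderiv p (expo \<eta>) x"
      unfolding LE mderiv_eq partials_eq_dds dds_add[OF assms(1) smRE smcE x]
        dds_cmult[OF assms(1) smooth_on_expo[OF assms(1)] x] ..
    also have "mderiv p (\<lambda>x. R x * expo \<eta> x) x = (\<Sum>k\<le>sum p UNIV. complex_of_real l ^ k * twist \<zeta> R (index_list p) k x) * expo \<eta> x"
      unfolding mderiv_eq \<eta>_def partials_times_expo[OF assms(1) R x] length_index_list ..
    finally show ?thesis unfolding mderiv_expo by simp
  qed
  have "0 = schroedinger_op R (diff_op m a (expo \<eta>)) x - diff_op m a (schroedinger_op R (expo \<eta>)) x"
    using comm x smooth_on_expo[OF assms(1)] unfolding zero_operator_on_def commutator_def by simp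
  also have "schroedinger_op R (diff_op m a (expo \<eta>)) x
     = - ((laplacian Q x + 2 * dd \<eta> Q x + c * Q x) * expo \<eta> x) + R x * (Q x * expo \<eta> x)"
    unfolding PE schroedinger_op_def c_def laplacian_times_expo[OF assms(1) smQ x] ..
  also have "diff_op m a (schroedinger_op R (expo \<eta>)) x
     = (\<Sum>p | sum p UNIV \<le> m. a p x * (\<Sum>k\<le>sum p UNIV. complex_of_real l ^ k * twist \<zeta> R (index_list p) k x)) * expo \<eta> x - c * Q x * expo \<eta> x"
    unfolding diff_op_def part Q_alt
    by (simp add: right_diff_distrib sum_subtractf sum_distrib_left sum_distrib_right mult_ac)
  finally have e: "0 = - ((laplacian Q x + 2 * dd \<eta> Q x + c * Q x) * expo \<eta> x) + R x * (Q x * expo \<eta> x)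
     - ((\<Sum>p | sum p UNIV \<le> m. a p x * (\<Sum>k\<le>sum p UNIV. complex_of_real l ^ k * twist \<zeta> R (index_list p) k x)) * expo \<eta> x - c * Q x * expo \<eta> x)" .
  have cancel: "A1 + 2 * A2 + (T - r * q) = 0"
    if "0 = - ((A1 + 2 * A2 + c' * q) * E) + r * (q * E) - (T * E - c' * q * E)" "E \<noteq> 0" for A1 A2 T r q c' E :: complex
  proof -
    have "(A1 + 2 * A2 + (T - r * q)) * E = 0" using that(1) by (simp add: algebra_simps)
    then show ?thesis using that(2) by simp
  qed
  have "laplacian Q x + 2 * dd \<eta> Q x + ((\<Sum>p | sum p UNIV \<le> m. a p x * (\<Sum>k\<le>sum p UNIV. complex_of_real l ^ k * twist \<zeta> R (index_list p) k x)) - R x * Q x) = 0"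
    by (rule cancel[OF e expo_nonzero])
  moreover have "(\<Sum>p | sum p UNIV \<le> m. a p x * (\<Sum>k\<le>sum p UNIV. complex_of_real l ^ k * twist \<zeta> R (index_list p) k x)) - R x * Q x
      = (\<Sum>p | sum p UNIV \<le> m. a p x * (\<Sum>k<sum p UNIV. complex_of_real l ^ k * twist \<zeta> R (index_list p) k x))"
  proof -
    have top: "twist \<zeta> R (index_list p) (sum p UNIV) x = complex_of_real (mpower \<zeta> p) * R x" for p
      using twist_top[of \<zeta> R "index_list p" x] unfolding length_index_list prod_list_index_list by (simp add: mpower_def)
    show ?thesis unfolding Q_alt sum_distrib_left sum_subtractf[symmetric]
    proof (intro sum.cong refl)
      fix p
      have "(\<Sum>k\<le>sum p UNIV. complex_of_real l ^ k * twist \<zeta> R (index_list p) k x)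
        = (\<Sum>k<sum p UNIV. complex_of_real l ^ k * twist \<zeta> R (index_list p) k x) + complex_of_real (mpower \<eta> p) * R x"
        unfolding lessThan_Suc_atMost[symmetric] sum.lessThan_Suc top mp by (simp add: mult_ac)
      then show "(\<Sum>k\<le>sum p UNIV. a p x * (complex_of_real l ^ k * twist \<zeta> R (index_list p) k x)) - R x * (a p x * complex_of_real (mpower \<eta> p))
         = (\<Sum>k<sum p UNIV. a p x * (complex_of_real l ^ k * twist \<zeta> R (index_list p) k x))"
        unfolding sum_distrib_left[symmetric] by (simp add: algebra_simps)
    qed
  qed
  moreover have "laplacian Q x = (\<Sum>k\<le>m. complex_of_real l ^ k * laplacian (symbol_part a k \<zeta>) x)"
    unfolding Q_def[abs_def] by (rule laplacian_sum[OF assms(1) smk x])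
  moreover have "dd \<eta> Q x = complex_of_real l * (\<Sum>k\<le>m. complex_of_real l ^ k * dd \<zeta> (symbol_part a k \<zeta>) x)"
  proof -
    have sm: "smooth_on D (\<lambda>x. complex_of_real l ^ k * symbol_part a k \<zeta> x)" if "k \<in> {..m}" for k
      by (intro smooth_on_mult smooth_on_const smk assms(1) that)
    have "dd \<zeta> Q x = (\<Sum>k\<le>m. dd \<zeta> (\<lambda>x. complex_of_real l ^ k * symbol_part a k \<zeta> x) x)"
      unfolding Q_def[abs_def] by (rule dd_sum[OF assms(1) sm x])
    also have "\<dots> = (\<Sum>k\<le>m. complex_of_real l ^ k * dd \<zeta> (symbol_part a k \<zeta>) x)"
      by (intro sum.cong refl dd_cmult[OF assms(1) smk x])
    finally show ?thesis unfolding \<eta>_def dd_vector_scale by simp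
  qed
  ultimately show ?thesis by (simp add: mult.assoc)
qed

text \<open>The coefficient of l ^ k. It determines the derivative of the part of degree k - 1 along
  \<zeta> from parts of degree at least k, which is the basis of the descent from the principal
  symbol.\<close>

lemma commutator_symbol_equation:
  fixes a :: "('n \<Rightarrow> nat) \<Rightarrow> real ^ 'n \<Rightarrow> complex"
  assumes "open D" and a: "\<And>p. sum p UNIV \<le> m \<Longrightarrow> smooth_on D (a p)" and R: "smooth_on D R"
    and comm: "zero_operator_on D (commutator (schroedinger_op R) (diff_op m a))" and x: "x \<in> D"
    and k: "k \<le> m"
  shows "laplacian (symbol_part a k \<zeta>) x
     + 2 * (case k of 0 \<Rightarrow> 0 | Suc k' \<Rightarrow> dd \<zeta> (symbol_part a k' \<zeta>) x)
     + (\<Sum>p | k < sum p UNIV \<and> sum p UNIV \<le> m. a p x * twist \<zeta> R (index_list p) k x) = 0"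
proof -
  \<comment> \<open>The first-order term carries an additional factor l, so powers up to m + 1
    occur, and the other two families are extended to that range.\<close>
  define A where "A k = (if k \<le> m then laplacian (symbol_part a k \<zeta>) x else 0)" for k
  define B where "B k = (case k of 0 \<Rightarrow> 0 | Suc k' \<Rightarrow> dd \<zeta> (symbol_part a k' \<zeta>) x)" for k
  define T where "T k = (\<Sum>p | k < sum p UNIV \<and> sum p UNIV \<le> m. a p x * twist \<zeta> R (index_list p) k x)" for k
  have "(\<Sum>k\<le>Suc m. (A k + 2 * B k + T k) * complex_of_real l ^ k) = 0" for l
  proof -
    let ?l = "complex_of_real l"
    have "(\<Sum>k\<le>m. ?l ^ k * laplacian (symbol_part a k \<zeta>) x) = (\<Sum>k\<le>Suc m. A k * ?l ^ k)"
      by (simp add: A_def mult.commute)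
    moreover have "2 * ?l * (\<Sum>k\<le>m. ?l ^ k * dd \<zeta> (symbol_part a k \<zeta>) x) = (\<Sum>k\<le>Suc m. 2 * B k * ?l ^ k)"
      by (subst sum.atMost_Suc_shift) (simp add: B_def sum_distrib_left mult_ac)
    moreover have "(\<Sum>p | sum p UNIV \<le> m. a p x * (\<Sum>k<sum p UNIV. ?l ^ k * twist \<zeta> R (index_list p) k x)) = (\<Sum>k\<le>Suc m. T k * ?l ^ k)"
    proof -
      have "(\<Sum>k<sum p UNIV. ?l ^ k * twist \<zeta> R (index_list p) k x) = (\<Sum>k\<le>Suc m. if k < sum p UNIV then ?l ^ k * twist \<zeta> R (index_list p) k x else 0)"
        if "sum p UNIV \<le> m" for p :: "'n \<Rightarrow> nat"
        using that by (intro sum.mono_neutral_cong_left) auto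
      note ext = this
      have "(\<Sum>p | sum p UNIV \<le> m. a p x * (\<Sum>k<sum p UNIV. ?l ^ k * twist \<zeta> R (index_list p) k x))
        = (\<Sum>p | sum p UNIV \<le> m. \<Sum>k\<le>Suc m. if k < sum p UNIV then a p x * twist \<zeta> R (index_list p) k x * ?l ^ k else 0)"
      proof (intro sum.cong refl)
        fix p :: "'n \<Rightarrow> nat" assume "p \<in> {p. sum p UNIV \<le> m}"
        then have "sum p UNIV \<le> m" by simp
        then show "a p x * (\<Sum>k<sum p UNIV. ?l ^ k * twist \<zeta> R (index_list p) k x)
          = (\<Sum>k\<le>Suc m. if k < sum p UNIV then a p x * twist \<zeta> R (index_list p) k x * ?l ^ k else 0)"
          unfolding ext[OF \<open>sum p UNIV \<le> m\<close>] sum_distrib_left by (intro sum.cong refl) (simp add: mult_ac)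
      qed
      also have "\<dots> = (\<Sum>k\<le>Suc m. \<Sum>p | sum p UNIV \<le> m. if k < sum p UNIV then a p x * twist \<zeta> R (index_list p) k x * ?l ^ k else 0)"
        by (rule sum.swap)
      also have "\<dots> = (\<Sum>k\<le>Suc m. T k * ?l ^ k)"
      proof (intro sum.cong refl)
        fix k
        have "(\<Sum>p | sum p UNIV \<le> m. if k < sum p UNIV then a p x * twist \<zeta> R (index_list p) k x * ?l ^ k else 0)
           = (\<Sum>p \<in> {p \<in> {p. sum p UNIV \<le> m}. k < sum p UNIV}. a p x * twist \<zeta> R (index_list p) k x * ?l ^ k)"
          by (rule sum.inter_filter[symmetric]) (rule finite_multi_indices)
        also have "{p \<in> {p :: 'n \<Rightarrow> nat. sum p UNIV \<le> m}. k < sum p UNIV} = {p. k < sum p UNIV \<and> sum p UNIV \<le> m}" by auto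
        finally show "(\<Sum>p | sum p UNIV \<le> m. if k < sum p UNIV then a p x * twist \<zeta> R (index_list p) k x * ?l ^ k else 0) = T k * ?l ^ k"
          by (simp add: T_def sum_distrib_right)
      qed
      finally show ?thesis .
    qed
    ultimately show ?thesis
      using commutator_symbol_sum[OF assms(1-5), of l \<zeta>] by (simp only: sum.distrib distrib_right)
  qed
  then have "A k + 2 * B k + T k = 0" by (rule real_polynomial_zero) (use k in simp)
  then show ?thesis using k by (simp add: A_def B_def T_def)
qed

section \<open>Polynomials invariant under infinitely many reflections\<close>

lemma linear_reflection: "linear (reflection \<alpha>)"
  by (rule linearI) (simp_all add: reflection_def inner_add_right algebra_simps add_divide_distrib)

lemma reflection_reflection: "\<alpha> \<noteq> 0 \<Longrightarrow> reflection \<alpha> (reflection \<alpha> x) = x"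
  by (simp add: reflection_def inner_diff_right field_simps)

lemma reflection_scaleR: "c \<noteq> 0 \<Longrightarrow> reflection (c *\<^sub>R \<alpha>) = reflection \<alpha>"
  by (auto simp: reflection_def fun_eq_iff)

lemma inner_reflection: "\<alpha> \<noteq> 0 \<Longrightarrow> reflection \<alpha> x \<bullet> reflection \<alpha> y = x \<bullet> y"
  by (simp add: reflection_def inner_diff_left inner_diff_right inner_commute field_simps)

lemma norm_reflection: "\<alpha> \<noteq> 0 \<Longrightarrow> norm (reflection \<alpha> x) = norm x"
  by (simp add: norm_eq_sqrt_inner inner_reflection)

lemma reflection_conjugate:
  assumes "\<alpha> \<noteq> 0"
  shows "reflection (reflection \<alpha> v) (reflection \<alpha> x) = reflection \<alpha> (reflection v x)"
proof -
  have "reflection \<alpha> (reflection v x) = reflection \<alpha> x - (2 * (v \<bullet> x) / (v \<bullet> v)) *\<^sub>R reflection \<alpha> v"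
    using linear_diff[OF linear_reflection, of \<alpha>] linear_scale[OF linear_reflection, of \<alpha>]
    by (simp add: reflection_def[of v])
  then show ?thesis by (simp add: reflection_def[of "reflection \<alpha> v"] inner_reflection[OF assms])
qed

lemma reflection_swap:
  assumes "norm x = norm y" "x \<noteq> y"
  shows "reflection (x - y) x = y"
proof -
  have "x \<bullet> x = y \<bullet> y" using assms(1) by (simp add: norm_eq)
  then have d: "(x - y) \<bullet> (x - y) = 2 * ((x - y) \<bullet> x)"
    by (simp add: inner_diff_left inner_diff_right inner_commute)
  have "(x - y) \<bullet> (x - y) \<noteq> 0" using assms(2) by simp
  then have "2 * ((x - y) \<bullet> x) / ((x - y) \<bullet> (x - y)) = 1" unfolding d[symmetric] by (rule divide_self)
  then show ?thesis unfolding reflection_def by (simp only:) simp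
qed

definition mirror :: "(real ^ 'n \<Rightarrow> complex) \<Rightarrow> real ^ 'n \<Rightarrow> bool" where
  "mirror \<sigma> u \<longleftrightarrow> u \<noteq> 0 \<and> (\<forall>\<xi>. \<sigma> (reflection u \<xi>) = \<sigma> \<xi>)"

lemma mirror_scaleR: "mirror \<sigma> u \<Longrightarrow> c \<noteq> 0 \<Longrightarrow> mirror \<sigma> (c *\<^sub>R u)"
  by (simp add: mirror_def reflection_scaleR)

lemma mirror_reflection:
  assumes "mirror \<sigma> u" "mirror \<sigma> v"
  shows "mirror \<sigma> (reflection u v)"
proof -
  have u: "u \<noteq> 0" "v \<noteq> 0" using assms by (auto simp: mirror_def)
  have "\<sigma> (reflection (reflection u v) \<xi>) = \<sigma> \<xi>" for \<xi>
  proof -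
    have "reflection (reflection u v) \<xi> = reflection u (reflection v (reflection u \<xi>))"
      using reflection_conjugate[OF u(1), of v "reflection u \<xi>"] by (simp add: reflection_reflection[OF u(1)])
    then show ?thesis using assms by (simp add: mirror_def)
  qed
  moreover have "reflection u v \<noteq> 0" using norm_reflection[OF u(1), of v] u(2) by auto
  ultimately show ?thesis by (simp add: mirror_def)
qed

lemma mirror_limit:
  assumes "continuous_on UNIV \<sigma>" "X \<longlonglongrightarrow> u" "u \<noteq> 0" "\<And>n. mirror \<sigma> (X n)"
  shows "mirror \<sigma> u"
proof -
  have "\<sigma> (reflection u \<xi>) = \<sigma> \<xi>" for \<xi>
  proof -
    have lim: "(\<lambda>n. reflection (X n) \<xi>) \<longlonglongrightarrow> reflection u \<xi>"
      unfolding reflection_def by (intro tendsto_intros assms(2)) (use assms(3) in simp)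
    have "(\<lambda>n. \<sigma> (reflection (X n) \<xi>)) \<longlonglongrightarrow> \<sigma> (reflection u \<xi>)"
      by (rule continuous_on_tendsto_compose[OF assms(1) lim]) auto
    moreover have "(\<lambda>n. \<sigma> (reflection (X n) \<xi>)) = (\<lambda>_. \<sigma> \<xi>)" using assms(4) by (simp add: mirror_def)
    ultimately show ?thesis using LIMSEQ_unique tendsto_const by metis
  qed
  then show ?thesis using assms(3) by (simp add: mirror_def)
qed

text \<open>The condition concerns every translate of V, not V alone: when x - y lies in V, equal
  norms mean that the components of x and y in V have equal norm.\<close>

definition spherical_on :: "(real ^ 'n \<Rightarrow> complex) \<Rightarrow> (real ^ 'n) set \<Rightarrow> bool" where
  "spherical_on \<sigma> V \<longleftrightarrow> subspace V \<and> (\<forall>x y. x - y \<in> V \<longrightarrow> norm x = norm y \<longrightarrow> \<sigma> x = \<sigma> y)"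

text \<open>Two vectors x and y of equal norm are exchanged by the reflection in x - y, and here
  this vector is a mirror.\<close>

lemma spherical_on_mirror:
  assumes "subspace V" "\<And>u. u \<in> V \<Longrightarrow> u \<noteq> 0 \<Longrightarrow> mirror \<sigma> u"
  shows "spherical_on \<sigma> V"
  unfolding spherical_on_def
proof (intro conjI allI impI assms(1))
  fix x y assume xy: "x - y \<in> V" "norm x = norm y"
  show "\<sigma> x = \<sigma> y"
  proof (cases "x = y")
    case False
    then have "mirror \<sigma> (x - y)" using assms(2) xy by simp
    then show ?thesis using reflection_swap[OF xy(2) False] by (metis mirror_def)
  qed simp
qed

text \<open>Reflecting the unit vector at angle k \<theta> in the one at angle (k + 1) \<theta>
  gives the negative of the one at angle (k + 2) \<theta>. Mirrors are stable under each other and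
  under sign, so two of them generate the whole arithmetic progression.\<close>

lemma mirror_circle:
  assumes u: "mirror \<sigma> u" and v: "mirror \<sigma> (cos \<theta> *\<^sub>R u + sin \<theta> *\<^sub>R w)"
    and "norm u = 1" "norm w = 1" "u \<bullet> w = 0"
  shows "mirror \<sigma> (cos (of_nat k * \<theta>) *\<^sub>R u + sin (of_nat k * \<theta>) *\<^sub>R w)"
proof -
  define x where "x k = cos (of_nat k * \<theta>) *\<^sub>R u + sin (of_nat k * \<theta>) *\<^sub>R w" for k :: nat
  have uu: "u \<bullet> u = 1" "w \<bullet> w = 1" "w \<bullet> u = 0" using assms by (simp_all add: norm_eq_1 inner_commute)
  have in_x: "x k \<bullet> x l = cos (of_nat k * \<theta> - of_nat l * \<theta>)" for k l
    unfolding x_def by (simp add: inner_add_left inner_add_right uu \<open>u \<bullet> w = 0\<close> cos_diff)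
  have rec: "reflection (x (Suc k)) (x k) = - x (Suc (Suc k))" for k
  proof -
    have "x (Suc k) \<bullet> x (Suc k) = 1" "x (Suc k) \<bullet> x k = cos \<theta>" by (simp_all add: in_x algebra_simps)
    then have "reflection (x (Suc k)) (x k) = x k - (2 * cos \<theta>) *\<^sub>R x (Suc k)" by (simp add: reflection_def)
    moreover have "cos (of_nat (Suc (Suc k)) * \<theta>) = 2 * cos \<theta> * cos (of_nat (Suc k) * \<theta>) - cos (of_nat k * \<theta>)"
    proof -
      have "cos (of_nat (Suc (Suc k)) * \<theta>) = cos (of_nat (Suc k) * \<theta> + \<theta>)" "cos (of_nat k * \<theta>) = cos (of_nat (Suc k) * \<theta> - \<theta>)"
        by (simp_all add: algebra_simps)
      then show ?thesis by (simp add: cos_add cos_diff)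
    qed
    moreover have "sin (of_nat (Suc (Suc k)) * \<theta>) = 2 * cos \<theta> * sin (of_nat (Suc k) * \<theta>) - sin (of_nat k * \<theta>)"
    proof -
      have "sin (of_nat (Suc (Suc k)) * \<theta>) = sin (of_nat (Suc k) * \<theta> + \<theta>)" "sin (of_nat k * \<theta>) = sin (of_nat (Suc k) * \<theta> - \<theta>)"
        by (simp_all add: algebra_simps)
      then show ?thesis by (simp add: sin_add sin_diff)
    qed
    ultimately show ?thesis unfolding x_def by (simp only:) (simp add: algebra_simps)
  qed
  have "mirror \<sigma> (x k) \<and> mirror \<sigma> (x (Suc k))"
  proof (induction k)
    case 0
    then show ?case using u v by (simp add: x_def)
  next
    case (Suc k)
    then have "mirror \<sigma> (- x (Suc (Suc k)))" using mirror_reflection[of \<sigma> "x (Suc k)" "x k"] rec by simp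
    then have "mirror \<sigma> (x (Suc (Suc k)))" using mirror_scaleR[of \<sigma> "- x (Suc (Suc k))" "-1"] by simp
    then show ?case using Suc by simp
  qed
  then show ?thesis by (simp add: x_def)
qed

text \<open>Mirrors accumulating at \<open>u\<close> generate rotations by arbitrarily small angles in planes through \<open>u\<close>; in the
  limit all unit vectors of a plane are mirrors.\<close>

lemma spherical_plane_exists:
  fixes \<sigma> :: "real ^ 'n \<Rightarrow> complex"
  assumes cont: "continuous_on UNIV \<sigma>" and inf: "infinite {u. norm u = 1 \<and> mirror \<sigma> u}"
  shows "\<exists>V. spherical_on \<sigma> V \<and> dim V = 2"
proof -
  define M where "M = {u. norm u = 1 \<and> mirror \<sigma> u}"
  have "M \<subseteq> sphere 0 1" by (auto simp: M_def)
  moreover have "compact (sphere (0 :: real ^ 'n) 1)" by simp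
  ultimately obtain u where u: "u \<in> sphere 0 1" "u islimpt M"
    using inf compact_eq_Bolzano_Weierstrass[of "sphere (0 :: real ^ 'n) 1"] unfolding M_def[symmetric] by blast
  have nu: "norm u = 1" using u by simp
  have uu: "u \<bullet> u = 1" using nu by (simp add: norm_eq_1)
  \<comment> \<open>The unit ball around u excludes -u, so the angle between u and
    \<open>X n\<close> lies strictly between 0 and pi and has positive sine.\<close>
  have "u islimpt (M \<inter> ball u 1)" by (rule islimpt_Int_eventually[OF u(2) eventually_at_in_open']) auto
  then obtain X where X: "\<And>n. X n \<in> M" "\<And>n. X n \<in> ball u 1" "\<And>n. X n \<noteq> u" "X \<longlonglongrightarrow> u"
    unfolding islimpt_sequential by auto
  have Xm: "mirror \<sigma> (X n)" "norm (X n) = 1" "X n \<bullet> X n = 1" for n using X(1)[of n] by (auto simp: M_def norm_eq_1)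
  have um: "mirror \<sigma> u" by (rule mirror_limit[OF cont X(4)]) (use nu Xm in auto)
  define \<theta> where "\<theta> n = arccos (u \<bullet> X n)" for n
  have c_bounds: "- 1 < u \<bullet> X n" "u \<bullet> X n < 1" for n
  proof -
    have d: "(X n - u) \<bullet> (X n - u) = 2 - 2 * (u \<bullet> X n)"
      using Xm(3)[of n] uu by (simp add: inner_diff_left inner_diff_right inner_commute)
    have "(X n - u) \<bullet> (X n - u) > 0" using X(3)[of n] by (simp only: inner_gt_zero_iff) simp
    then show "u \<bullet> X n < 1" using d by simp
    have "norm (X n - u) < 1" using X(2)[of n] by (simp add: dist_norm norm_minus_commute)
    then have "(X n - u) \<bullet> (X n - u) < 1" by (simp add: dot_square_norm abs_square_less_1)
    then show "- 1 < u \<bullet> X n" using d by simp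
  qed
  have th: "0 < \<theta> n" "\<theta> n < pi" "cos (\<theta> n) = u \<bullet> X n" for n
    using c_bounds[of n] arccos_lt_bounded[of "u \<bullet> X n"] by (auto simp: \<theta>_def cos_arccos)
  have sin_pos: "sin (\<theta> n) > 0" for n using th sin_gt_zero by blast
  have "(\<lambda>n. u \<bullet> X n) \<longlonglongrightarrow> u \<bullet> u" by (intro tendsto_intros X(4))
  then have "(\<lambda>n. arccos (u \<bullet> X n)) \<longlonglongrightarrow> arccos (u \<bullet> u)"
    using c_bounds uu by (intro continuous_on_tendsto_compose[OF continuous_on_arccos']) (auto intro!: always_eventually less_imp_le)
  then have th_lim: "\<theta> \<longlonglongrightarrow> 0" by (simp add: \<theta>_def[abs_def] uu)
  \<comment> \<open>The unit vector orthogonal to u in the plane of u and \<open>X n\<close>. A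
    limit W of these directions will span the plane together with u.\<close>
  define w where "w n = (1 / sin (\<theta> n)) *\<^sub>R (X n - cos (\<theta> n) *\<^sub>R u)" for n
  have Xw: "X n = cos (\<theta> n) *\<^sub>R u + sin (\<theta> n) *\<^sub>R w n" for n
    using sin_pos[of n] by (simp add: w_def)
  have uw: "u \<bullet> w n = 0" for n
    using uu th(3)[of n] by (simp add: w_def inner_diff_right)
  have nw: "norm (w n) = 1" for n
  proof -
    have "(X n - cos (\<theta> n) *\<^sub>R u) \<bullet> (X n - cos (\<theta> n) *\<^sub>R u) = 1 - (cos (\<theta> n))\<^sup>2"
      using Xm(3)[of n] uu th(3)[of n]
      by (simp add: inner_diff_left inner_diff_right inner_commute power2_eq_square)
    also have "\<dots> = (sin (\<theta> n))\<^sup>2" by (simp add: sin_squared_eq)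
    finally have "w n \<bullet> w n = 1" using sin_pos[of n] by (simp add: w_def power2_eq_square)
    then show ?thesis by (simp add: norm_eq_1)
  qed
  have "compact (sphere (0 :: real ^ 'n) 1)" by simp
  then obtain W r where W: "W \<in> sphere 0 1" "strict_mono r" "(w \<circ> r) \<longlonglongrightarrow> W"
    using nw unfolding compact_def by (metis (no_types, lifting) dist_0_norm mem_sphere)
  have nW: "norm W = 1" using W by simp
  have uW: "u \<bullet> W = 0"
  proof -
    have "(\<lambda>n. u \<bullet> (w \<circ> r) n) \<longlonglongrightarrow> u \<bullet> W" by (intro tendsto_intros W(3))
    then show ?thesis using LIMSEQ_unique[OF _ tendsto_const] by (simp add: uw)
  qed
  have circle: "mirror \<sigma> (cos \<phi> *\<^sub>R u + sin \<phi> *\<^sub>R W)" if "\<phi> \<ge> 0" for \<phi>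
  proof -
    \<comment> \<open>This multiple of the small angle approximates \<phi> from below with error at
      most that angle, which tends to 0.\<close>
    define k where "k n = nat \<lfloor>\<phi> / \<theta> (r n)\<rfloor>" for n
    have k1: "of_nat (k n) * \<theta> (r n) \<le> \<phi>" "\<phi> - \<theta> (r n) \<le> of_nat (k n) * \<theta> (r n)" for n
    proof -
      have t: "\<theta> (r n) > 0" by (rule th)
      have "0 \<le> \<phi> / \<theta> (r n)" using that t by simp
      then have "real (k n) = of_int \<lfloor>\<phi> / \<theta> (r n)\<rfloor>" by (simp add: k_def)
      then have "real (k n) \<le> \<phi> / \<theta> (r n)" "\<phi> / \<theta> (r n) \<le> real (k n) + 1"
        using of_int_floor_le[of "\<phi> / \<theta> (r n)"] real_of_int_floor_add_one_ge[of "\<phi> / \<theta> (r n)"] by linarith+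
      then have "real (k n) * \<theta> (r n) \<le> \<phi>" "\<phi> \<le> (real (k n) + 1) * \<theta> (r n)"
        unfolding pos_le_divide_eq[OF t] pos_divide_le_eq[OF t] .
      then show "of_nat (k n) * \<theta> (r n) \<le> \<phi>" "\<phi> - \<theta> (r n) \<le> of_nat (k n) * \<theta> (r n)"
        by (simp_all add: distrib_right)
    qed
    have "(\<lambda>n. \<theta> (r n)) \<longlonglongrightarrow> 0" using LIMSEQ_subseq_LIMSEQ[OF th_lim W(2)] by (simp add: o_def)
    then have "(\<lambda>n. \<phi> - \<theta> (r n)) \<longlonglongrightarrow> \<phi> - 0" by (intro tendsto_diff tendsto_const)
    then have low: "(\<lambda>n. \<phi> - \<theta> (r n)) \<longlonglongrightarrow> \<phi>" by simp
    have klim: "(\<lambda>n. of_nat (k n) * \<theta> (r n)) \<longlonglongrightarrow> \<phi>"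
      by (rule tendsto_sandwich[OF _ _ low tendsto_const]; rule always_eventually; rule allI; rule k1)
    have "(\<lambda>n. cos (of_nat (k n) * \<theta> (r n)) *\<^sub>R u + sin (of_nat (k n) * \<theta> (r n)) *\<^sub>R (w \<circ> r) n)
      \<longlonglongrightarrow> cos \<phi> *\<^sub>R u + sin \<phi> *\<^sub>R W"
      by (intro tendsto_intros klim W(3))
    then show ?thesis
    proof (rule mirror_limit[OF cont])
      have "(cos \<phi> *\<^sub>R u + sin \<phi> *\<^sub>R W) \<bullet> (cos \<phi> *\<^sub>R u + sin \<phi> *\<^sub>R W) = 1"
        using uu uW nW by (simp add: inner_add_left inner_add_right inner_commute norm_eq_1 flip: power2_eq_square)
      then show "cos \<phi> *\<^sub>R u + sin \<phi> *\<^sub>R W \<noteq> 0" by force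
      fix n
      have "mirror \<sigma> (cos (\<theta> (r n)) *\<^sub>R u + sin (\<theta> (r n)) *\<^sub>R w (r n))" using Xm(1)[of "r n"] Xw[of "r n"] by simp
      then show "mirror \<sigma> (cos (of_nat (k n) * \<theta> (r n)) *\<^sub>R u + sin (of_nat (k n) * \<theta> (r n)) *\<^sub>R (w \<circ> r) n)"
        using mirror_circle[OF um _ nu nw uw] by simp
    qed
  qed
  have "spherical_on \<sigma> (span {u, W})"
  proof (rule spherical_on_mirror)
    fix x assume x: "x \<in> span {u, W}" "x \<noteq> 0"
    then obtain a b where ab: "x = a *\<^sub>R u + b *\<^sub>R W" by (auto simp: span_breakdown_eq algebra_simps)
    then have "a \<noteq> 0 \<or> b \<noteq> 0" using x by auto
    define \<rho> where "\<rho> = sqrt (a\<^sup>2 + b\<^sup>2)"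
    have "\<rho> > 0" using \<open>a \<noteq> 0 \<or> b \<noteq> 0\<close> by (auto simp: \<rho>_def sum_power2_gt_zero_iff)
    have "(a / \<rho>)\<^sup>2 + (b / \<rho>)\<^sup>2 = 1"
    proof -
      have r2: "\<rho>\<^sup>2 = a\<^sup>2 + b\<^sup>2" by (simp add: \<rho>_def)
      have "(a / \<rho>)\<^sup>2 + (b / \<rho>)\<^sup>2 = (a\<^sup>2 + b\<^sup>2) / \<rho>\<^sup>2" by (simp add: power_divide add_divide_distrib)
      also have "\<dots> = \<rho>\<^sup>2 / \<rho>\<^sup>2" unfolding r2 ..
      also have "\<dots> = 1" using \<open>\<rho> > 0\<close> by simp
      finally show ?thesis .
    qed
    then obtain t where t: "0 \<le> t" "t < 2 * pi" "a / \<rho> = cos t" "b / \<rho> = sin t"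
      by (rule sincos_total_2pi)
    have xe: "x = \<rho> *\<^sub>R (cos t *\<^sub>R u + sin t *\<^sub>R W)"
      unfolding t(3,4)[symmetric] ab scaleR_add_right using \<open>\<rho> > 0\<close> by simp
    have "mirror \<sigma> (\<rho> *\<^sub>R (cos t *\<^sub>R u + sin t *\<^sub>R W))"
      by (rule mirror_scaleR[OF circle[OF t(1)]]) (use \<open>\<rho> > 0\<close> in simp)
    then show "mirror \<sigma> x" unfolding xe[symmetric] .
  qed simp
  moreover have "dim (span {u, W}) = 2"
  proof -
    have "u \<noteq> W" using uu uW by auto
    moreover have "independent {u, W}"
      using nu nW uW \<open>u \<noteq> W\<close> by (intro pairwise_orthogonal_independent) (auto simp: pairwise_def orthogonal_def inner_commute)
    ultimately show ?thesis by (simp add: dim_eq_card_independent)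
  qed
  ultimately show ?thesis by blast
qed

text \<open>Rotating inside \<open>V\<close> before reflecting in \<open>\<alpha>\<close> tilts \<open>V\<close> by all small angles, so \<open>\<sigma>\<close> is constant along a
  small arc from \<open>V\<close> towards its normal direction; as \<open>\<sigma>\<close> is a trigonometric polynomial of the angle, it is constant
  along the full circle.\<close>

lemma spherical_on_extend:
  fixes \<sigma> :: "real ^ 'n \<Rightarrow> complex"
  assumes \<sigma>: "\<And>\<xi>. \<sigma> \<xi> = (\<Sum>p\<in>A. c p * complex_of_real (mpower \<xi> p))"
    and V: "spherical_on \<sigma> V" "dim V \<ge> 2" and \<alpha>: "mirror \<sigma> \<alpha>" "\<alpha> \<notin> V" "v0 \<in> V" "\<alpha> \<bullet> v0 \<noteq> 0"
  shows "spherical_on \<sigma> (span (insert \<alpha> V))"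
proof -
  have subV: "subspace V" and sph: "\<And>x y. x - y \<in> V \<Longrightarrow> norm x = norm y \<Longrightarrow> \<sigma> x = \<sigma> y"
    using V(1) by (auto simp: spherical_on_def)
  \<comment> \<open>The vector \<alpha> is split into a in V and b orthogonal to V. The hypotheses
    on \<alpha> say that neither part is 0, so the reflection really tilts V.\<close>
  obtain a b where "a \<in> span V" and bV: "\<And>w. w \<in> span V \<Longrightarrow> orthogonal b w" and ab: "\<alpha> = a + b"
    using orthogonal_subspace_decomp_exists[of V \<alpha>] by metis
  have spV: "span V = V" using subV by simp
  have a: "a \<in> V" using \<open>a \<in> span V\<close> spV by simp
  have bV: "b \<bullet> w = 0" if "w \<in> V" for w using bV[of w] that spV by (simp add: orthogonal_def)
  have "b \<noteq> 0" using \<alpha>(2) a ab by auto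
  have "a \<noteq> 0" using \<alpha>(3,4) bV ab by (auto simp: inner_add_left)
  define a1 where "a1 = (1 / norm a) *\<^sub>R a"
  define b1 where "b1 = (1 / norm b) *\<^sub>R b"
  have a1: "a1 \<in> V" "norm a1 = 1" "a = norm a *\<^sub>R a1" using a \<open>a \<noteq> 0\<close> subV by (auto simp: a1_def subspace_scale)
  have b1: "norm b1 = 1" "b = norm b *\<^sub>R b1" "\<And>w. w \<in> V \<Longrightarrow> b1 \<bullet> w = 0" using \<open>b \<noteq> 0\<close> bV by (auto simp: b1_def)
  have sq: "a1 \<bullet> a1 = 1" "b1 \<bullet> b1 = 1" "b1 \<bullet> a1 = 0" "a1 \<bullet> b1 = 0"
    using a1 b1 by (auto simp: norm_eq_1 inner_commute)
  obtain c1 where c1: "c1 \<in> V" "norm c1 = 1" "a1 \<bullet> c1 = 0"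
  proof -
    \<comment> \<open>Here dimension at least 2 enters: it provides a second direction in V,
      orthogonal to a, for rotating before the reflection.\<close>
    have "\<not> V \<subseteq> span {a1}"
      using dim_subset[of V "span {a1}"] V(2) dim_le_card'[of "{a1}"] by (auto simp: dim_span)
    then obtain v where v: "v \<in> V" "v \<notin> span {a1}" by blast
    define d where "d = v - (a1 \<bullet> v) *\<^sub>R a1"
    have "d \<noteq> 0"
    proof
      assume "d = 0"
      then have "v = (a1 \<bullet> v) *\<^sub>R a1" by (simp add: d_def)
      moreover have "(a1 \<bullet> v) *\<^sub>R a1 \<in> span {a1}" by (intro span_scale span_base) simp
      ultimately show False using v(2) by metis
    qed
    moreover have "d \<in> V" using v a1 subV by (auto simp: d_def subspace_diff subspace_scale)
    moreover have "a1 \<bullet> d = 0" by (simp add: d_def inner_diff_right sq)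
    ultimately show ?thesis
      by (intro that[of "(1 / norm d) *\<^sub>R d"]) (auto simp: subV subspace_scale)
  qed
  have sqc: "c1 \<bullet> c1 = 1" "c1 \<bullet> a1 = 0" "b1 \<bullet> c1 = 0" "c1 \<bullet> b1 = 0"
    using c1(2) c1(3) b1(3)[OF c1(1)] inner_commute[of a1 c1] inner_commute[of b1 c1] by (simp_all add: norm_eq_1)
  \<comment> \<open>Reflecting \<rho> (cos \<psi> a1 + sin \<psi> c1) in \<alpha> produces the
    component -\<rho> \<kappa> cos \<psi> along b1. Every height \<rho> sin t with \<bar>sin t\<bar>
    \<le> \<kappa> is therefore reached by choosing \<psi>.\<close>
  define \<kappa> where "\<kappa> = 2 * norm a * norm b / (\<alpha> \<bullet> \<alpha>)"
  have "\<alpha> \<noteq> 0" using \<alpha>(1) by (simp add: mirror_def)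
  then have "\<kappa> > 0" using \<open>a \<noteq> 0\<close> \<open>b \<noteq> 0\<close> by (simp add: \<kappa>_def)
  have arc: "\<sigma> (\<rho> *\<^sub>R (cos \<theta> *\<^sub>R a1 + sin \<theta> *\<^sub>R b1) + \<zeta>) = \<sigma> (\<rho> *\<^sub>R a1 + \<zeta>)"
    if \<zeta>: "\<And>w. w \<in> V \<Longrightarrow> \<zeta> \<bullet> w = 0" "\<zeta> \<bullet> b1 = 0" for \<rho> \<theta> :: real and \<zeta>
  proof -
    have \<zeta>': "\<zeta> \<bullet> a1 = 0" "\<zeta> \<bullet> c1 = 0" "a1 \<bullet> \<zeta> = 0" "c1 \<bullet> \<zeta> = 0" "b1 \<bullet> \<zeta> = 0" 
      using \<zeta>(1)[OF a1(1)] \<zeta>(1)[OF c1(1)] \<zeta>(2) inner_commute[of \<zeta>] by simp_all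
    \<comment> \<open>Since \<sigma> is a polynomial, its values along the circle extend to an
      entire function of the angle.\<close>
    define \<Phi> where "\<Phi> z = (\<Sum>p\<in>A. c p * (\<Prod>i\<in>UNIV. (of_real \<rho> * (cos z * of_real (a1 $ i) + sin z * of_real (b1 $ i)) + of_real (\<zeta> $ i)) ^ p i))" for z
    have \<Phi>: "\<Phi> (of_real t) = \<sigma> (\<rho> *\<^sub>R (cos t *\<^sub>R a1 + sin t *\<^sub>R b1) + \<zeta>)" for t
      unfolding \<Phi>_def \<sigma> mpower_def by (simp add: cos_of_real sin_of_real)
    have cs: "\<rho> * (cos s * (\<rho> * cos s)) + \<rho> * (sin s * (\<rho> * sin s)) = \<rho> * \<rho>" for s
    proof -
      have "\<rho> * (cos s * (\<rho> * cos s)) + \<rho> * (sin s * (\<rho> * sin s)) = \<rho> * \<rho> * (cos s * cos s + sin s * sin s)"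
        by (simp only: distrib_left mult_ac)
      then show ?thesis by (simp only: sin_cos_squared_add3 mult_1_right)
    qed
    have near: "\<Phi> (of_real t) = \<Phi> 0" if t: "\<bar>t\<bar> < \<kappa>" for t
    proof -
      have "\<bar>sin t\<bar> \<le> \<kappa>" using abs_sin_x_le_abs_x[of t] t by linarith
      then have "- 1 * \<kappa> \<le> - sin t" "- sin t \<le> 1 * \<kappa>" by linarith+
      then have cb: "- 1 \<le> - sin t / \<kappa>" "- sin t / \<kappa> \<le> 1"
        unfolding pos_le_divide_eq[OF \<open>\<kappa> > 0\<close>] pos_divide_le_eq[OF \<open>\<kappa> > 0\<close>] .
      define \<psi> where "\<psi> = arccos (- sin t / \<kappa>)"
      have \<psi>: "cos \<psi> = - sin t / \<kappa>" unfolding \<psi>_def by (rule cos_arccos[OF cb])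
      define x where "x = \<rho> *\<^sub>R (cos \<psi> *\<^sub>R a1 + sin \<psi> *\<^sub>R c1) + \<zeta>"
      have x0: "\<sigma> x = \<sigma> (\<rho> *\<^sub>R a1 + \<zeta>)"
      proof (rule sph)
        have "x - (\<rho> *\<^sub>R a1 + \<zeta>) = \<rho> *\<^sub>R (cos \<psi> *\<^sub>R a1 + sin \<psi> *\<^sub>R c1) - \<rho> *\<^sub>R a1" by (simp add: x_def)
        also have "\<dots> \<in> V" using a1 c1 by (intro subspace_diff subspace_scale subspace_add subV)
        finally show "x - (\<rho> *\<^sub>R a1 + \<zeta>) \<in> V" .
        have "x \<bullet> x = \<rho> * \<rho> + \<zeta> \<bullet> \<zeta>"
          unfolding x_def by (simp add: inner_add_left inner_add_right sq sqc \<zeta>' c1(3) distrib_left cs)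
        also have "\<dots> = (\<rho> *\<^sub>R a1 + \<zeta>) \<bullet> (\<rho> *\<^sub>R a1 + \<zeta>)"
          by (simp add: inner_add_left inner_add_right sq \<zeta>')
        finally show "norm x = norm (\<rho> *\<^sub>R a1 + \<zeta>)" by (simp add: norm_eq)
      qed
      define \<mu> where "\<mu> = 2 * (\<alpha> \<bullet> x) / (\<alpha> \<bullet> \<alpha>)"
      have "\<alpha> \<bullet> x = norm a * (a1 \<bullet> x) + norm b * (b1 \<bullet> x)"
        unfolding ab inner_add_left by (metis a1(3) b1(2) inner_scaleR_left)
      also have "a1 \<bullet> x = \<rho> * cos \<psi>" unfolding x_def by (simp add: inner_add_right sq c1(3) \<zeta>')
      also have "b1 \<bullet> x = 0" unfolding x_def by (simp add: inner_add_right sq sqc \<zeta>')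
      finally have "\<alpha> \<bullet> x = norm a * (\<rho> * cos \<psi>)" by simp
      then have "\<mu> * norm b = \<rho> * (\<kappa> * cos \<psi>)" unfolding \<mu>_def \<kappa>_def by simp
      also have "\<kappa> * cos \<psi> = - sin t" unfolding \<psi> using \<open>\<kappa> > 0\<close> by simp
      finally have mu: "\<mu> * norm b = - \<rho> * sin t" by simp
      have rx: "reflection \<alpha> x = x - \<mu> *\<^sub>R \<alpha>" by (simp add: reflection_def \<mu>_def)
      have "\<sigma> x = \<sigma> (reflection \<alpha> x)" using \<alpha>(1) by (simp add: mirror_def)
      also have "\<dots> = \<sigma> (\<rho> *\<^sub>R (cos t *\<^sub>R a1 + sin t *\<^sub>R b1) + \<zeta>)"
      proof (rule sph)
        have "reflection \<alpha> x = x - \<mu> *\<^sub>R a - (\<mu> * norm b) *\<^sub>R b1"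
        proof -
          have "\<mu> *\<^sub>R \<alpha> = \<mu> *\<^sub>R a + \<mu> *\<^sub>R b" unfolding ab by (rule scaleR_add_right)
          also have "\<mu> *\<^sub>R b = (\<mu> * norm b) *\<^sub>R b1" using b1(2) by (metis scaleR_scaleR)
          finally show ?thesis unfolding rx by (simp only: diff_diff_eq)
        qed
        then have "reflection \<alpha> x - (\<rho> *\<^sub>R (cos t *\<^sub>R a1 + sin t *\<^sub>R b1) + \<zeta>)
           = \<rho> *\<^sub>R (cos \<psi> *\<^sub>R a1 + sin \<psi> *\<^sub>R c1) - \<mu> *\<^sub>R a - (\<rho> * cos t) *\<^sub>R a1"
          unfolding mu by (simp add: x_def algebra_simps)
        also have "\<dots> \<in> V" using a a1 c1 by (intro subspace_diff subspace_scale subspace_add subV)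
        finally show "reflection \<alpha> x - (\<rho> *\<^sub>R (cos t *\<^sub>R a1 + sin t *\<^sub>R b1) + \<zeta>) \<in> V" .
        have "reflection \<alpha> x \<bullet> reflection \<alpha> x = x \<bullet> x" by (rule inner_reflection[OF \<open>\<alpha> \<noteq> 0\<close>])
        also have "x \<bullet> x = \<rho> * \<rho> + \<zeta> \<bullet> \<zeta>"
          unfolding x_def by (simp add: inner_add_left inner_add_right sq sqc \<zeta>' c1(3) distrib_left cs)
        also have "\<dots> = (\<rho> *\<^sub>R (cos t *\<^sub>R a1 + sin t *\<^sub>R b1) + \<zeta>) \<bullet> (\<rho> *\<^sub>R (cos t *\<^sub>R a1 + sin t *\<^sub>R b1) + \<zeta>)"
          using \<zeta>(2) by (simp add: inner_add_left inner_add_right sq \<zeta>' distrib_left cs)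
        finally show "norm (reflection \<alpha> x) = norm (\<rho> *\<^sub>R (cos t *\<^sub>R a1 + sin t *\<^sub>R b1) + \<zeta>)" by (simp add: norm_eq)
      qed
      also have "\<dots> = \<Phi> (of_real t)" by (simp add: \<Phi>)
      finally show ?thesis using x0 \<Phi>[of 0] by simp
    qed
    \<comment> \<open>By \<open>near\<close> the entire function is constant on a real interval
      around 0, and the identity theorem removes the restriction to small angles.\<close>
    have "\<Phi> (of_real \<theta>) - \<Phi> 0 = 0"
    proof (rule analytic_continuation[of "\<lambda>z. \<Phi> z - \<Phi> 0" UNIV "of_real ` {- \<kappa><..<\<kappa>}" 0])
      show "(\<lambda>z. \<Phi> z - \<Phi> 0) holomorphic_on UNIV" unfolding \<Phi>_def by (intro holomorphic_intros)
      show "0 islimpt (of_real ` {- \<kappa><..<\<kappa>} :: complex set)"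
        unfolding islimpt_approachable
      proof (intro allI impI)
        fix e :: real assume "e > 0"
        define s where "s = min e \<kappa> / 2"
        have s: "0 < s" "s < e" "s < \<kappa>" using \<open>e > 0\<close> \<open>\<kappa> > 0\<close> by (auto simp: s_def min_def)
        then show "\<exists>x'\<in>of_real ` {- \<kappa><..<\<kappa>}. x' \<noteq> (0 :: complex) \<and> dist x' 0 < e"
          by (intro bexI[of _ "of_real s"] conjI imageI) auto
      qed
    qed (use near in auto)
    then show ?thesis using \<Phi>[of \<theta>] \<Phi>[of 0] by simp
  qed
  define V' where "V' = span (insert \<alpha> V)"
  have V'_eq: "\<exists>v\<in>V. \<exists>k. x = v + k *\<^sub>R b1" if x: "x \<in> V'" for x
  proof -
    obtain k where "x - k *\<^sub>R \<alpha> \<in> V" using x unfolding V'_def span_breakdown_eq spV by blast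
    then have "x - k *\<^sub>R \<alpha> + k *\<^sub>R a \<in> V" using a subV by (simp add: subspace_add subspace_scale)
    moreover have "x = (x - k *\<^sub>R \<alpha> + k *\<^sub>R a) + (k * norm b) *\<^sub>R b1"
    proof -
      have "k *\<^sub>R \<alpha> = k *\<^sub>R a + k *\<^sub>R b" unfolding ab by (rule scaleR_add_right)
      also have "k *\<^sub>R b = (k * norm b) *\<^sub>R b1" using b1(2) by (metis scaleR_scaleR)
      finally show ?thesis by simp
    qed
    ultimately show ?thesis by blast
  qed
  \<comment> \<open>A normal form: the component in V is first turned into the direction a1, then
    the arc in the plane of a1 and b1 is followed. The value of \<sigma> then depends only on
    \<zeta> and on the norm of the component in the enlarged space.\<close>
  have normal: "\<sigma> (v + k *\<^sub>R b1 + \<zeta>) = \<sigma> (sqrt (v \<bullet> v + k * k) *\<^sub>R a1 + \<zeta>)"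
    if v: "v \<in> V" and \<zeta>: "\<And>w. w \<in> V \<Longrightarrow> \<zeta> \<bullet> w = 0" "\<zeta> \<bullet> b1 = 0" for v k \<zeta>
  proof -
    define \<rho> where "\<rho> = sqrt (v \<bullet> v + k * k)"
    have "\<sigma> (v + k *\<^sub>R b1 + \<zeta>) = \<sigma> (norm v *\<^sub>R a1 + k *\<^sub>R b1 + \<zeta>)"
    proof (rule sph)
      show "v + k *\<^sub>R b1 + \<zeta> - (norm v *\<^sub>R a1 + k *\<^sub>R b1 + \<zeta>) \<in> V"
        using v a1 subV by (simp add: subspace_diff subspace_scale)
      have z: "\<zeta> \<bullet> v = 0" "v \<bullet> \<zeta> = 0" "\<zeta> \<bullet> a1 = 0" "a1 \<bullet> \<zeta> = 0" "b1 \<bullet> \<zeta> = 0" "b1 \<bullet> v = 0" "v \<bullet> b1 = 0"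
        using \<zeta>(1)[OF v] \<zeta>(1)[OF a1(1)] \<zeta>(2) b1(3)[OF v] inner_commute[of \<zeta> v] inner_commute[of \<zeta> a1]
          inner_commute[of \<zeta> b1] inner_commute[of b1 v] by simp_all
      have "(v + k *\<^sub>R b1 + \<zeta>) \<bullet> (v + k *\<^sub>R b1 + \<zeta>) = v \<bullet> v + k * k + \<zeta> \<bullet> \<zeta>"
        using \<zeta>(2) by (simp add: inner_add_left inner_add_right sq z)
      also have "\<dots> = (norm v *\<^sub>R a1 + k *\<^sub>R b1 + \<zeta>) \<bullet> (norm v *\<^sub>R a1 + k *\<^sub>R b1 + \<zeta>)"
      proof -
        have vv: "v \<bullet> v = norm v * norm v" by (simp add: dot_square_norm power2_eq_square)
        show ?thesis using \<zeta>(2) unfolding vv by (simp add: inner_add_left inner_add_right sq z)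
      qed
      finally show "norm (v + k *\<^sub>R b1 + \<zeta>) = norm (norm v *\<^sub>R a1 + k *\<^sub>R b1 + \<zeta>)" by (simp add: norm_eq)
    qed
    also have "\<dots> = \<sigma> (\<rho> *\<^sub>R a1 + \<zeta>)"
    proof (cases "\<rho> = 0")
      case True
      then have "v \<bullet> v + k * k = 0" by (simp add: \<rho>_def)
      then have "v \<bullet> v = 0" "k * k = 0" using inner_ge_zero[of v] zero_le_square[of k] by linarith+
      then show ?thesis using True by simp
    next
      case False
      have r2: "\<rho>\<^sup>2 = (norm v)\<^sup>2 + k\<^sup>2" by (simp add: \<rho>_def dot_square_norm power2_eq_square)
      have "(norm v / \<rho>)\<^sup>2 + (k / \<rho>)\<^sup>2 = 1"
      proof -
        have "(norm v / \<rho>)\<^sup>2 + (k / \<rho>)\<^sup>2 = ((norm v)\<^sup>2 + k\<^sup>2) / \<rho>\<^sup>2" by (simp add: power_divide add_divide_distrib)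
        also have "\<dots> = \<rho>\<^sup>2 / \<rho>\<^sup>2" unfolding r2 ..
        also have "\<dots> = 1" using False by simp
        finally show ?thesis .
      qed
      then obtain t where t: "0 \<le> t" "t < 2 * pi" "norm v / \<rho> = cos t" "k / \<rho> = sin t" by (rule sincos_total_2pi)
      have "norm v = \<rho> * cos t" "k = \<rho> * sin t" using False by (simp_all flip: t(3,4))
      then have "norm v *\<^sub>R a1 + k *\<^sub>R b1 + \<zeta> = \<rho> *\<^sub>R (cos t *\<^sub>R a1 + sin t *\<^sub>R b1) + \<zeta>"
        by (simp add: algebra_simps)
      then show ?thesis using arc[OF \<zeta>] by simp
    qed
    finally show ?thesis by (simp add: \<rho>_def)
  qed
  show ?thesis unfolding V'_def[symmetric] spherical_on_def
  proof (intro conjI allI impI)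
    show "subspace V'" by (simp add: V'_def)
    fix x y assume xy: "x - y \<in> V'" "norm x = norm y"
    obtain x1 \<zeta> where "x1 \<in> span V'" and z: "\<And>w. w \<in> span V' \<Longrightarrow> orthogonal \<zeta> w" and x: "x = x1 + \<zeta>"
      using orthogonal_subspace_decomp_exists[of V' x] by metis
    have spV': "span V' = V'" unfolding V'_def by simp
    have x1: "x1 \<in> V'" using \<open>x1 \<in> span V'\<close> spV' by simp
    have "b1 \<in> V'"
    proof -
      have "\<alpha> - a \<in> V'" unfolding V'_def using a by (intro span_diff span_base) auto
      then show ?thesis unfolding b1_def ab by (simp add: V'_def span_scale)
    qed
    moreover have "V \<subseteq> V'" unfolding V'_def by (auto intro: span_base)
    ultimately have \<zeta>: "\<And>w. w \<in> V \<Longrightarrow> \<zeta> \<bullet> w = 0" "\<zeta> \<bullet> b1 = 0" using z spV' by (auto simp: orthogonal_def)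
    define y1 where "y1 = x1 - (x - y)"
    have y: "y = y1 + \<zeta>" by (simp add: y1_def x)
    have y1: "y1 \<in> V'" unfolding y1_def using x1 xy(1) by (simp add: V'_def span_diff)
    obtain v k where v: "v \<in> V" "x1 = v + k *\<^sub>R b1" using V'_eq[OF x1] by blast
    obtain v' k' where v': "v' \<in> V" "y1 = v' + k' *\<^sub>R b1" using V'_eq[OF y1] by blast
    have n: "(v + k *\<^sub>R b1 + \<zeta>) \<bullet> (v + k *\<^sub>R b1 + \<zeta>) = v \<bullet> v + k * k + \<zeta> \<bullet> \<zeta>" if "v \<in> V" for v k
      using \<zeta>(1)[OF that] \<zeta>(2) b1(3)[OF that] inner_commute[of \<zeta> v] inner_commute[of \<zeta> b1] inner_commute[of b1 v]
      by (simp add: inner_add_left inner_add_right sq)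
    have "v \<bullet> v + k * k = v' \<bullet> v' + k' * k'"
      using n[OF v(1), of k] n[OF v'(1), of k'] xy(2) unfolding norm_eq x y v(2) v'(2) by simp
    then show "\<sigma> x = \<sigma> y" unfolding x y v(2) v'(2) using normal[OF v(1) \<zeta>] normal[OF v'(1) \<zeta>] by simp
  qed
qed

lemma continuous_on_mpower: "continuous_on S (\<lambda>\<xi>. mpower \<xi> p)"
  unfolding mpower_def by (intro continuous_intros)

text \<open>Take V of maximal dimension. If it were proper and no vector of H were transversal to
  it, then H would split into the vectors inside V and those orthogonal to V. Both classes are
  nonempty, as H spans and V is not 0, against irreducibility. A transversal vector in turn allows
  an extension of V, against maximality.\<close>

lemma spherical_UNIV:
  fixes \<sigma> :: "real ^ 'n \<Rightarrow> complex"
  assumes \<sigma>: "\<And>\<xi>. \<sigma> \<xi> = (\<Sum>p\<in>A. c p * complex_of_real (mpower \<xi> p))"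
    and irr: "irreducible_set H" and mir: "\<And>\<alpha>. \<alpha> \<in> H \<Longrightarrow> mirror \<sigma> \<alpha>"
    and inf: "infinite {u. norm u = 1 \<and> mirror \<sigma> u}"
  shows "spherical_on \<sigma> UNIV"
proof -
  have "continuous_on UNIV \<sigma>" unfolding \<sigma>[abs_def] by (intro continuous_intros continuous_on_mpower)
  then obtain V0 where V0: "spherical_on \<sigma> V0" "dim V0 = 2" using spherical_plane_exists inf by blast
  define P where "P d \<longleftrightarrow> (\<exists>V. spherical_on \<sigma> V \<and> dim V = d \<and> d \<ge> 2)" for d
  have "P 2" using V0 unfolding P_def by blast
  have bound: "\<And>d. P d \<Longrightarrow> d \<le> DIM(real ^ 'n)" unfolding P_def using dim_subset_UNIV by blast
  define G where "G = Greatest P"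
  have "P G" unfolding G_def using \<open>P 2\<close> bound by (rule GreatestI_nat)
  then obtain V where V: "spherical_on \<sigma> V" "dim V = G" "dim V \<ge> 2" unfolding P_def by blast
  have subV: "subspace V" using V(1) by (simp add: spherical_on_def)
  show ?thesis
  proof (cases "V = UNIV")
    case False
    have "\<exists>\<alpha>\<in>H. \<alpha> \<notin> V \<and> (\<exists>v\<in>V. \<alpha> \<bullet> v \<noteq> 0)"
    proof (rule ccontr)
      assume no: "\<not> (\<exists>\<alpha>\<in>H. \<alpha> \<notin> V \<and> (\<exists>v\<in>V. \<alpha> \<bullet> v \<noteq> 0))"
      define H1 where "H1 = H \<inter> V"
      define H2 where "H2 = H - V"
      have no': "\<beta> \<bullet> v = 0" if \<beta>: "\<beta> \<in> H" "\<beta> \<notin> V" and v: "v \<in> V" for \<beta> v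
      proof (rule ccontr)
        assume "\<beta> \<bullet> v \<noteq> 0"
        then have "\<exists>v\<in>V. \<beta> \<bullet> v \<noteq> 0" using v by (rule bexI)
        with \<beta>(2) have "\<beta> \<notin> V \<and> (\<exists>v\<in>V. \<beta> \<bullet> v \<noteq> 0)" by (rule conjI)
        then have "\<exists>\<alpha>\<in>H. \<alpha> \<notin> V \<and> (\<exists>v\<in>V. \<alpha> \<bullet> v \<noteq> 0)" using \<beta>(1) by (rule bexI)
        with no show False by (rule notE)
      qed
      have orth: "\<alpha> \<bullet> \<beta> = 0" if "\<alpha> \<in> H1" "\<beta> \<in> H2" for \<alpha> \<beta>
        using no'[of \<beta> \<alpha>] that inner_commute[of \<alpha> \<beta>] by (simp add: H1_def H2_def)
      have spanH: "span H = UNIV" using irr unfolding irreducible_set_def by blast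
      have "H2 \<noteq> {}"
      proof
        assume "H2 = {}"
        then have "H \<subseteq> V" by (auto simp: H2_def)
        then have "span H \<subseteq> V" using subV by (simp add: span_minimal)
        then show False using spanH False by auto
      qed
      moreover have "H1 \<noteq> {}"
      proof
        assume "H1 = {}"
        have perp: "orthogonal v \<alpha>" if "\<alpha> \<in> H" "v \<in> V" for \<alpha> v
        proof -
          have "\<alpha> \<notin> V" using \<open>H1 = {}\<close> that(1) by (auto simp: H1_def)
          then have "\<alpha> \<bullet> v = 0" by (rule no'[OF that(1) _ that(2)])
          then show ?thesis by (simp add: orthogonal_def inner_commute)
        qed
        have "v = 0" if "v \<in> V" for v
        proof -
          have "v \<in> span H" unfolding spanH by simp
          then have "orthogonal v v" by (rule orthogonal_to_span) (rule perp[OF _ that])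
          then show ?thesis by (simp add: orthogonal_self)
        qed
        then have "V \<subseteq> {0}" by blast
        then have le: "dim V \<le> dim {0 :: real ^ 'n}" by (rule dim_subset)
        have "dim {0 :: real ^ 'n} = 0" by simp
        with le V(3) show False by linarith
      qed
      ultimately have "H1 \<subset> H" "H2 \<subset> H" "H1 \<union> H2 = H" "H1 \<inter> H2 = {}" by (auto simp: H1_def H2_def)
      then have "\<exists>A1 A2. A1 \<subset> H \<and> A2 \<subset> H \<and> A1 \<union> A2 = H \<and> A1 \<inter> A2 = {} \<and> (\<forall>\<alpha>\<in>A1. \<forall>\<beta>\<in>A2. \<alpha> \<bullet> \<beta> = 0)"
        using orth by (intro exI[of _ H1] exI[of _ H2]) simp
      then show False using irr unfolding irreducible_set_def by simp
    qed
    then obtain \<alpha> v where \<alpha>: "\<alpha> \<in> H" "\<alpha> \<notin> V" "v \<in> V" "\<alpha> \<bullet> v \<noteq> 0" by blast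
    have "spherical_on \<sigma> (span (insert \<alpha> V))"
      by (rule spherical_on_extend[OF \<sigma> V(1,3) mir[OF \<alpha>(1)] \<alpha>(2-4)])
    moreover have "dim (span (insert \<alpha> V)) = Suc (dim V)"
      using \<alpha>(2) subV by (simp add: dim_insert span_eq_iff[THEN iffD2])
    ultimately have "P (Suc (dim V))" using V(3) unfolding P_def by force
    then have "Suc (dim V) \<le> G" unfolding G_def using bound by (rule Greatest_le_nat)
    then show ?thesis using V(2) by simp
  qed (use V in simp)
qed

text \<open>The value at \<xi> is the value at one fixed unit vector, here an arbitrary coordinate
  vector, times the m-th power of the norm. For even m this is a power of the squared norm; for odd
  m, comparing e with -e gives 0.\<close>

lemma spherical_homogeneous_poly:
  fixes \<sigma> :: "real ^ 'n \<Rightarrow> complex"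
  assumes sph: "spherical_on \<sigma> UNIV"
    and hom: "\<And>t \<xi>. \<sigma> (t *\<^sub>R \<xi>) = of_real t ^ m * \<sigma> \<xi>"
  shows "\<exists>q :: complex poly. \<forall>\<xi>. \<sigma> \<xi> = poly q (complex_of_real (\<Sum>i\<in>UNIV. (\<xi> $ i)\<^sup>2))"
proof -
  define e :: "real ^ 'n" where "e = axis undefined 1"
  have ne: "norm e = 1" by (simp add: e_def)
  have eq: "\<sigma> x = \<sigma> y" if "norm x = norm y" for x y using sph that unfolding spherical_on_def by blast
  have val: "\<sigma> \<xi> = of_real (norm \<xi>) ^ m * \<sigma> e" for \<xi>
  proof -
    have "\<sigma> \<xi> = \<sigma> (norm \<xi> *\<^sub>R e)" by (rule eq) (simp add: ne)
    also have "\<dots> = of_real (norm \<xi>) ^ m * \<sigma> e" by (rule hom)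
    finally show ?thesis .
  qed
  have sq: "(\<Sum>i\<in>UNIV. (\<xi> $ i)\<^sup>2) = (norm \<xi>)\<^sup>2" for \<xi> :: "real ^ 'n"
    by (simp add: norm_vec_def L2_set_def sum_nonneg)
  show ?thesis
  proof (cases "even m")
    case True
    then obtain k where k: "m = 2 * k" by blast
    show ?thesis
    proof (rule exI[of _ "monom (\<sigma> e) k"], rule allI)
      fix \<xi> :: "real ^ 'n"
      have "complex_of_real (norm \<xi>) ^ m = complex_of_real ((norm \<xi>)\<^sup>2) ^ k" by (simp add: k power_mult)
      then show "\<sigma> \<xi> = poly (monom (\<sigma> e) k) (complex_of_real (\<Sum>i\<in>UNIV. (\<xi> $ i)\<^sup>2))"
        unfolding sq poly_monom val[of \<xi>] by (simp only: mult.commute)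
    qed
  next
    case False
    have "\<sigma> e = \<sigma> ((-1) *\<^sub>R e)" by (rule eq) simp
    also have "\<dots> = - \<sigma> e" using hom[of "-1" e] False by simp
    finally have "\<sigma> e = 0" by simp
    have "\<sigma> \<xi> = 0" for \<xi> unfolding val[of \<xi>] \<open>\<sigma> e = 0\<close> by simp
    then show ?thesis by (intro exI[of _ 0]) simp
  qed
qed

section \<open>Finiteness of the reflection group from a finite invariant set\<close>

lemma reflection_in_BijGroup: "\<alpha> \<noteq> 0 \<Longrightarrow> reflection \<alpha> \<in> carrier (BijGroup UNIV)"
  by (auto simp: BijGroup_def Bij_def intro!: o_bij[of "reflection \<alpha>"] simp: fun_eq_iff reflection_reflection)

lemma BijGroup_UNIV_mult:
  assumes "f \<in> carrier (BijGroup UNIV)" "g \<in> carrier (BijGroup UNIV)"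
  shows "f \<otimes>\<^bsub>BijGroup UNIV\<^esub> g = f \<circ> g"
proof -
  have "f \<in> Bij UNIV" "g \<in> Bij UNIV" using assms by (simp_all add: BijGroup_def)
  then show ?thesis by (simp add: BijGroup_def compose_def restrict_def fun_eq_iff)
qed

lemma BijGroup_UNIV_one: "\<one>\<^bsub>BijGroup UNIV\<^esub> = id"
  by (simp add: BijGroup_def restrict_def fun_eq_iff)

lemma BijGroup_inv_reflection:
  assumes "\<alpha> \<noteq> 0"
  shows "inv\<^bsub>BijGroup UNIV\<^esub> (reflection \<alpha>) = reflection \<alpha>"
proof (rule group.inv_equality[OF group_BijGroup])
  show c: "reflection \<alpha> \<in> carrier (BijGroup UNIV)" "reflection \<alpha> \<in> carrier (BijGroup UNIV)"
    using reflection_in_BijGroup[OF assms] by blast+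
  show "reflection \<alpha> \<otimes>\<^bsub>BijGroup UNIV\<^esub> reflection \<alpha> = \<one>\<^bsub>BijGroup UNIV\<^esub>"
    unfolding BijGroup_UNIV_mult[OF c] BijGroup_UNIV_one by (rule ext) (simp add: reflection_reflection[OF assms])
qed

lemma reflection_group_linear_preserving:
  fixes H M :: "(real ^ 'n) set"
  assumes H: "0 \<notin> H" and pres: "\<And>\<alpha> u. \<alpha> \<in> H \<Longrightarrow> u \<in> M \<Longrightarrow> reflection \<alpha> u \<in> M"
    and g: "g \<in> reflection_group H"
  shows "linear g \<and> (\<forall>u\<in>M. g u \<in> M)"
proof -
  have nz: "\<alpha> \<noteq> 0" if "\<alpha> \<in> H" for \<alpha> using H that by metis
  have carr: "reflection ` H \<subseteq> carrier (BijGroup UNIV)" using reflection_in_BijGroup[OF nz] by blast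
  show ?thesis using g unfolding reflection_group_def
  proof (induction rule: generate.induct)
    case one
    show ?case unfolding BijGroup_UNIV_one by (simp add: linear_iff)
  next
    case (incl h)
    then obtain \<alpha> where \<alpha>: "\<alpha> \<in> H" "h = reflection \<alpha>" by blast
    show ?case unfolding \<alpha>(2) using pres[OF \<alpha>(1)] linear_reflection by blast
  next
    case (inv h)
    then obtain \<alpha> where \<alpha>: "\<alpha> \<in> H" "h = reflection \<alpha>" by blast
    show ?case unfolding \<alpha>(2) BijGroup_inv_reflection[OF nz[OF \<alpha>(1)]]
      using pres[OF \<alpha>(1)] linear_reflection by blast
  next
    case (eng h1 h2)
    note c = group.generate_in_carrier[OF group_BijGroup carr]
    show ?case unfolding BijGroup_UNIV_mult[OF c[OF eng.hyps(1)] c[OF eng.hyps(2)]]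
      using eng.IH by (intro conjI ballI linear_compose) simp_all
  qed
qed

text \<open>The elements are linear and map M into itself. As M spans, each is determined by its
  restriction to M, and there are only finitely many maps from M to M.\<close>

lemma finite_reflection_group_of_finite:
  fixes H M :: "(real ^ 'n) set"
  assumes H: "0 \<notin> H" and "span M = UNIV" "finite M"
    and pres: "\<And>\<alpha> u. \<alpha> \<in> H \<Longrightarrow> u \<in> M \<Longrightarrow> reflection \<alpha> u \<in> M"
  shows "finite_reflection_group (reflection_group H)"
proof -
  have props: "linear g" "\<forall>u\<in>M. g u \<in> M" if "g \<in> reflection_group H" for g
    using reflection_group_linear_preserving[OF H pres that] by auto
  have inj: "inj_on (\<lambda>g. restrict g M) (reflection_group H)"
  proof (rule inj_onI)
    fix g h assume gh: "g \<in> reflection_group H" "h \<in> reflection_group H" "restrict g M = restrict h M"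
    have eq: "g x = h x" if "x \<in> M" for x using fun_cong[OF gh(3), of x] that by simp
    show "g = h"
    proof
      fix x
      have "x \<in> span M" unfolding \<open>span M = UNIV\<close> by (rule UNIV_I)
      then show "g x = h x"
        by (rule linear_eq_on_span[OF props(1)[OF gh(1)] props(1)[OF gh(2)] eq, rotated])
    qed
  qed
  have "(\<lambda>g. restrict g M) ` reflection_group H \<subseteq> PiE M (\<lambda>_. M)"
  proof (rule image_subsetI)
    fix g assume "g \<in> reflection_group H"
    then show "restrict g M \<in> PiE M (\<lambda>_. M)" using props(2) by (intro restrict_PiE_iff[THEN iffD2]) blast
  qed
  moreover have "finite (PiE M (\<lambda>_. M))" using \<open>finite M\<close> by (simp add: finite_PiE)
  ultimately have "finite ((\<lambda>g. restrict g M) ` reflection_group H)" by (rule finite_subset)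
  then have "finite (reflection_group H)" using inj by (rule finite_imageD)
  then show ?thesis unfolding finite_reflection_group_def using H by (intro conjI exI[of _ H]) auto
qed

text \<open>The unit mirrors of \<sigma> contain the normalised vectors of H, hence span, and are
  permuted by the reflections of H. If there were finitely many, the group would be finite; so there
  are infinitely many, as \<open>spherical_UNIV\<close> requires.\<close>

theorem reflection_invariant_radial:
  fixes \<sigma> :: "real ^ 'n \<Rightarrow> complex"
  assumes \<sigma>: "\<And>\<xi>. \<sigma> \<xi> = (\<Sum>p | sum p UNIV = m. c p * complex_of_real (mpower \<xi> p))"
    and "0 \<notin> H" "irreducible_set H" and inv: "\<And>\<alpha> \<xi>. \<alpha> \<in> H \<Longrightarrow> \<sigma> (reflection \<alpha> \<xi>) = \<sigma> \<xi>"
    and infW: "\<not> finite_reflection_group (reflection_group H)"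
  shows "\<exists>q :: complex poly. \<forall>\<xi>. \<sigma> \<xi> = poly q (complex_of_real (\<Sum>i\<in>UNIV. (\<xi> $ i)\<^sup>2))"
proof -
  define M where "M = {u. norm u = 1 \<and> mirror \<sigma> u}"
  have mir: "mirror \<sigma> \<alpha>" if "\<alpha> \<in> H" for \<alpha> using that inv \<open>0 \<notin> H\<close> by (auto simp: mirror_def)
  have "infinite M"
  proof
    assume "finite M"
    moreover have "span M = UNIV"
    proof -
      have "\<alpha> \<in> span M" if "\<alpha> \<in> H" for \<alpha>
      proof -
        have "\<alpha> \<noteq> 0" using that \<open>0 \<notin> H\<close> by auto
        then have "(1 / norm \<alpha>) *\<^sub>R \<alpha> \<in> M" using mirror_scaleR[OF mir[OF that], of "1 / norm \<alpha>"] by (simp add: M_def)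
        then have "norm \<alpha> *\<^sub>R ((1 / norm \<alpha>) *\<^sub>R \<alpha>) \<in> span M" by (intro span_scale span_base)
        then show ?thesis using \<open>\<alpha> \<noteq> 0\<close> by simp
      qed
      then have "span H \<subseteq> span M" by (simp add: span_minimal subsetI)
      then show ?thesis using \<open>irreducible_set H\<close> unfolding irreducible_set_def by auto
    qed
    moreover have "reflection \<alpha> u \<in> M" if "\<alpha> \<in> H" "u \<in> M" for \<alpha> u
    proof -
      have "\<alpha> \<noteq> 0" using that \<open>0 \<notin> H\<close> by auto
      then show ?thesis using that mirror_reflection[OF mir[OF that(1)]] by (simp add: M_def norm_reflection)
    qed
    ultimately show False using infW finite_reflection_group_of_finite[OF \<open>0 \<notin> H\<close>] by blast
  qed
  then have "spherical_on \<sigma> UNIV"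
    using spherical_UNIV[OF \<sigma> \<open>irreducible_set H\<close> mir] unfolding M_def by blast
  moreover have "\<sigma> (t *\<^sub>R \<xi>) = of_real t ^ m * \<sigma> \<xi>" for t \<xi>
    unfolding \<sigma> sum_distrib_left by (intro sum.cong refl) (auto simp: mpower_scaleR)
  ultimately show ?thesis by (rule spherical_homogeneous_poly)
qed

section \<open>Functions near a hyperplane\<close>

definition inner_pole :: "real ^ 'n \<Rightarrow> nat \<Rightarrow> real ^ 'n \<Rightarrow> complex" where
  "inner_pole \<beta> l x = 1 / complex_of_real (\<beta> \<bullet> x) ^ l"

lemma inner_pole_has_derivative:
  assumes "\<beta> \<bullet> x \<noteq> 0"
  shows "(inner_pole \<beta> l has_derivative (\<lambda>h. complex_of_real (\<beta> \<bullet> h) * (- of_nat l * inner_pole \<beta> (Suc l) x))) (at x)"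
proof -
  have ex: "complex_of_real (\<beta> \<bullet> x) \<noteq> 0" using assms by simp
  have "((\<lambda>z. 1 / z ^ l) has_field_derivative (- of_nat l * (1 / complex_of_real (\<beta> \<bullet> x) ^ Suc l))) (at (complex_of_real (\<beta> \<bullet> x)))"
  proof (cases l)
    case (Suc n)
    have *: "(- 1 - of_nat n) * z ^ n = - (z ^ n) - of_nat n * z ^ (n - Suc 0) * z" for z :: complex
      by (cases n) (auto simp: algebra_simps)
    show ?thesis unfolding Suc using ex
      by (auto intro!: derivative_eq_intros simp: divide_simps *)
  qed simp
  then have d: "((\<lambda>z. 1 / z ^ l) has_derivative (\<lambda>h. (- of_nat l * (1 / complex_of_real (\<beta> \<bullet> x) ^ Suc l)) * h)) (at (complex_of_real (\<beta> \<bullet> x)))"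
    unfolding has_field_derivative_def .
  have "((\<lambda>x. complex_of_real (\<beta> \<bullet> x)) has_derivative (\<lambda>h. complex_of_real (\<beta> \<bullet> h))) (at x)"
    by (intro has_derivative_of_real has_derivative_inner_right has_derivative_ident)
  from has_derivative_compose[OF this d]
  show ?thesis unfolding inner_pole_def[abs_def] by (simp only: mult.commute)
qed

lemma dd_inner_pole:
  "\<beta> \<bullet> x \<noteq> 0 \<Longrightarrow> dd v (inner_pole \<beta> l) x = complex_of_real (\<beta> \<bullet> v) * (- of_nat l * inner_pole \<beta> (Suc l) x)"
  by (rule dd_has_derivative[OF inner_pole_has_derivative])

lemma smooth_on_inner_pole:
  assumes "open S" and nz: "\<And>x. x \<in> S \<Longrightarrow> \<beta> \<bullet> x \<noteq> 0"
  shows "smooth_on S (\<lambda>x. K * inner_pole \<beta> l x)"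
  using assms(1)
proof (rule smooth_on_coinduct[of _ "\<lambda>f. \<exists>K l. f = (\<lambda>x. K * inner_pole \<beta> l x)"])
  show "\<exists>K' l'. (\<lambda>x. K * inner_pole \<beta> l x) = (\<lambda>x. K' * inner_pole \<beta> l' x)" by blast
next
  fix f assume "\<exists>K l. f = (\<lambda>x. K * inner_pole \<beta> l x)"
  then obtain K l where f: "f = (\<lambda>x. K * inner_pole \<beta> l x)" by blast
  have d: "(f has_derivative (\<lambda>h. K * (complex_of_real (\<beta> \<bullet> h) * (- of_nat l * inner_pole \<beta> (Suc l) x)))) (at x)" if "x \<in> S" for x
    unfolding f by (rule has_derivative_mult_right[OF inner_pole_has_derivative[OF nz[OF that]]])
  have "f differentiable_on S"
    unfolding differentiable_on_def using d differentiableI differentiable_at_withinI by blast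
  moreover have "partial_deriv i f x = (K * complex_of_real (\<beta> $ i) * (- of_nat l)) * inner_pole \<beta> (Suc l) x" if "x \<in> S" for x i
    using partial_deriv_has_derivative[OF d[OF that], of i] by (simp only: inner_axis inner_real_def mult_1_right mult.assoc)
  ultimately show "f differentiable_on S \<and> (\<forall>i. \<exists>g. (\<exists>K l. g = (\<lambda>x. K * inner_pole \<beta> l x)) \<and> (\<forall>x\<in>S. partial_deriv i f x = g x))"
    by blast
qed

lemma dds_inner_pole:
  assumes "open S" and nz: "\<And>x. x \<in> S \<Longrightarrow> \<beta> \<bullet> x \<noteq> 0"
  shows "\<exists>K'. \<forall>x\<in>S. dds vs (\<lambda>x. K * inner_pole \<beta> l x) x = K' * inner_pole \<beta> (l + length vs) x"
proof (induction vs)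
  case Nil
  then show ?case by auto
next
  case (Cons v vs)
  then obtain K' where K': "\<And>x. x \<in> S \<Longrightarrow> dds vs (\<lambda>x. K * inner_pole \<beta> l x) x = K' * inner_pole \<beta> (l + length vs) x" by blast
  have "dds (v # vs) (\<lambda>x. K * inner_pole \<beta> l x) x
      = (K' * (complex_of_real (\<beta> \<bullet> v) * (- of_nat (l + length vs)))) * inner_pole \<beta> (l + length (v # vs)) x" if "x \<in> S" for x
  proof -
    have "dds (v # vs) (\<lambda>x. K * inner_pole \<beta> l x) x = dd v (\<lambda>x. K' * inner_pole \<beta> (l + length vs) x) x"
      unfolding dds_simps by (rule dd_cong_open[OF assms(1) that K'])
    also have "\<dots> = K' * (complex_of_real (\<beta> \<bullet> v) * (- of_nat (l + length vs) * inner_pole \<beta> (Suc (l + length vs)) x))"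
      by (rule dd_has_derivative[OF has_derivative_mult_right[OF inner_pole_has_derivative[OF nz[OF that]]]])
    finally show ?thesis by (simp only: mult.assoc list.size add_Suc_right add_0_right)
  qed
  then show ?case by blast
qed

text \<open>A base point y on the hyperplane orthogonal to the unit vector e, with a region S on its
  positive side that contains a normal segment. Staying on one side keeps powers of 1 / \<langle>e,
  x\<rangle> smooth and ln t real.\<close>

locale near_hyperplane =
  fixes e y :: "real ^ 'n" and \<epsilon> :: real and S :: "(real ^ 'n) set"
  assumes norm_e: "norm e = 1" and eps: "\<epsilon> > 0" and S_open: "open S"
    and line_in: "\<And>t. 0 < t \<Longrightarrow> t < \<epsilon> \<Longrightarrow> y + t *\<^sub>R e \<in> S"
    and S_pos: "\<And>x. x \<in> S \<Longrightarrow> e \<bullet> x > 0"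
    and e_y: "e \<bullet> y = 0"
begin

lemma e_e: "e \<bullet> e = 1"
  using norm_e by (simp add: norm_eq_1)

lemma e_line: "e \<bullet> (y + t *\<^sub>R e) = t"
  by (simp add: inner_add_right e_y e_e)

text \<open>Expansions are controlled only along the line \<open>y + t e\<close>, together with all derivatives in directions
  parallel to the hyperplane. The derivative along \<open>e\<close> acts on the expansion itself.\<close>

definition tangential :: "(real ^ 'n) list \<Rightarrow> bool" where
  "tangential vs \<longleftrightarrow> (\<forall>v\<in>set vs. e \<bullet> v = 0)"

definition on_line :: "(real ^ 'n \<Rightarrow> complex) \<Rightarrow> real \<Rightarrow> complex" where
  "on_line f t = f (y + t *\<^sub>R e)"

text \<open>The same N and L serve all tangential derivatives: only differentiation along e costs
  pole order.\<close>

definition log_pole :: "nat \<Rightarrow> nat \<Rightarrow> (real ^ 'n \<Rightarrow> complex) \<Rightarrow> bool" where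
  "log_pole N L f \<longleftrightarrow> smooth_on S f \<and>
     (\<forall>vs. tangential vs \<longrightarrow> (\<exists>q. loglead \<epsilon> N L (on_line (dds vs f)) q))"

text \<open>Derivatives in all directions are included, since normal derivatives also create no pole
  here; the class is thereby stable under every \<open>dd v\<close>.\<close>

definition holomorphic_near :: "(real ^ 'n \<Rightarrow> complex) \<Rightarrow> bool" where
  "holomorphic_near f \<longleftrightarrow> smooth_on S f \<and>
     (\<forall>vs. \<exists>k. k holomorphic_on ball 0 \<epsilon> \<and> (\<forall>t. 0 < t \<longrightarrow> t < \<epsilon> \<longrightarrow> on_line (dds vs f) t = k (of_real t)))"

lemma log_pole_smooth: "log_pole N L f \<Longrightarrow> smooth_on S f"
  by (simp add: log_pole_def)

lemma holomorphic_near_smooth: "holomorphic_near f \<Longrightarrow> smooth_on S f"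
  by (simp add: holomorphic_near_def)

lemma log_poleD: "log_pole N L f \<Longrightarrow> tangential vs \<Longrightarrow> \<exists>q. loglead \<epsilon> N L (on_line (dds vs f)) q"
  by (simp add: log_pole_def)

lemma on_line_cong:
  assumes "loglead \<epsilon> N L (on_line f) q" "\<And>x. x \<in> S \<Longrightarrow> f x = g x"
  shows "loglead \<epsilon> N L (on_line g) q"
  by (rule loglead_cong[OF assms(1)]) (simp add: on_line_def assms(2) line_in)

lemma log_pole_cong:
  assumes "log_pole N L f" "\<And>x. x \<in> S \<Longrightarrow> f x = g x"
  shows "log_pole N L g"
  unfolding log_pole_def
proof (intro conjI allI impI)
  show "smooth_on S g" by (rule smooth_on_cong[OF S_open log_pole_smooth[OF assms(1)] assms(2)])
  fix vs assume "tangential vs"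
  then obtain q where q: "loglead \<epsilon> N L (on_line (dds vs f)) q" using log_poleD[OF assms(1)] by blast
  show "\<exists>q. loglead \<epsilon> N L (on_line (dds vs g)) q"
    by (rule exI[of _ q], rule on_line_cong[OF q]) (rule dds_cong_open[OF S_open assms(2)])
qed

lemma log_pole_mono:
  assumes "log_pole N L f" "N \<le> N'" "L \<le> L'"
  shows "log_pole N' L' f"
  unfolding log_pole_def
proof (intro conjI allI impI)
  show "smooth_on S f" by (rule log_pole_smooth[OF assms(1)])
  fix vs assume "tangential vs"
  then obtain q where "loglead \<epsilon> N L (on_line (dds vs f)) q" using log_poleD[OF assms(1)] by blast
  then have "loglead \<epsilon> N L' (on_line (dds vs f)) q" using assms(3) by (rule loglead_mono_log)
  then show "\<exists>q. loglead \<epsilon> N' L' (on_line (dds vs f)) q" using assms(2) by (rule loglead_le)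
qed

lemma log_pole_add:
  assumes "log_pole N L f" "log_pole N L g"
  shows "log_pole N L (\<lambda>x. f x + g x)"
  unfolding log_pole_def
proof (intro conjI allI impI)
  note sm = log_pole_smooth[OF assms(1)] log_pole_smooth[OF assms(2)]
  show "smooth_on S (\<lambda>x. f x + g x)" by (rule smooth_on_add[OF S_open sm])
  fix vs assume vs: "tangential vs"
  obtain q where q: "loglead \<epsilon> N L (on_line (dds vs f)) q" using log_poleD[OF assms(1) vs] by blast
  obtain r where r: "loglead \<epsilon> N L (on_line (dds vs g)) r" using log_poleD[OF assms(2) vs] by blast
  have "on_line (dds vs f) t + on_line (dds vs g) t = on_line (dds vs (\<lambda>x. f x + g x)) t"
    if "0 < t" "t < \<epsilon>" for t
    unfolding on_line_def by (rule dds_add[OF S_open sm line_in[OF that], symmetric])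
  then show "\<exists>q. loglead \<epsilon> N L (on_line (dds vs (\<lambda>x. f x + g x))) q"
    using loglead_cong[OF loglead_add[OF q r]] by blast
qed

lemma log_pole_cmult:
  assumes "log_pole N L f"
  shows "log_pole N L (\<lambda>x. c * f x)"
  unfolding log_pole_def
proof (intro conjI allI impI)
  note sm = log_pole_smooth[OF assms(1)]
  show "smooth_on S (\<lambda>x. c * f x)" by (rule smooth_on_mult[OF S_open smooth_on_const[OF S_open] sm])
  fix vs assume vs: "tangential vs"
  obtain q where q: "loglead \<epsilon> N L (on_line (dds vs f)) q" using log_poleD[OF assms(1) vs] by blast
  have "c * on_line (dds vs f) t = on_line (dds vs (\<lambda>x. c * f x)) t"
    if "0 < t" "t < \<epsilon>" for t
    unfolding on_line_def by (rule dds_cmult[OF S_open sm line_in[OF that], symmetric])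
  then show "\<exists>q. loglead \<epsilon> N L (on_line (dds vs (\<lambda>x. c * f x))) q"
    using loglead_cong[OF loglead_cmult[OF q]] by blast
qed

lemma holomorphic_near_dd:
  assumes "holomorphic_near h"
  shows "holomorphic_near (dd v h)"
  unfolding holomorphic_near_def
proof (intro conjI allI)
  show "smooth_on S (dd v h)" by (rule smooth_on_dd[OF S_open holomorphic_near_smooth[OF assms]])
  fix vs
  have "dds vs (dd v h) = dds (vs @ [v]) h" by (simp add: dds_append)
  then show "\<exists>k. k holomorphic_on ball 0 \<epsilon> \<and> (\<forall>t. 0 < t \<longrightarrow> t < \<epsilon> \<longrightarrow> on_line (dds vs (dd v h)) t = k (of_real t))"
    using assms unfolding holomorphic_near_def by metis
qed

lemma holomorphic_near_const: "holomorphic_near (\<lambda>_. c)"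
  unfolding holomorphic_near_def
proof (intro conjI allI)
  show "smooth_on S (\<lambda>_. c)" by (rule smooth_on_const[OF S_open])
  fix vs :: "(real ^ 'n) list"
  have "\<exists>c'. dds vs (\<lambda>_. c) = (\<lambda>_. c')"
  proof (induction vs)
    case (Cons v vs)
    then obtain c' where "dds vs (\<lambda>_. c) = (\<lambda>_. c')" by blast
    then have "dds (v # vs) (\<lambda>_. c) = dd v (\<lambda>_. c')" by simp
    also have "\<dots> = (\<lambda>_. 0)" by (rule ext) (rule dd_const)
    finally have "dds (v # vs) (\<lambda>_. c) = (\<lambda>_. 0)" .
    then show ?case by blast
  qed auto
  then obtain c' where "dds vs (\<lambda>_. c) = (\<lambda>_. c')" by blast
  then show "\<exists>k. k holomorphic_on ball 0 \<epsilon> \<and> (\<forall>t. 0 < t \<longrightarrow> t < \<epsilon> \<longrightarrow> on_line (dds vs (\<lambda>_. c)) t = k (of_real t))"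
    by (intro exI[of _ "\<lambda>_. c'"]) (simp add: on_line_def)
qed

lemma holomorphic_near_add:
  assumes "holomorphic_near f" "holomorphic_near g"
  shows "holomorphic_near (\<lambda>x. f x + g x)"
  unfolding holomorphic_near_def
proof (intro conjI allI)
  note sm = holomorphic_near_smooth[OF assms(1)] holomorphic_near_smooth[OF assms(2)]
  show "smooth_on S (\<lambda>x. f x + g x)" by (rule smooth_on_add[OF S_open sm])
  fix vs
  obtain k where k: "k holomorphic_on ball 0 \<epsilon>" "\<And>t. 0 < t \<Longrightarrow> t < \<epsilon> \<Longrightarrow> on_line (dds vs f) t = k (of_real t)"
    using assms(1) unfolding holomorphic_near_def by blast
  obtain l where l: "l holomorphic_on ball 0 \<epsilon>" "\<And>t. 0 < t \<Longrightarrow> t < \<epsilon> \<Longrightarrow> on_line (dds vs g) t = l (of_real t)"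
    using assms(2) unfolding holomorphic_near_def by blast
  show "\<exists>k. k holomorphic_on ball 0 \<epsilon> \<and> (\<forall>t. 0 < t \<longrightarrow> t < \<epsilon> \<longrightarrow> on_line (dds vs (\<lambda>x. f x + g x)) t = k (of_real t))"
  proof (intro exI[of _ "\<lambda>z. k z + l z"] conjI allI impI holomorphic_on_add k(1) l(1))
    fix t assume t: "0 < t" "t < \<epsilon>"
    have "on_line (dds vs (\<lambda>x. f x + g x)) t = on_line (dds vs f) t + on_line (dds vs g) t"
      unfolding on_line_def by (rule dds_add[OF S_open sm line_in[OF t]])
    then show "on_line (dds vs (\<lambda>x. f x + g x)) t = k (of_real t) + l (of_real t)"
      unfolding k(2)[OF t] l(2)[OF t] .
  qed
qed

lemma holomorphic_near_cmult:
  assumes "holomorphic_near f"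
  shows "holomorphic_near (\<lambda>x. c * f x)"
  unfolding holomorphic_near_def
proof (intro conjI allI)
  note sm = holomorphic_near_smooth[OF assms(1)]
  show "smooth_on S (\<lambda>x. c * f x)" by (rule smooth_on_mult[OF S_open smooth_on_const[OF S_open] sm])
  fix vs
  obtain k where k: "k holomorphic_on ball 0 \<epsilon>" "\<And>t. 0 < t \<Longrightarrow> t < \<epsilon> \<Longrightarrow> on_line (dds vs f) t = k (of_real t)"
    using assms(1) unfolding holomorphic_near_def by blast
  show "\<exists>k. k holomorphic_on ball 0 \<epsilon> \<and> (\<forall>t. 0 < t \<longrightarrow> t < \<epsilon> \<longrightarrow> on_line (dds vs (\<lambda>x. c * f x)) t = k (of_real t))"
  proof (intro exI[of _ "\<lambda>z. c * k z"] conjI allI impI holomorphic_on_mult holomorphic_on_const k(1))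
    fix t assume t: "0 < t" "t < \<epsilon>"
    have "on_line (dds vs (\<lambda>x. c * f x)) t = c * on_line (dds vs f) t"
      unfolding on_line_def by (rule dds_cmult[OF S_open sm line_in[OF t]])
    then show "on_line (dds vs (\<lambda>x. c * f x)) t = c * k (of_real t)"
      unfolding k(2)[OF t] .
  qed
qed

lemma holomorphic_near_sum:
  assumes "finite I" "\<And>i. i \<in> I \<Longrightarrow> holomorphic_near (f i)"
  shows "holomorphic_near (\<lambda>x. \<Sum>i\<in>I. f i x)"
  using assms by (induction I rule: finite_induct) (auto intro: holomorphic_near_const holomorphic_near_add)

lemma holomorphic_near_imp_log_pole:
  assumes "holomorphic_near h"
  shows "log_pole 0 L h"
  unfolding log_pole_def
proof (intro conjI allI impI)
  show "smooth_on S h" by (rule holomorphic_near_smooth[OF assms])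
  fix vs
  obtain k where k: "k holomorphic_on ball 0 \<epsilon>" "\<And>t. 0 < t \<Longrightarrow> t < \<epsilon> \<Longrightarrow> on_line (dds vs h) t = k (of_real t)"
    using assms(1) unfolding holomorphic_near_def by blast
  show "\<exists>q. loglead \<epsilon> 0 L (on_line (dds vs h)) q"
    by (rule exI, rule loglead_holomorphic[OF k])
qed

lemma log_pole_const: "log_pole N L (\<lambda>_. c)"
  by (rule log_pole_mono[OF holomorphic_near_imp_log_pole[OF holomorphic_near_const]]) auto

lemma log_pole_sum:
  assumes "\<And>i. i \<in> I \<Longrightarrow> log_pole N L (f i)"
  shows "log_pole N L (\<lambda>x. \<Sum>i\<in>I. f i x)"
  using assms by (induction I rule: infinite_finite_induct) (simp_all add: log_pole_const log_pole_add)

lemma log_pole_dd_tangential: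
  assumes "log_pole N L f" "e \<bullet> v = 0"
  shows "log_pole N L (dd v f)"
  unfolding log_pole_def
proof (intro conjI allI impI)
  show "smooth_on S (dd v f)" by (rule smooth_on_dd[OF S_open log_pole_smooth[OF assms(1)]])
  fix vs assume "tangential vs"
  then have "tangential (vs @ [v])" using assms(2) by (simp add: tangential_def)
  then have "\<exists>q. loglead \<epsilon> N L (on_line (dds (vs @ [v]) f)) q" by (rule log_poleD[OF assms(1)])
  then show "\<exists>q. loglead \<epsilon> N L (on_line (dds vs (dd v f))) q" by (simp add: dds_append)
qed

lemma on_line_deriv:
  assumes "smooth_on S f" "0 < t" "t < \<epsilon>"
  shows "(on_line f has_vector_derivative on_line (dd e f) t) (at t)"
  unfolding on_line_def by (rule dd_along_line[OF S_open assms(1) line_in[OF assms(2,3)]])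

lemma loglead_dd_normal:
  assumes "smooth_on S f" "loglead \<epsilon> N L (on_line f) q"
  shows "loglead \<epsilon> (Suc N) L (on_line (dd e f)) (\<lambda>s. of_nat (Suc s) * q (Suc s) - of_nat N * q s)"
  by (rule loglead_deriv[OF assms(2) on_line_deriv[OF assms(1)]])

lemma log_pole_dd_normal:
  assumes "log_pole N L f"
  shows "log_pole (Suc N) L (dd e f)"
  unfolding log_pole_def
proof (intro conjI allI impI)
  note sm = log_pole_smooth[OF assms]
  show "smooth_on S (dd e f)" by (rule smooth_on_dd[OF S_open sm])
  fix vs assume vs: "tangential vs"
  obtain q where "loglead \<epsilon> N L (on_line (dds vs f)) q" using log_poleD[OF assms vs] by blast
  from on_line_cong[OF loglead_dd_normal[OF smooth_on_dds[OF S_open sm] this] dds_dd_commute[OF S_open sm, symmetric]]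
  show "\<exists>q. loglead \<epsilon> (Suc N) L (on_line (dds vs (dd e f))) q" by blast
qed

text \<open>The derivative along e commutes with the tangential ones, so each tangential derivative
  of f is, on the line, an antiderivative of a function with a known expansion.\<close>

lemma log_pole_antideriv:
  assumes "smooth_on S f" "log_pole N L (dd e f)"
  shows "log_pole N (Suc L) f"
  unfolding log_pole_def
proof (intro conjI allI impI)
  show "smooth_on S f" by fact
  fix vs assume vs: "tangential vs"
  obtain q where "loglead \<epsilon> N L (on_line (dds vs (dd e f))) q" using log_poleD[OF assms(2) vs] by blast
  from on_line_cong[OF this dds_dd_commute[OF S_open assms(1)]]
  have "loglead \<epsilon> N L (on_line (dd e (dds vs f))) q" .
  from loglead_antideriv[OF eps this on_line_deriv[OF smooth_on_dds[OF S_open assms(1)]]]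
  show "\<exists>q. loglead \<epsilon> N (Suc L) (on_line (dds vs f)) q" .
qed

text \<open>The Leibniz rule. The innermost derivative is peeled off, which yields products of the
  same kind with \<open>dd v f\<close> or \<open>dd v h\<close>; hence the induction from the right,
  with both factors arbitrary.\<close>

lemma log_pole_mult_holomorphic:
  assumes "holomorphic_near h" "log_pole N L f"
  shows "log_pole N L (\<lambda>x. h x * f x)"
  unfolding log_pole_def
proof (intro conjI allI impI)
  show "smooth_on S (\<lambda>x. h x * f x)"
    by (rule smooth_on_mult[OF S_open holomorphic_near_smooth[OF assms(1)] log_pole_smooth[OF assms(2)]])
  fix vs assume "tangential vs"
  then show "\<exists>q. loglead \<epsilon> N L (on_line (dds vs (\<lambda>x. h x * f x))) q"
    using assms
  proof (induction vs arbitrary: h f rule: rev_induct)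
    case Nil
    obtain k where k: "k holomorphic_on ball 0 \<epsilon>" "\<And>t. 0 < t \<Longrightarrow> t < \<epsilon> \<Longrightarrow> on_line (dds [] h) t = k (of_real t)"
      using Nil(2) unfolding holomorphic_near_def by blast
    obtain q where q: "loglead \<epsilon> N L (on_line (dds [] f)) q" using log_poleD[OF Nil(3,1)] by blast
    have "loglead \<epsilon> N L (\<lambda>t. on_line (dds [] h) t * on_line (dds [] f) t) (\<lambda>s. k 0 * q s)"
      by (rule loglead_mult[OF q k])
    then show ?case by (auto simp: on_line_def[abs_def])
  next
    case (snoc v vs)
    have vs: "tangential vs" and v: "e \<bullet> v = 0" using snoc.prems(1) by (auto simp: tangential_def)
    note smh = holomorphic_near_smooth[OF snoc.prems(2)] and smf = log_pole_smooth[OF snoc.prems(3)]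
    obtain q where q: "loglead \<epsilon> N L (on_line (dds vs (\<lambda>x. h x * dd v f x))) q"
      using snoc.IH[OF vs snoc.prems(2) log_pole_dd_tangential[OF snoc.prems(3) v]] by blast
    obtain r where r: "loglead \<epsilon> N L (on_line (dds vs (\<lambda>x. dd v h x * f x))) r"
      using snoc.IH[OF vs holomorphic_near_dd[OF snoc.prems(2)] snoc.prems(3)] by blast
    have "on_line (dds vs (\<lambda>x. h x * dd v f x)) t + on_line (dds vs (\<lambda>x. dd v h x * f x)) t
        = on_line (dds (vs @ [v]) (\<lambda>x. h x * f x)) t" if t: "0 < t" "t < \<epsilon>" for t
    proof -
      have "dds vs (dd v (\<lambda>x. h x * f x)) (y + t *\<^sub>R e) = dds vs (\<lambda>x. h x * dd v f x + dd v h x * f x) (y + t *\<^sub>R e)"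
        by (rule dds_cong_open[OF S_open dd_mult[OF S_open smh smf] line_in[OF t]])
      also have "\<dots> = dds vs (\<lambda>x. h x * dd v f x) (y + t *\<^sub>R e) + dds vs (\<lambda>x. dd v h x * f x) (y + t *\<^sub>R e)"
        by (rule dds_add[OF S_open smooth_on_mult[OF S_open smh smooth_on_dd[OF S_open smf]]
              smooth_on_mult[OF S_open smooth_on_dd[OF S_open smh] smf] line_in[OF t]])
      finally show ?thesis by (simp add: on_line_def dds_append)
    qed
    from loglead_cong[OF loglead_add[OF q r] this] show ?case by blast
  qed
qed

abbreviation inv_power :: "nat \<Rightarrow> real ^ 'n \<Rightarrow> complex" where
  "inv_power \<equiv> inner_pole e"

lemma inner_e_nonzero: "x \<in> S \<Longrightarrow> e \<bullet> x \<noteq> 0"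
  using S_pos by force

lemmas dd_inv_power = dd_inner_pole[OF inner_e_nonzero]

lemmas smooth_on_cmult_inv_power = smooth_on_inner_pole[OF S_open inner_e_nonzero]

lemma smooth_on_inv_power: "smooth_on S (inv_power l)"
  using smooth_on_cmult_inv_power[of 1 l] by simp

lemma dds_mult_inv_power:
  assumes "tangential vs" "smooth_on S f" "x \<in> S"
  shows "dds vs (\<lambda>x. f x * inv_power l x) x = dds vs f x * inv_power l x"
  using assms(1,3)
proof (induction vs arbitrary: x)
  case (Cons v vs)
  have vs: "tangential vs" "e \<bullet> v = 0" using Cons.prems by (auto simp: tangential_def)
  have "dd v (dds vs (\<lambda>x. f x * inv_power l x)) x = dd v (\<lambda>x. dds vs f x * inv_power l x) x"
    by (rule dd_cong_open[OF S_open Cons.prems(2) Cons.IH[OF vs(1)]])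
  also have "\<dots> = dds vs f x * dd v (inv_power l) x + dd v (dds vs f) x * inv_power l x"
    by (rule dd_mult[OF S_open smooth_on_dds[OF S_open assms(2)] smooth_on_inv_power Cons.prems(2)])
  also have "dd v (inv_power l) x = 0" unfolding dd_inv_power[OF Cons.prems(2)] vs(2) by simp
  finally show ?case by simp
qed simp

lemma loglead_mult_inv_power:
  assumes "loglead \<epsilon> N L (on_line f) q"
  shows "loglead \<epsilon> (N + l) L (on_line (\<lambda>x. f x * inv_power l x)) q"
  by (rule loglead_cong[OF loglead_divide_power[OF assms, of l]]) (simp add: on_line_def inner_pole_def e_line)

lemma log_pole_mult_inv_power:
  assumes "log_pole N L f"
  shows "log_pole (N + l) L (\<lambda>x. f x * inv_power l x)"
  unfolding log_pole_def
proof (intro conjI allI impI)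
  note sm = log_pole_smooth[OF assms]
  show "smooth_on S (\<lambda>x. f x * inv_power l x)" by (rule smooth_on_mult[OF S_open sm smooth_on_inv_power])
  fix vs assume vs: "tangential vs"
  obtain q where "loglead \<epsilon> N L (on_line (dds vs f)) q" using log_poleD[OF assms vs] by blast
  from on_line_cong[OF loglead_mult_inv_power[OF this] dds_mult_inv_power[OF vs sm, symmetric]]
  show "\<exists>q. loglead \<epsilon> (N + l) L (on_line (dds vs (\<lambda>x. f x * inv_power l x))) q" by blast
qed

text \<open>Projections of the coordinate axes to the hyperplane. They are linearly dependent, but
  replace an orthonormal basis of the hyperplane in the Laplacian.\<close>

definition tangent_axis :: "'n \<Rightarrow> real ^ 'n" where
  "tangent_axis j = axis j 1 - (e $ j) *\<^sub>R e"

lemma tangent_axis_orthogonal: "e \<bullet> tangent_axis j = 0"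
  by (simp add: tangent_axis_def inner_diff_right e_e inner_axis)

text \<open>Each axis is its tangential part plus a multiple e $ j of e. The squares of these
  multiples sum to 1, and the mixed terms cancel because the tangential parts weighted by them sum
  to 0.\<close>

lemma laplacian_split:
  assumes "smooth_on S f" "x \<in> S"
  shows "laplacian f x = dd e (dd e f) x + (\<Sum>j\<in>UNIV. dd (tangent_axis j) (dd (tangent_axis j) f) x)"
proof -
  have ax: "axis j 1 = tangent_axis j + (e $ j) *\<^sub>R e" for j by (simp add: tangent_axis_def)
  have "(\<Sum>j\<in>UNIV. (e $ j) *\<^sub>R axis j (1::real)) = e"
    by (simp add: vec_eq_iff axis_def if_distrib sum.delta' cong: if_cong)
  moreover have "(\<Sum>j\<in>UNIV. e $ j * e $ j) = 1" using e_e by (simp add: inner_vec_def)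
  ultimately have zero: "(\<Sum>j\<in>UNIV. (e $ j) *\<^sub>R tangent_axis j) = 0"
    by (simp add: tangent_axis_def scaleR_diff_right sum_subtractf flip: scaleR_sum_left)
  have one: "(\<Sum>j\<in>UNIV. complex_of_real (e $ j) * complex_of_real (e $ j)) = 1"
    using \<open>(\<Sum>j\<in>UNIV. e $ j * e $ j) = 1\<close> by (simp flip: of_real_mult of_real_sum)
  have "dd (axis j 1) (dd (axis j 1) f) x = dd (tangent_axis j) (dd (tangent_axis j) f) x
      + 2 * (complex_of_real (e $ j) * dd (tangent_axis j) (dd e f) x)
      + complex_of_real (e $ j) * complex_of_real (e $ j) * dd e (dd e f) x" for j
  proof -
    let ?T = "tangent_axis j" and ?c = "complex_of_real (e $ j)"
    have fn: "dd (axis j 1) f = (\<lambda>x. dd ?T f x + ?c * dd e f x)"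
      unfolding ax by (rule ext) (simp add: dd_vector_add dd_vector_scale)
    have sm: "smooth_on S (dd ?T f)" "smooth_on S (dd e f)" "smooth_on S (\<lambda>x. ?c * dd e f x)"
      by (intro smooth_on_mult smooth_on_const smooth_on_dd S_open assms)+
    have "dd v (dd (axis j 1) f) x = dd v (dd ?T f) x + ?c * dd v (dd e f) x" for v
      unfolding fn dd_add[OF S_open sm(1) sm(3) assms(2)] dd_cmult[OF S_open sm(2) assms(2)] ..
    then have "dd (axis j 1) (dd (axis j 1) f) x = dd ?T (dd ?T f) x + ?c * dd ?T (dd e f) x
       + ?c * (dd e (dd ?T f) x + ?c * dd e (dd e f) x)"
      unfolding ax[of j] dd_vector_add dd_vector_scale by simp
    also have "dd e (dd ?T f) x = dd ?T (dd e f) x" by (rule dd_commute[OF S_open assms])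
    finally show ?thesis by (simp add: algebra_simps)
  qed
  then have "laplacian f x = (\<Sum>j\<in>UNIV. dd (tangent_axis j) (dd (tangent_axis j) f) x)
      + 2 * (\<Sum>j\<in>UNIV. complex_of_real (e $ j) * dd (tangent_axis j) (dd e f) x)
      + (\<Sum>j\<in>UNIV. complex_of_real (e $ j) * complex_of_real (e $ j)) * dd e (dd e f) x"
    unfolding laplacian_dd by (simp add: sum.distrib sum_distrib_left sum_distrib_right)
  also have "(\<Sum>j\<in>UNIV. complex_of_real (e $ j) * dd (tangent_axis j) (dd e f) x) = 0"
  proof -
    have "(\<Sum>j\<in>UNIV. complex_of_real (e $ j) * dd (tangent_axis j) (dd e f) x)
      = dd (\<Sum>j\<in>UNIV. (e $ j) *\<^sub>R tangent_axis j) (dd e f) x"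
      by (simp add: dd_vector_sum dd_vector_scale)
    then show ?thesis unfolding zero by (simp add: dd_def)
  qed
  finally show ?thesis unfolding one by simp
qed

lemma log_pole_laplacian:
  assumes "log_pole N L f"
  shows "log_pole (Suc (Suc N)) L (laplacian f)"
proof (rule log_pole_cong)
  show "log_pole (Suc (Suc N)) L (\<lambda>x. dd e (dd e f) x + (\<Sum>j\<in>UNIV. dd (tangent_axis j) (dd (tangent_axis j) f) x))"
    by (intro log_pole_add log_pole_sum log_pole_dd_normal
         log_pole_mono[OF log_pole_dd_tangential[OF log_pole_dd_tangential[OF assms]], of _ _ "Suc (Suc N)" L] assms tangent_axis_orthogonal) auto
  show "dd e (dd e f) x + (\<Sum>j\<in>UNIV. dd (tangent_axis j) (dd (tangent_axis j) f) x) = laplacian f x" if "x \<in> S" for x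
    by (rule laplacian_split[OF log_pole_smooth[OF assms] that, symmetric])
qed

end

section \<open>Extraction of polynomial coefficients\<close>

lemma sum_real_powers_mult_linear:
  "(\<Sum>i\<le>n. t ^ i * (a i + t * b i)) = (\<Sum>i\<le>Suc n. t ^ i * ((if i \<le> n then a i else 0) + (case i of 0 \<Rightarrow> 0 | Suc i' \<Rightarrow> b i')))"
  for a b :: "nat \<Rightarrow> complex"
proof -
  have "(\<Sum>i\<le>Suc n. t ^ i * (case i of 0 \<Rightarrow> 0 | Suc i' \<Rightarrow> b i')) = (\<Sum>i\<le>n. t ^ i * (t * b i))"
    by (subst sum.atMost_Suc_shift) (simp add: mult_ac)
  then show ?thesis by (simp add: distrib_left sum.distrib)
qed

lemma poly_coeff_sum:
  assumes "degree q \<le> n"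
  shows "poly q (t :: complex) = (\<Sum>i\<le>n. coeff q i * t ^ i)"
proof -
  have "(\<Sum>i\<le>n. coeff q i * t ^ i) = (\<Sum>i\<le>degree q. coeff q i * t ^ i)"
    using assms by (intro sum.mono_neutral_right) (auto simp: coeff_eq_0)
  then show ?thesis by (simp add: poly_altdef)
qed

lemma coeff_pcompose_translate:
  fixes q :: "complex poly"
  assumes "degree q \<le> n"
  shows "coeff (pcompose q [:t, 1:]) l = (\<Sum>r\<le>n. of_nat (r choose l) * coeff q r * t ^ (r - l))"
proof -
  have lin: "coeff ([:t, 1:] ^ r) l = of_nat (r choose l) * t ^ (r - l)" for r l
  proof (cases "l \<le> r")
    case True
    then show ?thesis by (simp add: coeff_linear_poly_power)
  next
    case False
    have "degree ([:t, 1:] ^ r) \<le> r" using degree_power_le[of "[:t, 1:]" r] by simp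
    then show ?thesis using False by (simp add: coeff_eq_0)
  qed
  have mon: "pcompose (monom c r) [:t, 1:] = smult c ([:t, 1:] ^ r)" for c r
    by (induction r) (simp_all add: monom_0 monom_Suc pcompose_pCons smult_add_right)
  have "pcompose q [:t, 1:] = (\<Sum>r\<le>n. smult (coeff q r) ([:t, 1:] ^ r))"
  proof -
    have "q = (\<Sum>r\<le>n. monom (coeff q r) r)" using poly_as_sum_of_monoms'[OF assms] by simp
    then have "pcompose q [:t, 1:] = (\<Sum>r\<le>n. pcompose (monom (coeff q r) r) [:t, 1:])"
      by (metis pcompose_sum)
    also have "\<dots> = (\<Sum>r\<le>n. smult (coeff q r) ([:t, 1:] ^ r))"
      unfolding mon ..
    finally show ?thesis .
  qed
  then show ?thesis by (simp add: coeff_sum lin mult_ac)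
qed

text \<open>Lagrange interpolation at 0, ..., d is exact on polynomials of degree at most d, so the
  j-th coefficients of the Lagrange basis are weights that read off a coefficient from
  values.\<close>

lemma interpolation_weights:
  "\<exists>w. \<forall>i\<le>d. (\<Sum>l\<le>d. w l * of_nat l ^ i) = (if i = j then 1 else (0::complex))" if "j \<le> d"
proof -
  define L where "L l = (\<Prod>k\<in>{..d} - {l}. smult (1 / (of_nat l - of_nat k)) [:- of_nat k, 1:] :: complex poly)" for l
  have L: "poly (L l) (of_nat k) = (if k = l then 1 else 0)" if "k \<le> d" "l \<le> d" for k l
  proof (cases "k = l")
    case True
    then show ?thesis unfolding L_def poly_prod by (auto intro!: prod.neutral simp flip: diff_divide_distrib)
  next
    case False
    then show ?thesis unfolding L_def poly_prod using that by (auto intro!: prod_zero)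
  qed
  have degL: "degree (L l) \<le> d" if "l \<le> d" for l
  proof -
    have "degree (L l) \<le> (\<Sum>k\<in>{..d} - {l}. 1)"
      unfolding L_def by (rule order_trans[OF degree_prod_sum_le], simp, rule sum_mono) simp
    then show ?thesis using that by simp
  qed
  have eq: "(\<Sum>l\<le>d. smult (of_nat l ^ i) (L l)) = monom 1 i" if "i \<le> d" for i
  proof (rule ccontr)
    define P where "P = (\<Sum>l\<le>d. smult (of_nat l ^ i) (L l)) - monom 1 i"
    assume "\<not> ?thesis"
    then have "P \<noteq> 0" by (simp add: P_def)
    have "degree P \<le> d" unfolding P_def
      by (intro degree_diff_le degree_sum_le order_trans[OF degree_smult_le degL] order_trans[OF degree_monom_le that]) auto
    have "poly P (of_nat k) = 0" if "k \<le> d" for k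
    proof -
      have "(\<Sum>l\<le>d. of_nat l ^ i * poly (L l) (of_nat k)) = (\<Sum>l\<le>d. if l = k then of_nat k ^ i else 0)"
        by (intro sum.cong refl) (use that in \<open>auto simp: L\<close>)
      then show ?thesis using that by (simp add: P_def poly_sum poly_monom)
    qed
    then have "of_nat ` {..d} \<subseteq> {z. poly P z = 0}" by auto
    moreover have "card (of_nat ` {..d} :: complex set) = Suc d" by (subst card_image) (auto simp: inj_on_def)
    ultimately have "Suc d \<le> card {z. poly P z = 0}"
      using card_mono[OF poly_roots_finite[OF \<open>P \<noteq> 0\<close>]] by metis
    also have "\<dots> \<le> degree P" by (rule card_poly_roots_bound[OF \<open>P \<noteq> 0\<close>])
    finally show False using \<open>degree P \<le> d\<close> by simp
  qed
  show ?thesis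
  proof (intro exI[of _ "\<lambda>l. coeff (L l) j"] allI impI)
    fix i assume "i \<le> d"
    have "(\<Sum>l\<le>d. coeff (L l) j * of_nat l ^ i) = coeff (\<Sum>l\<le>d. smult (of_nat l ^ i) (L l)) j"
      by (simp add: coeff_sum mult.commute)
    then show "(\<Sum>l\<le>d. coeff (L l) j * of_nat l ^ i) = (if i = j then 1 else 0)"
      unfolding eq[OF \<open>i \<le> d\<close>] by simp
  qed
qed

text \<open>The weights are products of one-variable weights, at grid points with entries 0, ..., d.
  Each coefficient of a homogeneous polynomial becomes a fixed combination of finitely many of its
  values.\<close>

lemma coefficient_from_values:
  fixes p :: "'n :: finite \<Rightarrow> nat"
  assumes p: "sum p UNIV = d"
  shows "\<exists>W. \<forall>q. sum q UNIV = d \<longrightarrow>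
    (\<Sum>l\<in>PiE UNIV (\<lambda>_. {..d}). W l * complex_of_real (mpower (\<chi> j. real (l j)) q)) = (if q = p then 1 else 0)"
proof -
  have le: "q j \<le> d" if "sum q UNIV = d" for q :: "'n \<Rightarrow> nat" and j
    using member_le_sum[of j UNIV q] that by simp
  obtain w where w: "\<And>j i. i \<le> d \<Longrightarrow> (\<Sum>l\<le>d. w j l * of_nat l ^ i) = (if i = p j then 1 else (0::complex))"
    using interpolation_weights[OF le[OF p]] by metis
  show ?thesis
  proof (intro exI[of _ "\<lambda>l. \<Prod>j\<in>UNIV. w j (l j)"] allI impI)
    fix q :: "'n \<Rightarrow> nat" assume q: "sum q UNIV = d"
    have "(\<Sum>l\<in>PiE UNIV (\<lambda>_. {..d}). (\<Prod>j\<in>UNIV. w j (l j)) * complex_of_real (mpower (\<chi> j. real (l j)) q))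
      = (\<Sum>l\<in>PiE UNIV (\<lambda>_. {..d}). \<Prod>j\<in>UNIV. w j (l j) * of_nat (l j) ^ q j)"
      by (intro sum.cong refl) (simp add: mpower_def prod.distrib)
    also have "\<dots> = (\<Prod>j\<in>UNIV. \<Sum>l\<le>d. w j l * of_nat l ^ q j)"
      by (rule prod_sum_PiE[symmetric, of UNIV "\<lambda>_. {..d}" "\<lambda>j l. w j l * of_nat l ^ q j"]) auto
    also have "\<dots> = (\<Prod>j\<in>UNIV. if q j = p j then 1 else 0)"
      by (intro prod.cong refl w le q)
    also have "\<dots> = (if q = p then 1 else 0)"
    proof (cases "q = p")
      case False
      then obtain j where "q j \<noteq> p j" by auto
      then show ?thesis using False by (auto intro!: prod_zero)
    qed simp
    finally show "(\<Sum>l\<in>PiE UNIV (\<lambda>_. {..d}). (\<Prod>j\<in>UNIV. w j (l j)) * complex_of_real (mpower (\<chi> j. real (l j)) q))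
      = (if q = p then 1 else 0)" .
  qed
qed

section \<open>Equations for the coefficients of the operator\<close>

lemma pcompose_power: "pcompose (p ^ n) q = pcompose p q ^ n"
  by (induction n) (simp_all add: pcompose_1 pcompose_mult)

context near_hyperplane
begin

section \<open>The symbol as a polynomial in the normal component of the frequency\<close>

definition normal_poly :: "('n \<Rightarrow> nat) \<Rightarrow> real ^ 'n \<Rightarrow> complex poly" where
  "normal_poly p \<eta> = (\<Prod>j\<in>UNIV. [:complex_of_real (\<eta> $ j), complex_of_real (e $ j):] ^ p j)"

lemma degree_normal_poly: "degree (normal_poly p \<eta>) \<le> sum p UNIV"
proof -
  have "degree (normal_poly p \<eta>) \<le> (\<Sum>j\<in>UNIV. degree ([:complex_of_real (\<eta> $ j), complex_of_real (e $ j):] ^ p j))"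
    unfolding normal_poly_def by (rule order_trans[OF degree_prod_sum_le]) simp_all
  also have "\<dots> \<le> sum p UNIV"
  proof (rule sum_mono)
    fix j
    have "degree ([:complex_of_real (\<eta> $ j), complex_of_real (e $ j):] ^ p j) \<le> degree [:complex_of_real (\<eta> $ j), complex_of_real (e $ j):] * p j"
      by (rule degree_power_le)
    also have "\<dots> \<le> 1 * p j" by (intro mult_right_mono) simp_all
    finally show "degree ([:complex_of_real (\<eta> $ j), complex_of_real (e $ j):] ^ p j) \<le> p j" by simp
  qed
  finally show ?thesis .
qed

lemma poly_normal_poly: "poly (normal_poly p \<eta>) (complex_of_real \<tau>) = complex_of_real (mpower (\<eta> + \<tau> *\<^sub>R e) p)"
  by (simp add: normal_poly_def poly_prod mpower_def)

lemma normal_poly_shift: "normal_poly p (\<eta> + \<tau> *\<^sub>R e) = pcompose (normal_poly p \<eta>) [:complex_of_real \<tau>, 1:]"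
  unfolding normal_poly_def pcompose_prod pcompose_power
  by (simp add: pcompose_pCons mult.commute)

text \<open>The coefficient of \<open>\<tau> ^ i\<close> in the part of degree \<open>k\<close> of the symbol at \<open>\<eta> + \<tau> e\<close>.\<close>

definition normal_coeff :: "(('n \<Rightarrow> nat) \<Rightarrow> real ^ 'n \<Rightarrow> complex) \<Rightarrow> nat \<Rightarrow> nat \<Rightarrow> real ^ 'n \<Rightarrow> real ^ 'n \<Rightarrow> complex" where
  "normal_coeff a k i \<eta> x = (\<Sum>p | sum p UNIV = k. a p x * coeff (normal_poly p \<eta>) i)"

lemma normal_coeff_eq_0: "i > k \<Longrightarrow> normal_coeff a k i \<eta> = (\<lambda>_. 0)"
  unfolding normal_coeff_def[abs_def]
proof (intro ext sum.neutral ballI)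
  fix x and p :: "'n \<Rightarrow> nat" assume "i > k" "p \<in> {p. sum p UNIV = k}"
  then have "degree (normal_poly p \<eta>) < i" using degree_normal_poly[of p \<eta>] by simp
  then show "a p x * coeff (normal_poly p \<eta>) i = 0" by (simp add: coeff_eq_0)
qed

lemma symbol_part_eq_normal_coeffs:
  assumes "k \<le> n"
  shows "symbol_part a k (\<eta> + \<tau> *\<^sub>R e) x = (\<Sum>i\<le>n. complex_of_real \<tau> ^ i * normal_coeff a k i \<eta> x)"
proof -
  have "symbol_part a k (\<eta> + \<tau> *\<^sub>R e) x = (\<Sum>p | sum p UNIV = k. \<Sum>i\<le>n. complex_of_real \<tau> ^ i * (a p x * coeff (normal_poly p \<eta>) i))"
    unfolding symbol_part_def
  proof (intro sum.cong refl)
    fix p :: "'n \<Rightarrow> nat" assume "p \<in> {p. sum p UNIV = k}"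
    then have "degree (normal_poly p \<eta>) \<le> n" using degree_normal_poly[of p \<eta>] assms by simp
    then show "a p x * complex_of_real (mpower (\<eta> + \<tau> *\<^sub>R e) p) = (\<Sum>i\<le>n. complex_of_real \<tau> ^ i * (a p x * coeff (normal_poly p \<eta>) i))"
      unfolding poly_normal_poly[symmetric] poly_coeff_sum[OF \<open>degree (normal_poly p \<eta>) \<le> n\<close>] sum_distrib_left
      by (simp add: mult_ac)
  qed
  also have "\<dots> = (\<Sum>i\<le>n. \<Sum>p | sum p UNIV = k. complex_of_real \<tau> ^ i * (a p x * coeff (normal_poly p \<eta>) i))"
    by (rule sum.swap)
  finally show ?thesis by (simp add: normal_coeff_def sum_distrib_left)
qed

lemma smooth_on_normal_coeff:
  assumes "\<And>p. sum p UNIV = k \<Longrightarrow> smooth_on S (a p)"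
  shows "smooth_on S (normal_coeff a k i \<eta>)"
  unfolding normal_coeff_def[abs_def]
  by (intro smooth_on_sum smooth_on_mult smooth_on_const S_open) (use assms in simp)

text \<open>The l-th derivative of c / s ^ 2 at s = \<langle>e, x\<rangle>; l = 0 is the singular
  part of the potential.\<close>

definition pole_deriv :: "complex \<Rightarrow> nat \<Rightarrow> real ^ 'n \<Rightarrow> complex" where
  "pole_deriv c l x = (c * (-1) ^ l * fact (Suc l)) * inv_power (l + 2) x"

lemma smooth_on_pole_deriv: "smooth_on S (pole_deriv c l)"
  unfolding pole_deriv_def[abs_def] by (rule smooth_on_cmult_inv_power)

lemma dd_pole_deriv:
  assumes "x \<in> S"
  shows "dd v (pole_deriv c l) x = complex_of_real (e \<bullet> v) * pole_deriv c (Suc l) x"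
  unfolding pole_deriv_def[abs_def] dd_cmult[OF S_open smooth_on_inv_power assms] dd_inv_power[OF assms]
  by (simp add: algebra_simps)

text \<open>The pole varies only along e, so each derivative contributes a component of e, while the
  other k positions contribute components of \<zeta>. Summing over the choice of positions is the
  extraction of one coefficient of a product of linear polynomials.\<close>

lemma twist_pole:
  assumes "x \<in> S" "k \<le> length js"
  shows "twist \<zeta> (pole_deriv c 0) js k x
    = coeff (\<Prod>j\<leftarrow>js. [:complex_of_real (\<zeta> $ j), complex_of_real (e $ j):]) (length js - k) * pole_deriv c (length js - k) x"
  using assms
proof (induction js arbitrary: k x)
  case (Cons j js)
  define F where "F = (\<Prod>j\<leftarrow>js. [:complex_of_real (\<zeta> $ j), complex_of_real (e $ j):])"
  define n where "n = length js"
  have "degree F \<le> n" unfolding F_def n_def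
  proof (induction js)
    case (Cons i ks)
    then show ?case
      using degree_mult_le[of "[:complex_of_real (\<zeta> $ i), complex_of_real (e $ i):]" "\<Prod>j\<leftarrow>ks. [:complex_of_real (\<zeta> $ j), complex_of_real (e $ j):]"]
      by (simp del: mult_pCons_left split: if_splits)
  qed simp
  then have Fn: "coeff F (Suc n) = 0" by (simp add: coeff_eq_0)
  have c0: "coeff ([:A, B:] * F) 0 = A * coeff F 0" and cS: "coeff ([:A, B:] * F) (Suc r) = A * coeff F (Suc r) + B * coeff F r" for A B r
    by simp_all
  have IH: "twist \<zeta> (pole_deriv c 0) js k x = coeff F (n - k) * pole_deriv c (n - k) x" if "x \<in> S" "k \<le> n" for k x
    using Cons.IH[OF that(1)] that(2) unfolding F_def n_def by blast
  have dIH: "dd (axis j 1) (twist \<zeta> (pole_deriv c 0) js k) x = coeff F (n - k) * (complex_of_real (e $ j) * pole_deriv c (Suc (n - k)) x)"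
    if "k \<le> n" for k
  proof -
    have "dd (axis j 1) (twist \<zeta> (pole_deriv c 0) js k) x = dd (axis j 1) (\<lambda>x. coeff F (n - k) * pole_deriv c (n - k) x) x"
      by (rule dd_cong_open[OF S_open Cons.prems(1) IH[OF _ that]])
    also have "\<dots> = coeff F (n - k) * (complex_of_real (e $ j) * pole_deriv c (Suc (n - k)) x)"
      unfolding dd_cmult[OF S_open smooth_on_pole_deriv Cons.prems(1)] dd_pole_deriv[OF Cons.prems(1)] by (simp add: inner_axis)
    finally show ?thesis .
  qed
  have "twist \<zeta> (pole_deriv c 0) (j # js) k x = coeff ([:complex_of_real (\<zeta> $ j), complex_of_real (e $ j):] * F) (Suc n - k) * pole_deriv c (Suc n - k) x"
  proof (cases k)
    case 0
    show ?thesis unfolding 0 twist.simps dIH[OF le0] by (simp add: cS Fn del: mult_pCons_left)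
  next
    case (Suc k')
    then have "k' \<le> n" using Cons.prems(2) by (simp add: n_def)
    show ?thesis
    proof (cases "k' = n")
      case True
      have "twist \<zeta> (pole_deriv c 0) js (Suc n) = (\<lambda>_. 0)" by (rule twist_eq_0) (simp add: n_def)
      then show ?thesis unfolding Suc True twist.simps IH[OF Cons.prems(1) order_refl] by (simp add: c0 del: mult_pCons_left)
    next
      case False
      then have k: "Suc k' \<le> n" using \<open>k' \<le> n\<close> by simp
      then have nk: "Suc n - Suc k' = Suc (n - Suc k')" "n - k' = Suc (n - Suc k')" by simp_all
      show ?thesis unfolding Suc twist.simps dIH[OF k] IH[OF Cons.prems(1) \<open>k' \<le> n\<close>]
        unfolding nk cS by (simp add: algebra_simps del: mult_pCons_left)
    qed
  qed
  then show ?case by (simp add: F_def n_def del: mult_pCons_left)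
qed simp

text \<open>A part of degree k in \<zeta> has degree at most k in \<tau>, since each component of
  \<eta> + \<tau> e is linear in \<tau>; its coefficients are built from derivatives of R.\<close>

lemma twist_holomorphic:
  assumes R: "holomorphic_near R"
  shows "\<exists>h. (\<forall>i. holomorphic_near (h i)) \<and>
    (\<forall>x\<in>S. \<forall>\<tau>. twist (\<eta> + \<tau> *\<^sub>R e) R js k x = (\<Sum>i\<le>k. complex_of_real \<tau> ^ i * h i x))"
proof (induction js arbitrary: k)
  case Nil
  show ?case
  proof (cases k)
    case 0
    then show ?thesis by (intro exI[of _ "\<lambda>i. R"]) (simp add: R)
  next
    case (Suc k')
    then show ?thesis by (intro exI[of _ "\<lambda>i _. 0"]) (simp add: holomorphic_near_const)
  qed
next
  case (Cons j js)
  have dd_exp: "dd (axis j 1) (twist (\<eta> + \<tau> *\<^sub>R e) R js k) x = (\<Sum>i\<le>k. complex_of_real \<tau> ^ i * dd (axis j 1) (h i) x)"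
    if h: "\<And>i. holomorphic_near (h i)"
      "\<And>x \<tau>. x \<in> S \<Longrightarrow> twist (\<eta> + \<tau> *\<^sub>R e) R js k x = (\<Sum>i\<le>k. complex_of_real \<tau> ^ i * h i x)"
      and x: "x \<in> S" for h k \<tau> x
  proof -
    have sm: "smooth_on S (\<lambda>x. complex_of_real \<tau> ^ i * h i x)" for i
      by (rule holomorphic_near_smooth[OF holomorphic_near_cmult[OF h(1)]])
    have "dd (axis j 1) (twist (\<eta> + \<tau> *\<^sub>R e) R js k) x = dd (axis j 1) (\<lambda>x. \<Sum>i\<le>k. complex_of_real \<tau> ^ i * h i x) x"
      by (rule dd_cong_open[OF S_open x h(2)])
    also have "\<dots> = (\<Sum>i\<le>k. dd (axis j 1) (\<lambda>x. complex_of_real \<tau> ^ i * h i x) x)"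
      by (rule dd_sum[OF S_open sm x])
    also have "\<dots> = (\<Sum>i\<le>k. complex_of_real \<tau> ^ i * dd (axis j 1) (h i) x)"
      unfolding dd_cmult[OF S_open holomorphic_near_smooth[OF h(1)] x] ..
    finally show ?thesis .
  qed
  obtain h where h: "\<And>i. holomorphic_near (h i)"
      "\<And>x \<tau>. x \<in> S \<Longrightarrow> twist (\<eta> + \<tau> *\<^sub>R e) R js k x = (\<Sum>i\<le>k. complex_of_real \<tau> ^ i * h i x)"
    using Cons.IH[of k] by blast
  show ?case
  proof (cases k)
    case 0
    show ?thesis
    proof (intro exI[of _ "\<lambda>i. dd (axis j 1) (h i)"] conjI allI ballI holomorphic_near_dd h(1))
      fix x \<tau> assume "x \<in> S"
      then show "twist (\<eta> + \<tau> *\<^sub>R e) R (j # js) k x = (\<Sum>i\<le>k. complex_of_real \<tau> ^ i * dd (axis j 1) (h i) x)"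
        using dd_exp[OF h] unfolding 0 twist.simps by blast
    qed
  next
    case (Suc k')
    obtain h' where h': "\<And>i. holomorphic_near (h' i)"
        "\<And>x \<tau>. x \<in> S \<Longrightarrow> twist (\<eta> + \<tau> *\<^sub>R e) R js k' x = (\<Sum>i\<le>k'. complex_of_real \<tau> ^ i * h' i x)"
      using Cons.IH[of k'] by blast
    define g where "g i x = dd (axis j 1) (h i) x + ((if i \<le> k' then complex_of_real (\<eta> $ j) * h' i x else 0)
       + (case i of 0 \<Rightarrow> 0 | Suc i' \<Rightarrow> complex_of_real (e $ j) * h' i' x))" for i x
    have "holomorphic_near (g i)" for i
    proof -
      have "holomorphic_near (\<lambda>x. if i \<le> k' then complex_of_real (\<eta> $ j) * h' i x else 0)"
        by (cases "i \<le> k'") (simp_all add: holomorphic_near_const holomorphic_near_cmult h'(1))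
      moreover have "holomorphic_near (\<lambda>x. case i of 0 \<Rightarrow> 0 | Suc i' \<Rightarrow> complex_of_real (e $ j) * h' i' x)"
        by (cases i) (simp_all add: holomorphic_near_const holomorphic_near_cmult h'(1))
      ultimately show ?thesis unfolding g_def[abs_def]
        by (intro holomorphic_near_add holomorphic_near_dd h(1))
    qed
    moreover have "twist (\<eta> + \<tau> *\<^sub>R e) R (j # js) k x = (\<Sum>i\<le>k. complex_of_real \<tau> ^ i * g i x)" if x: "x \<in> S" for x \<tau>
    proof -
      have "twist (\<eta> + \<tau> *\<^sub>R e) R (j # js) k x = (\<Sum>i\<le>k. complex_of_real \<tau> ^ i * dd (axis j 1) (h i) x)
         + complex_of_real ((\<eta> + \<tau> *\<^sub>R e) $ j) * (\<Sum>i\<le>k'. complex_of_real \<tau> ^ i * h' i x)"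
        using dd_exp[OF h x] h'(2)[OF x] unfolding Suc twist.simps by simp
      also have "complex_of_real ((\<eta> + \<tau> *\<^sub>R e) $ j) * (\<Sum>i\<le>k'. complex_of_real \<tau> ^ i * h' i x)
        = (\<Sum>i\<le>k'. complex_of_real \<tau> ^ i * (complex_of_real (\<eta> $ j) * h' i x + complex_of_real \<tau> * (complex_of_real (e $ j) * h' i x)))"
        unfolding sum_distrib_left by (intro sum.cong refl) (simp add: algebra_simps)
      also have "\<dots> = (\<Sum>i\<le>k. complex_of_real \<tau> ^ i * ((if i \<le> k' then complex_of_real (\<eta> $ j) * h' i x else 0)
         + (case i of 0 \<Rightarrow> 0 | Suc i' \<Rightarrow> complex_of_real (e $ j) * h' i' x)))"
        unfolding Suc by (rule sum_real_powers_mult_linear)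
      finally show ?thesis unfolding g_def by (simp add: distrib_left sum.distrib)
    qed
    ultimately show ?thesis by blast
  qed
qed

text \<open>Put \<zeta> = \<eta> + \<tau> e in \<open>commutator_symbol_equation\<close> and compare
  powers of \<tau>. Taylor translation of \<open>normal_poly\<close> by \<tau> produces the
  binomials; they couple degree k and power i to degree k + l and power i + l, so the difference of
  degree and power is preserved by the pole terms. The regular part of R enters only through
  H.\<close>

lemma coefficient_equations:
  fixes a :: "('n \<Rightarrow> nat) \<Rightarrow> real ^ 'n \<Rightarrow> complex"
  assumes "open D" "S \<subseteq> D" and a: "\<And>p. sum p UNIV \<le> m \<Longrightarrow> smooth_on D (a p)" and R: "smooth_on D R"
    and comm: "zero_operator_on D (commutator (schroedinger_op R) (diff_op m a))"
    and split: "\<And>x. x \<in> S \<Longrightarrow> R x = pole_deriv c 0 x + Rh x" and Rh: "holomorphic_near Rh"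
  shows "\<exists>H. (\<forall>p k \<eta> i. holomorphic_near (H p k \<eta> i)) \<and>
    (\<forall>\<eta> k i x. k \<le> m \<longrightarrow> i \<le> k \<longrightarrow> x \<in> S \<longrightarrow>
      laplacian (normal_coeff a k i \<eta>) x
      + 2 * (case k of 0 \<Rightarrow> 0 | Suc k' \<Rightarrow> dd \<eta> (normal_coeff a k' i \<eta>) x
          + (case i of 0 \<Rightarrow> 0 | Suc i' \<Rightarrow> dd e (normal_coeff a k' i' \<eta>) x))
      + (\<Sum>l=1..m-k. of_nat ((i + l) choose l) * (pole_deriv c l x * normal_coeff a (k + l) (i + l) \<eta> x))
      + (\<Sum>p | k < sum p UNIV \<and> sum p UNIV \<le> m. a p x * H p k \<eta> i x) = 0)"
proof -
  define P where "P p k \<eta> h \<longleftrightarrow> (\<forall>i. holomorphic_near (h i)) \<and>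
    (\<forall>x\<in>S. \<forall>\<tau>. twist (\<eta> + \<tau> *\<^sub>R e) Rh (index_list p) k x = (\<Sum>i\<le>k. complex_of_real \<tau> ^ i * h i x))" for p k \<eta> h
  define H where "H p k \<eta> = (SOME h. P p k \<eta> h)" for p k \<eta>
  have "\<exists>h. P p k \<eta> h" for p k \<eta> unfolding P_def by (rule twist_holomorphic[OF Rh])
  then have PH: "P p k \<eta> (H p k \<eta>)" for p k \<eta> unfolding H_def by (rule someI_ex)
  have H_hol: "holomorphic_near (H p k \<eta> i)" for p k \<eta> i using PH[of p k \<eta>] unfolding P_def by blast
  have H_tw: "twist (\<eta> + \<tau> *\<^sub>R e) Rh (index_list p) k x = (\<Sum>i\<le>k. complex_of_real \<tau> ^ i * H p k \<eta> i x)" if "x \<in> S" for p k \<eta> \<tau> x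
    using PH[of p k \<eta>] that unfolding P_def by blast
  have aS: "smooth_on S (a p)" if "sum p UNIV \<le> m" for p using smooth_on_subset[OF a[OF that] \<open>S \<subseteq> D\<close>] .
  have "laplacian (normal_coeff a k i \<eta>) x
      + 2 * (case k of 0 \<Rightarrow> 0 | Suc k' \<Rightarrow> dd \<eta> (normal_coeff a k' i \<eta>) x
          + (case i of 0 \<Rightarrow> 0 | Suc i' \<Rightarrow> dd e (normal_coeff a k' i' \<eta>) x))
      + (\<Sum>l=1..m-k. of_nat ((i + l) choose l) * (pole_deriv c l x * normal_coeff a (k + l) (i + l) \<eta> x))
      + (\<Sum>p | k < sum p UNIV \<and> sum p UNIV \<le> m. a p x * H p k \<eta> i x) = 0"
    if k: "k \<le> m" and i: "i \<le> k" and x: "x \<in> S" for \<eta> k i x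
  proof -
    have smk: "smooth_on S (normal_coeff a k i \<eta>)" if "k \<le> m" for k i
      by (rule smooth_on_normal_coeff) (use aS that in simp)
    define A where "A i = laplacian (normal_coeff a k i \<eta>) x" for i
    define B where "B i = (case k of 0 \<Rightarrow> 0 | Suc k' \<Rightarrow> (if i \<le> m then dd \<eta> (normal_coeff a k' i \<eta>) x else 0)
          + (case i of 0 \<Rightarrow> 0 | Suc i' \<Rightarrow> dd e (normal_coeff a k' i' \<eta>) x))" for i
    define G where "G i = (\<Sum>l=1..m-k. of_nat ((i + l) choose l) * (pole_deriv c l x * normal_coeff a (k + l) (i + l) \<eta> x))" for i
    define Z where "Z i = (\<Sum>p | k < sum p UNIV \<and> sum p UNIV \<le> m. a p x * H p k \<eta> i x)" for i
    have "(\<Sum>i\<le>Suc m. ((if i \<le> m then A i else 0) + 2 * B i + ((if i \<le> k then G i else 0) + (if i \<le> k then Z i else 0))) * complex_of_real \<tau> ^ i) = 0" for \<tau>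
    proof -
      let ?\<zeta> = "\<eta> + \<tau> *\<^sub>R e" and ?t = "complex_of_real \<tau>"
      have sp: "symbol_part a k ?\<zeta> = (\<lambda>x. \<Sum>i\<le>m. ?t ^ i * normal_coeff a k i \<eta> x)" if "k \<le> m" for k
        by (rule ext) (rule symbol_part_eq_normal_coeffs[OF that])
      have A: "laplacian (symbol_part a k ?\<zeta>) x = (\<Sum>i\<le>Suc m. (if i \<le> m then A i else 0) * ?t ^ i)"
        unfolding sp[OF k] laplacian_sum[OF S_open smk[OF k] x] by (simp add: A_def mult.commute)
      have B: "(case k of 0 \<Rightarrow> 0 | Suc k' \<Rightarrow> dd ?\<zeta> (symbol_part a k' ?\<zeta>) x) = (\<Sum>i\<le>Suc m. B i * ?t ^ i)"
      proof (cases k)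
        case 0
        then show ?thesis by (simp add: B_def)
      next
        case (Suc k')
        then have k': "k' \<le> m" using k by simp
        have sm: "smooth_on S (\<lambda>x. ?t ^ i * normal_coeff a k' i \<eta> x)" for i
          by (intro smooth_on_mult smooth_on_const S_open smk k')
        have "dd v (symbol_part a k' ?\<zeta>) x = (\<Sum>i\<le>m. ?t ^ i * dd v (normal_coeff a k' i \<eta>) x)" for v
          unfolding sp[OF k'] dd_sum[OF S_open sm x] dd_cmult[OF S_open smk[OF k'] x] ..
        then have "dd ?\<zeta> (symbol_part a k' ?\<zeta>) x = (\<Sum>i\<le>m. ?t ^ i * (dd \<eta> (normal_coeff a k' i \<eta>) x + ?t * dd e (normal_coeff a k' i \<eta>) x))"
          unfolding dd_vector_add dd_vector_scale by (simp add: sum_distrib_left sum.distrib distrib_left mult_ac)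
        also have "\<dots> = (\<Sum>i\<le>Suc m. ?t ^ i * B i)"
          unfolding B_def Suc nat.case by (rule sum_real_powers_mult_linear)
        finally show ?thesis unfolding Suc by (simp add: mult.commute)
      qed
      have tw: "twist ?\<zeta> R (index_list p) k x = (\<Sum>i\<le>k. ?t ^ i * (of_nat ((i + l) choose l) * coeff (normal_poly p \<eta>) (i + l) * pole_deriv c l x))
          + (\<Sum>i\<le>k. ?t ^ i * H p k \<eta> i x)" if l: "sum p UNIV = k + l" for p l
      proof -
        have "twist ?\<zeta> R (index_list p) k x = twist ?\<zeta> (\<lambda>x. pole_deriv c 0 x + Rh x) (index_list p) k x"
          by (rule twist_cong[OF S_open split x])
        also have "\<dots> = twist ?\<zeta> (pole_deriv c 0) (index_list p) k x + twist ?\<zeta> Rh (index_list p) k x"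
          by (rule twist_add[OF S_open smooth_on_pole_deriv holomorphic_near_smooth[OF Rh] x])
        also have "twist ?\<zeta> (pole_deriv c 0) (index_list p) k x = coeff (normal_poly p ?\<zeta>) l * pole_deriv c l x"
          using twist_pole[OF x, of k "index_list p" ?\<zeta> c] l unfolding length_index_list prod_list_index_list normal_poly_def by simp
        also have "coeff (normal_poly p ?\<zeta>) l = (\<Sum>r\<le>k + l. of_nat (r choose l) * coeff (normal_poly p \<eta>) r * ?t ^ (r - l))"
          unfolding normal_poly_shift by (rule coeff_pcompose_translate) (use degree_normal_poly[of p \<eta>] l in simp)
        \<comment> \<open>Indices r < l have binomial 0, so the truncated exponent r - l does no
          harm and r can be written as i + l.\<close>
        also have "\<dots> = (\<Sum>i\<le>k. of_nat ((i + l) choose l) * coeff (normal_poly p \<eta>) (i + l) * ?t ^ i)"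
        proof -
          have "(\<Sum>r\<le>k + l. of_nat (r choose l) * coeff (normal_poly p \<eta>) r * ?t ^ (r - l))
            = (\<Sum>r\<in>{0 + l..k + l}. of_nat (r choose l) * coeff (normal_poly p \<eta>) r * ?t ^ (r - l))"
            by (rule sum.mono_neutral_right) (auto simp: binomial_eq_0)
          also have "\<dots> = (\<Sum>i\<in>{0..k}. of_nat ((i + l) choose l) * coeff (normal_poly p \<eta>) (i + l) * ?t ^ (i + l - l))"
            by (rule sum.shift_bounds_cl_nat_ivl)
          finally show ?thesis by (simp add: atMost_atLeast0)
        qed
        finally show ?thesis unfolding H_tw[OF x] by (simp add: sum_distrib_left sum_distrib_right mult_ac)
      qed
      have part: "(\<Sum>p | k < sum p UNIV \<and> sum p UNIV \<le> m. f p) = (\<Sum>l=1..m-k. \<Sum>p | sum p UNIV = k + l. f p)" for f :: "('n \<Rightarrow> nat) \<Rightarrow> complex"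
      proof -
        have fin: "finite {p :: 'n \<Rightarrow> nat. k < sum p UNIV \<and> sum p UNIV \<le> m}"
          by (rule finite_subset[OF _ finite_multi_indices[of m]]) auto
        have "(\<Sum>l=1..m-k. \<Sum>p | p \<in> {p. k < sum p UNIV \<and> sum p UNIV \<le> m} \<and> sum p UNIV - k = l. f p) = (\<Sum>p | k < sum p UNIV \<and> sum p UNIV \<le> m. f p)"
          by (rule sum.group[OF fin]) auto
        moreover have "{p. p \<in> {p. k < sum p UNIV \<and> sum p UNIV \<le> m} \<and> sum p UNIV - k = l} = {p :: 'n \<Rightarrow> nat. sum p UNIV = k + l}" if "l \<in> {1..m-k}" for l
          using that by auto
        ultimately have "(\<Sum>l=1..m-k. \<Sum>p | sum p UNIV = k + l. f p) = (\<Sum>p | k < sum p UNIV \<and> sum p UNIV \<le> m. f p)"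
          by (metis (no_types, lifting) sum.cong)
        then show ?thesis by (rule sym)
      qed
      have "(\<Sum>p | k < sum p UNIV \<and> sum p UNIV \<le> m. a p x * twist ?\<zeta> R (index_list p) k x)
        = (\<Sum>l=1..m-k. \<Sum>p | sum p UNIV = k + l. \<Sum>i\<le>k. ?t ^ i * (of_nat ((i + l) choose l) * (pole_deriv c l x * (a p x * coeff (normal_poly p \<eta>) (i + l)))))
          + (\<Sum>l=1..m-k. \<Sum>p | sum p UNIV = k + l. \<Sum>i\<le>k. ?t ^ i * (a p x * H p k \<eta> i x))"
        unfolding part sum.distrib[symmetric]
      proof (intro sum.cong refl)
        fix l and p :: "'n \<Rightarrow> nat" assume "p \<in> {p. sum p UNIV = k + l}"
        then have l: "sum p UNIV = k + l" by simp
        show "a p x * twist ?\<zeta> R (index_list p) k x = (\<Sum>i\<le>k. ?t ^ i * (of_nat ((i + l) choose l) * (pole_deriv c l x * (a p x * coeff (normal_poly p \<eta>) (i + l))))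
           + ?t ^ i * (a p x * H p k \<eta> i x))"
          unfolding tw[OF l] sum.distrib distrib_left sum_distrib_left by (simp add: mult_ac)
      qed
      also have "(\<Sum>l=1..m-k. \<Sum>p | sum p UNIV = k + l. \<Sum>i\<le>k. ?t ^ i * (a p x * H p k \<eta> i x)) = (\<Sum>i\<le>k. ?t ^ i * Z i)"
        unfolding part[symmetric] Z_def sum_distrib_left by (rule sum.swap)
      also have "(\<Sum>l=1..m-k. \<Sum>p | sum p UNIV = k + l. \<Sum>i\<le>k. ?t ^ i * (of_nat ((i + l) choose l) * (pole_deriv c l x * (a p x * coeff (normal_poly p \<eta>) (i + l)))))
         = (\<Sum>i\<le>k. ?t ^ i * G i)"
      proof -
        have "(\<Sum>p | sum p UNIV = k + l. \<Sum>i\<le>k. ?t ^ i * (of_nat ((i + l) choose l) * (pole_deriv c l x * (a p x * coeff (normal_poly p \<eta>) (i + l)))))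
          = (\<Sum>i\<le>k. ?t ^ i * (of_nat ((i + l) choose l) * (pole_deriv c l x * normal_coeff a (k + l) (i + l) \<eta> x)))" for l
          by (subst sum.swap) (simp add: normal_coeff_def sum_distrib_left)
        then have "(\<Sum>l=1..m-k. \<Sum>p | sum p UNIV = k + l. \<Sum>i\<le>k. ?t ^ i * (of_nat ((i + l) choose l) * (pole_deriv c l x * (a p x * coeff (normal_poly p \<eta>) (i + l)))))
          = (\<Sum>l=1..m-k. \<Sum>i\<le>k. ?t ^ i * (of_nat ((i + l) choose l) * (pole_deriv c l x * normal_coeff a (k + l) (i + l) \<eta> x)))" by simp
        also have "\<dots> = (\<Sum>i\<le>k. ?t ^ i * G i)" unfolding G_def sum_distrib_left by (rule sum.swap)
        finally show ?thesis .
      qed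
      finally have GZ: "(\<Sum>p | k < sum p UNIV \<and> sum p UNIV \<le> m. a p x * twist ?\<zeta> R (index_list p) k x) = (\<Sum>i\<le>k. ?t ^ i * G i) + (\<Sum>i\<le>k. ?t ^ i * Z i)" .
      have ext: "(\<Sum>i\<le>k. ?t ^ i * f i) = (\<Sum>i\<le>Suc m. (if i \<le> k then f i else 0) * ?t ^ i)" for f :: "nat \<Rightarrow> complex"
        using k by (intro sum.mono_neutral_cong_left) auto
      have "x \<in> D" using x \<open>S \<subseteq> D\<close> by blast
      from commutator_symbol_equation[OF \<open>open D\<close> a R comm this k, of ?\<zeta>]
      have "(\<Sum>i\<le>Suc m. (if i \<le> m then A i else 0) * ?t ^ i) + 2 * (\<Sum>i\<le>Suc m. B i * ?t ^ i)
         + ((\<Sum>i\<le>Suc m. (if i \<le> k then G i else 0) * ?t ^ i) + (\<Sum>i\<le>Suc m. (if i \<le> k then Z i else 0) * ?t ^ i)) = 0"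
        unfolding A B GZ ext .
      then show ?thesis unfolding distrib_right sum.distrib sum_distrib_left by (simp only: mult.assoc)
    qed
    then have "(if i \<le> m then A i else 0) + 2 * B i + ((if i \<le> k then G i else 0) + (if i \<le> k then Z i else 0)) = 0"
      by (rule real_polynomial_zero) (use i k in simp)
    then have "A i + 2 * B i + (G i + Z i) = 0" using i k by simp
    moreover have "B i = (case k of 0 \<Rightarrow> 0 | Suc k' \<Rightarrow> dd \<eta> (normal_coeff a k' i \<eta>) x
          + (case i of 0 \<Rightarrow> 0 | Suc i' \<Rightarrow> dd e (normal_coeff a k' i' \<eta>) x))"
      unfolding B_def using i k by (cases k) simp_all
    ultimately show ?thesis unfolding A_def G_def Z_def by (simp only: add.assoc)
  qed
  then show ?thesis using H_hol by (intro exI[of _ H]) blast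
qed

end

section \<open>Leading coefficients\<close>

text \<open>Only the equations for the coefficients and the constancy of the top ones are kept; the
  potential and the commutator no longer occur.\<close>

locale coefficient_system = near_hyperplane e y \<epsilon> S
  for e y :: "real ^ 'n" and \<epsilon> :: real and S :: "(real ^ 'n) set" +
  fixes a :: "('n \<Rightarrow> nat) \<Rightarrow> real ^ 'n \<Rightarrow> complex" and m :: nat and c :: complex
    and H :: "('n \<Rightarrow> nat) \<Rightarrow> nat \<Rightarrow> real ^ 'n \<Rightarrow> nat \<Rightarrow> real ^ 'n \<Rightarrow> complex"
    and top :: "nat \<Rightarrow> real ^ 'n \<Rightarrow> complex"
  assumes a_smooth: "\<And>p. sum p UNIV \<le> m \<Longrightarrow> smooth_on S (a p)"
    and H_hol: "\<And>p k \<eta> i. holomorphic_near (H p k \<eta> i)"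
    and eqn: "\<And>\<eta> k i x. k \<le> m \<Longrightarrow> i \<le> k \<Longrightarrow> x \<in> S \<Longrightarrow>
      laplacian (normal_coeff a k i \<eta>) x
      + 2 * (case k of 0 \<Rightarrow> 0 | Suc k' \<Rightarrow> dd \<eta> (normal_coeff a k' i \<eta>) x
          + (case i of 0 \<Rightarrow> 0 | Suc i' \<Rightarrow> dd e (normal_coeff a k' i' \<eta>) x))
      + (\<Sum>l=1..m-k. of_nat ((i + l) choose l) * (pole_deriv c l x * normal_coeff a (k + l) (i + l) \<eta> x))
      + (\<Sum>p | k < sum p UNIV \<and> sum p UNIV \<le> m. a p x * H p k \<eta> i x) = 0"
    and top_const: "\<And>i \<eta> x. x \<in> S \<Longrightarrow> normal_coeff a m i \<eta> x = top i \<eta>"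
begin

abbreviation u :: "nat \<Rightarrow> nat \<Rightarrow> real ^ 'n \<Rightarrow> real ^ 'n \<Rightarrow> complex" where
  "u k i \<eta> \<equiv> normal_coeff a k i \<eta>"

lemma u_smooth: "k \<le> m \<Longrightarrow> smooth_on S (u k i \<eta>)"
  by (rule smooth_on_normal_coeff) (simp add: a_smooth)

lemma top_log_pole: "log_pole N L (u m i \<eta>)"
  by (rule log_pole_cong[OF log_pole_const]) (rule top_const[symmetric])

text \<open>Bounds are known for the symbol at each fixed frequency, after splitting it into normal
  and tangential part. Finitely many frequencies recover the coefficient \<open>a p\<close>, which
  is what multiplies H in the equations.\<close>

lemma log_pole_a:
  assumes "sum p UNIV = k" and u: "\<And>i \<eta>. e \<bullet> \<eta> = 0 \<Longrightarrow> log_pole N L (u k i \<eta>)"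
  shows "log_pole N L (a p)"
proof -
  obtain W where W: "\<And>q :: 'n \<Rightarrow> nat. sum q UNIV = k \<Longrightarrow>
      (\<Sum>l\<in>PiE UNIV (\<lambda>_. {..k}). W l * complex_of_real (mpower (\<chi> j. real (l j)) q)) = (if q = p then 1 else 0)"
    using coefficient_from_values[OF assms(1)] by blast
  have pt: "log_pole N L (symbol_part a k \<xi>)" for \<xi>
  proof -
    define \<tau> where "\<tau> = e \<bullet> \<xi>"
    define \<eta> where "\<eta> = \<xi> - \<tau> *\<^sub>R e"
    have "e \<bullet> \<eta> = 0" by (simp add: \<eta>_def \<tau>_def inner_diff_right e_e)
    have "symbol_part a k \<xi> = (\<lambda>x. \<Sum>i\<le>k. complex_of_real \<tau> ^ i * u k i \<eta> x)"
      using symbol_part_eq_normal_coeffs[OF order_refl, of a k \<eta> \<tau>] by (simp add: \<eta>_def fun_eq_iff)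
    moreover have "log_pole N L (\<lambda>x. \<Sum>i\<le>k. complex_of_real \<tau> ^ i * u k i \<eta> x)"
      by (intro log_pole_sum log_pole_cmult u \<open>e \<bullet> \<eta> = 0\<close>)
    ultimately show ?thesis by (simp only:)
  qed
  have "(\<Sum>l\<in>PiE UNIV (\<lambda>_. {..k}). W l * symbol_part a k (\<chi> j. real (l j)) x) = a p x" for x
  proof -
    have "(\<Sum>l\<in>PiE UNIV (\<lambda>_. {..k}). W l * symbol_part a k (\<chi> j. real (l j)) x)
      = (\<Sum>l\<in>PiE UNIV (\<lambda>_. {..k}). \<Sum>q | sum q UNIV = k. a q x * (W l * complex_of_real (mpower (\<chi> j. real (l j)) q)))"
      unfolding symbol_part_def sum_distrib_left by (intro sum.cong refl) (simp add: mult_ac)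
    also have "\<dots> = (\<Sum>q | sum q UNIV = k. a q x * (\<Sum>l\<in>PiE UNIV (\<lambda>_. {..k}). W l * complex_of_real (mpower (\<chi> j. real (l j)) q)))"
      unfolding sum_distrib_left by (rule sum.swap)
    also have "\<dots> = (\<Sum>q | sum q UNIV = k. if q = p then a q x else 0)"
    proof (intro sum.cong refl)
      fix q :: "'n \<Rightarrow> nat" assume "q \<in> {q. sum q UNIV = k}"
      then have "sum q UNIV = k" by simp
      then show "a q x * (\<Sum>l\<in>PiE UNIV (\<lambda>_. {..k}). W l * complex_of_real (mpower (\<chi> j. real (l j)) q)) = (if q = p then a q x else 0)"
        unfolding W[OF \<open>sum q UNIV = k\<close>] by simp
    qed
    also have "\<dots> = (if p \<in> {q. sum q UNIV = k} then a p x else 0)"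
      by (rule sum.delta[OF finite_multi_indices_eq])
    also have "\<dots> = a p x" using assms(1) by simp
    finally show ?thesis .
  qed
  moreover have "log_pole N L (\<lambda>x. \<Sum>l\<in>PiE UNIV (\<lambda>_. {..k}). W l * symbol_part a k (\<chi> j. real (l j)) x)"
    by (intro log_pole_sum log_pole_cmult pt)
  ultimately show ?thesis using log_pole_cong by simp
qed

section \<open>A priori bounds on poles and logarithms\<close>

definition poles_below :: "(nat \<Rightarrow> nat) \<Rightarrow> nat \<Rightarrow> nat \<Rightarrow> bool" where
  "poles_below N L k \<longleftrightarrow> (\<forall>k'. k \<le> k' \<longrightarrow> k' \<le> m \<longrightarrow> (\<forall>i \<eta>. e \<bullet> \<eta> = 0 \<longrightarrow> log_pole (N k') L (u k' i \<eta>)))"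

lemma log_pole_pole_deriv_mult:
  assumes "log_pole N L f"
  shows "log_pole (N + (l + 2)) L (\<lambda>x. b * (pole_deriv c l x * f x))"
proof -
  have "log_pole (N + (l + 2)) L (\<lambda>x. (b * (c * (-1) ^ l * fact (Suc l))) * (f x * inv_power (l + 2) x))"
    by (intro log_pole_cmult log_pole_mult_inv_power assms)
  then show ?thesis by (rule log_pole_cong) (simp add: pole_deriv_def mult_ac)
qed

lemma log_pole_lower_order_terms:
  assumes "poles_below N L (Suc k)" and N: "\<And>k'. k < k' \<Longrightarrow> k' \<le> m \<Longrightarrow> N k' \<le> N0"
  shows "log_pole N0 L (\<lambda>x. \<Sum>p | k < sum p UNIV \<and> sum p UNIV \<le> m. a p x * H p k \<eta> i x)"
proof (rule log_pole_sum)
  fix p :: "'n \<Rightarrow> nat" assume p: "p \<in> {p. k < sum p UNIV \<and> sum p UNIV \<le> m}"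
  then have "log_pole (N (sum p UNIV)) L (a p)"
    by (intro log_pole_a[OF refl]) (use assms(1) in \<open>simp add: poles_below_def\<close>)
  then have "log_pole N0 L (a p)" by (rule log_pole_mono) (use N p in auto)
  then have "log_pole N0 L (\<lambda>x. H p k \<eta> i x * a p x)" by (rule log_pole_mult_holomorphic[OF H_hol])
  then show "log_pole N0 L (\<lambda>x. a p x * H p k \<eta> i x)" by (rule log_pole_cong) (rule mult.commute)
qed

text \<open>Descending induction on the degree k and, inside it, on the power i. In the equation for
  (k + 1, i + 1) the unknown occurs as \<open>dd e (u k i \<eta>)\<close>; the rest has higher
  degree, or is the tangential derivative \<open>dd \<eta>\<close> of the coefficient with power i +
  1. One integration along e settles each coefficient.\<close>

lemma poles_bounded: "\<exists>N L. poles_below (\<lambda>_. N) L 0"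
proof -
  have "\<exists>N L. poles_below (\<lambda>_. N) L k" if "k \<le> m" for k
    using that
  proof (induction rule: inc_induct)
    case base
    have "poles_below (\<lambda>_. 0) 0 m" unfolding poles_below_def using top_log_pole le_antisym by blast
    then show ?case by blast
  next
    case (step k)
    then obtain N L where NL: "poles_below (\<lambda>_. N) L (Suc k)" by blast
    \<comment> \<open>The inner induction starts at i = k + 1, where the coefficient is 0 because a
      part of degree k has no higher power of \<tau>.\<close>
    have "\<exists>N' L'. \<forall>i'\<ge>i. \<forall>\<eta>. e \<bullet> \<eta> = 0 \<longrightarrow> log_pole N' L' (u k i' \<eta>)" if "i \<le> Suc k" for i
      using that
    proof (induction rule: inc_induct)
      case base
      have "log_pole 0 0 (u k i' \<eta>)" if "i' \<ge> Suc k" for i' \<eta>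
        using that normal_coeff_eq_0[of k i' a \<eta>] log_pole_const by simp
      then show ?case by blast
    next
      case (step i)
      then obtain N1 L1 where 1: "\<And>i' \<eta>. i' \<ge> Suc i \<Longrightarrow> e \<bullet> \<eta> = 0 \<Longrightarrow> log_pole N1 L1 (u k i' \<eta>)" by blast
      \<comment> \<open>The Laplacian raises the order by 2, and multiplication by the l-th
        derivative of the pole by l + 2, at most m + 2; N1 accounts for the tangential term.\<close>
      define N' where "N' = N + N1 + m + 2"
      define L' where "L' = L + L1"
      have new: "log_pole N' (Suc L') (u k i \<eta>)" if \<eta>: "e \<bullet> \<eta> = 0" for \<eta>
      proof (rule log_pole_antideriv)
        show "smooth_on S (u k i \<eta>)" using \<open>k < m\<close> by (intro u_smooth) simp
        have k: "Suc k \<le> m" "Suc i \<le> Suc k" using \<open>k < m\<close> \<open>i < Suc k\<close> by simp_all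
        have hi: "log_pole N L (u k' i' \<eta>)" if "Suc k \<le> k'" "k' \<le> m" for k' i'
          using NL \<eta> that unfolding poles_below_def by blast
        have A: "log_pole N' L' (laplacian (u (Suc k) (Suc i) \<eta>))"
          by (rule log_pole_mono[OF log_pole_laplacian[OF hi[OF order_refl k(1)]]]) (simp_all add: N'_def L'_def)
        have B: "log_pole N' L' (dd \<eta> (u k (Suc i) \<eta>))"
          by (rule log_pole_mono[OF log_pole_dd_tangential[OF 1[OF order_refl \<eta>] \<eta>]]) (simp_all add: N'_def L'_def)
        have G: "log_pole N' L' (\<lambda>x. \<Sum>l=1..m-Suc k. of_nat ((Suc i + l) choose l) * (pole_deriv c l x * u (Suc k + l) (Suc i + l) \<eta> x))"
        proof (rule log_pole_sum)
          fix l assume l: "l \<in> {1..m-Suc k}"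
          show "log_pole N' L' (\<lambda>x. of_nat ((Suc i + l) choose l) * (pole_deriv c l x * u (Suc k + l) (Suc i + l) \<eta> x))"
            by (rule log_pole_mono[OF log_pole_pole_deriv_mult[OF hi]]) (use l in \<open>auto simp: N'_def L'_def\<close>)
        qed
        have "poles_below (\<lambda>_. N) L (Suc (Suc k))" using NL unfolding poles_below_def by (meson Suc_leD)
        from log_pole_lower_order_terms[OF this order_refl]
        have Z: "log_pole N' L' (\<lambda>x. \<Sum>p | Suc k < sum p UNIV \<and> sum p UNIV \<le> m. a p x * H p (Suc k) \<eta> (Suc i) x)"
          by (rule log_pole_mono) (simp_all add: N'_def L'_def)
        have "log_pole N' L' (\<lambda>x. (-1/2) * ((laplacian (u (Suc k) (Suc i) \<eta>) x
            + (\<Sum>l=1..m-Suc k. of_nat ((Suc i + l) choose l) * (pole_deriv c l x * u (Suc k + l) (Suc i + l) \<eta> x)))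
            + (\<Sum>p | Suc k < sum p UNIV \<and> sum p UNIV \<le> m. a p x * H p (Suc k) \<eta> (Suc i) x))
            + (-1) * dd \<eta> (u k (Suc i) \<eta>) x)"
          by (intro log_pole_add log_pole_cmult A B G Z)
        then show "log_pole N' L' (dd e (u k i \<eta>))"
        proof (rule log_pole_cong)
          fix x assume "x \<in> S"
          have lin: "(-1/2) * ((A + G) + Z) + (-1) * B = E" if "A + 2 * (B + E) + G + Z = 0" for A B G Z E :: complex
          proof -
            have "E = (-1/2) * ((A + G) + Z) + (-1) * B + (1/2) * (A + 2 * (B + E) + G + Z)"
              by (simp add: field_simps)
            then show ?thesis unfolding that by simp
          qed
          show "(-1/2) * ((laplacian (u (Suc k) (Suc i) \<eta>) x
            + (\<Sum>l=1..m-Suc k. of_nat ((Suc i + l) choose l) * (pole_deriv c l x * u (Suc k + l) (Suc i + l) \<eta> x)))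
            + (\<Sum>p | Suc k < sum p UNIV \<and> sum p UNIV \<le> m. a p x * H p (Suc k) \<eta> (Suc i) x))
            + (-1) * dd \<eta> (u k (Suc i) \<eta>) x = dd e (u k i \<eta>) x"
            by (rule lin) (use eqn[OF k \<open>x \<in> S\<close>, of \<eta>] in \<open>simp only: nat.case\<close>)
        qed
      qed
      have "log_pole N' (Suc L') (u k i' \<eta>)" if "i' \<ge> i" "e \<bullet> \<eta> = 0" for i' \<eta>
      proof (cases "i' = i")
        case True
        then show ?thesis using new[OF that(2)] by simp
      next
        case False
        then have "log_pole N1 L1 (u k i' \<eta>)" using that by (intro 1) simp_all
        then show ?thesis by (rule log_pole_mono) (simp_all add: N'_def L'_def)
      qed
      then show ?case by blast
    qed
    from this[OF le0] obtain N' L' where new: "\<And>i' \<eta>. e \<bullet> \<eta> = 0 \<Longrightarrow> log_pole N' L' (u k i' \<eta>)" by blast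
    have "poles_below (\<lambda>_. N + N') (L + L') k"
      unfolding poles_below_def
    proof (intro allI impI)
      fix k' i \<eta> assume *: "k \<le> k'" "k' \<le> m" "e \<bullet> \<eta> = 0"
      show "log_pole (N + N') (L + L') (u k' i \<eta>)"
      proof (cases "k' = k")
        case True
        then show ?thesis using log_pole_mono[OF new[OF *(3)]] by simp
      next
        case False
        then have "Suc k \<le> k'" using *(1) by simp
        then have "log_pole N L (u k' i \<eta>)" using NL *(2,3) unfolding poles_below_def by blast
        then show ?thesis by (rule log_pole_mono) simp_all
      qed
    qed
    then show ?case by blast
  qed
  then show ?thesis by blast
qed

section \<open>Calculus of leading coefficients\<close>

definition lead :: "(real ^ 'n) list \<Rightarrow> nat \<Rightarrow> nat \<Rightarrow> (real ^ 'n \<Rightarrow> complex) \<Rightarrow> (nat \<Rightarrow> complex) \<Rightarrow> bool" where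
  "lead vs N L f q \<longleftrightarrow> smooth_on S f \<and> loglead \<epsilon> N L (on_line (dds vs f)) q"

lemma lead_cong:
  assumes "lead vs N L f q" "\<And>x. x \<in> S \<Longrightarrow> f x = g x"
  shows "lead vs N L g q"
  unfolding lead_def
proof
  show "smooth_on S g" by (rule smooth_on_cong[OF S_open _ assms(2)]) (use assms(1) in \<open>simp_all add: lead_def\<close>)
  show "loglead \<epsilon> N L (on_line (dds vs g)) q"
    by (rule on_line_cong[OF _ dds_cong_open[OF S_open assms(2)]]) (use assms(1) in \<open>simp_all add: lead_def\<close>)
qed

lemma lead_add:
  assumes "lead vs N L f q" "lead vs N L g r"
  shows "lead vs N L (\<lambda>x. f x + g x) (\<lambda>s. q s + r s)"
proof -
  have sm: "smooth_on S f" "smooth_on S g" using assms by (simp_all add: lead_def)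
  have "loglead \<epsilon> N L (on_line (dds vs (\<lambda>x. f x + g x))) (\<lambda>s. q s + r s)"
  proof (rule loglead_cong[OF loglead_add])
    show "loglead \<epsilon> N L (on_line (dds vs f)) q" "loglead \<epsilon> N L (on_line (dds vs g)) r"
      using assms by (simp_all add: lead_def)
    show "on_line (dds vs f) t + on_line (dds vs g) t = on_line (dds vs (\<lambda>x. f x + g x)) t"
      if "0 < t" "t < \<epsilon>" for t
      unfolding on_line_def by (rule dds_add[OF S_open sm line_in[OF that], symmetric])
  qed
  then show ?thesis unfolding lead_def using smooth_on_add[OF S_open sm] by blast
qed

lemma lead_cmult:
  assumes "lead vs N L f q"
  shows "lead vs N L (\<lambda>x. b * f x) (\<lambda>s. b * q s)"
proof -
  have sm: "smooth_on S f" using assms by (simp_all add: lead_def)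
  have "loglead \<epsilon> N L (on_line (dds vs (\<lambda>x. b * f x))) (\<lambda>s. b * q s)"
  proof (rule loglead_cong[OF loglead_cmult])
    show "loglead \<epsilon> N L (on_line (dds vs f)) q"
      using assms by (simp_all add: lead_def)
    show "b * on_line (dds vs f) t = on_line (dds vs (\<lambda>x. b * f x)) t"
      if "0 < t" "t < \<epsilon>" for t
      unfolding on_line_def by (rule dds_cmult[OF S_open sm line_in[OF that], symmetric])
  qed
  then show ?thesis unfolding lead_def using smooth_on_mult[OF S_open smooth_on_const[OF S_open] sm] by blast
qed

lemma lead_of_log_pole:
  assumes "log_pole N' L f" "tangential vs" "N' < N"
  shows "lead vs N L f (\<lambda>_. 0)"
proof -
  obtain q where "loglead \<epsilon> N' L (on_line (dds vs f)) q" using log_poleD[OF assms(1,2)] by blast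
  then show ?thesis unfolding lead_def using loglead_less[OF _ assms(3)] log_pole_smooth[OF assms(1)] by blast
qed

lemma lead_zero: "tangential vs \<Longrightarrow> lead vs (Suc N) L (\<lambda>_. 0) (\<lambda>_. 0)"
  by (rule lead_of_log_pole[OF log_pole_const _ lessI])

lemma lead_sum:
  assumes "tangential vs" "\<And>i. i \<in> I \<Longrightarrow> lead vs (Suc N) L (f i) (q i)"
  shows "lead vs (Suc N) L (\<lambda>x. \<Sum>i\<in>I. f i x) (\<lambda>s. \<Sum>i\<in>I. q i s)"
  using assms(2) by (induction I rule: infinite_finite_induct) (simp_all add: lead_zero[OF assms(1)] lead_add)

lemma lead_unique_zero:
  assumes "lead vs N L f q" "\<And>x. x \<in> S \<Longrightarrow> f x = 0"
  shows "q s = 0"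
proof -
  have "lead vs N L (\<lambda>_. 0) q" by (rule lead_cong[OF assms])
  then have "loglead \<epsilon> N L (on_line (dds vs (\<lambda>_. 0))) q" by (simp add: lead_def)
  moreover have "dds vs (\<lambda>_. 0) = (\<lambda>_. 0)"
  proof (induction vs)
    case (Cons v vs)
    show ?case unfolding dds_simps Cons by (rule ext) (rule dd_const)
  qed simp
  moreover have "on_line (\<lambda>_. 0) = (\<lambda>_. 0)" by (rule ext) (simp add: on_line_def)
  ultimately have "loglead \<epsilon> N L (\<lambda>_. 0) q" by (simp only:)
  then show ?thesis by (rule loglead_unique_zero[OF _ eps]) simp
qed

lemma lead_dd_normal:
  assumes "lead vs N L f q"
  shows "lead vs (Suc N) L (dd e f) (\<lambda>s. of_nat (Suc s) * q (Suc s) - of_nat N * q s)"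
proof -
  have sm: "smooth_on S f" and l: "loglead \<epsilon> N L (on_line (dds vs f)) q" using assms by (simp_all add: lead_def)
  from on_line_cong[OF loglead_dd_normal[OF smooth_on_dds[OF S_open sm] l] dds_dd_commute[OF S_open sm, symmetric]]
  show ?thesis unfolding lead_def using smooth_on_dd[OF S_open sm] by blast
qed

lemma lead_pole_deriv_mult:
  assumes "lead vs N L f q" "tangential vs"
  shows "lead vs (N + (l + 2)) L (\<lambda>x. pole_deriv c l x * f x) (\<lambda>s. c * (-1) ^ l * fact (Suc l) * q s)"
proof -
  have sm: "smooth_on S f" and l: "loglead \<epsilon> N L (on_line (dds vs f)) q" using assms by (simp_all add: lead_def)
  have "lead vs (N + (l + 2)) L (\<lambda>x. f x * inv_power (l + 2) x) q"
    unfolding lead_def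
    using on_line_cong[OF loglead_mult_inv_power[OF l, of "l + 2"] dds_mult_inv_power[OF assms(2) sm, symmetric]]
      smooth_on_mult[OF S_open sm smooth_on_inv_power] by blast
  from lead_cmult[OF this, of "c * (-1) ^ l * fact (Suc l)"]
  show ?thesis by (rule lead_cong) (simp add: pole_deriv_def mult_ac)
qed

text \<open>With order M - k in degree k, all terms of order M - k + 2 are collected at ln t ^ s.
  Two normal derivatives give the factor N (N + 1) with N = M - k, one normal derivative in degree k
  - 1 gives -(N + 1). Tangential derivatives and the terms with H have lower order. Since leading
  coefficients at higher powers of ln t vanish by \<open>above\<close>, the log-lowering part of the
  derivative contributes nothing.\<close>

lemma lead_equation:
  assumes M: "m \<le> M" and P: "poles_below (\<lambda>k. M - k) L 0" and vs: "tangential vs" and \<eta>: "e \<bullet> \<eta> = 0"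
    and q: "\<And>k i. k \<le> m \<Longrightarrow> lead vs (M - k) L (u k i \<eta>) (q k i)"
    and k: "k \<le> m" "i \<le> k" and above: "\<And>k i t. k \<le> m \<Longrightarrow> s < t \<Longrightarrow> q k i t = 0"
  shows "of_nat (M - k) * (of_nat (M - k) + 1) * q k i s
     - 2 * (of_nat (M - k) + 1) * (case k of 0 \<Rightarrow> 0 | Suc k' \<Rightarrow> (case i of 0 \<Rightarrow> 0 | Suc i' \<Rightarrow> q k' i' s))
     + c * (\<Sum>l=1..m-k. (-1) ^ l * fact (Suc l) * of_nat ((i + l) choose l) * q (k + l) (i + l) s) = 0"
proof -
  let ?N = "Suc (Suc (M - k))"
  have lp: "log_pole (M - k) L (u k i \<eta>)" if "k \<le> m" for k i using P that \<eta> unfolding poles_below_def by blast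
  have A1: "lead vs ?N L (dd e (dd e (u k i \<eta>))) (\<lambda>s. of_nat (Suc s) * (of_nat (Suc (Suc s)) * q k i (Suc (Suc s)) - of_nat (M - k) * q k i (Suc s))
       - of_nat (Suc (M - k)) * (of_nat (Suc s) * q k i (Suc s) - of_nat (M - k) * q k i s))"
    by (rule lead_dd_normal[OF lead_dd_normal[OF q[OF k(1)]]])
  have A2: "lead vs ?N L (\<lambda>x. \<Sum>j\<in>UNIV. dd (tangent_axis j) (dd (tangent_axis j) (u k i \<eta>)) x) (\<lambda>_. 0)"
    by (rule lead_of_log_pole[OF log_pole_sum[OF log_pole_dd_tangential[OF log_pole_dd_tangential[OF lp[OF k(1)]]]] vs])
       (simp_all add: tangent_axis_orthogonal)
  have A: "lead vs ?N L (laplacian (u k i \<eta>)) (\<lambda>s. (of_nat (Suc s) * (of_nat (Suc (Suc s)) * q k i (Suc (Suc s)) - of_nat (M - k) * q k i (Suc s))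
       - of_nat (Suc (M - k)) * (of_nat (Suc s) * q k i (Suc s) - of_nat (M - k) * q k i s)) + 0)"
    by (rule lead_cong[OF lead_add[OF A1 A2]]) (rule laplacian_split[OF u_smooth[OF k(1)], symmetric])
  have B: "lead vs ?N L (\<lambda>x. case k of 0 \<Rightarrow> 0 | Suc k' \<Rightarrow> dd \<eta> (u k' i \<eta>) x + (case i of 0 \<Rightarrow> 0 | Suc i' \<Rightarrow> dd e (u k' i' \<eta>) x))
     (\<lambda>s. case k of 0 \<Rightarrow> 0 | Suc k' \<Rightarrow> 0 + (case i of 0 \<Rightarrow> 0 | Suc i' \<Rightarrow> of_nat (Suc s) * q k' i' (Suc s) - of_nat (Suc (M - k)) * q k' i' s))"
  proof (cases k)
    case 0
    then show ?thesis using lead_zero[OF vs] by simp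
  next
    case (Suc k')
    have k': "k' \<le> m" "M - k' = Suc (M - k)" using k(1) M Suc by simp_all
    have B1: "lead vs ?N L (dd \<eta> (u k' i \<eta>)) (\<lambda>_. 0)"
      by (rule lead_of_log_pole[OF log_pole_dd_tangential[OF lp[OF k'(1)] \<eta>] vs]) (simp add: k'(2))
    have B2: "lead vs ?N L (\<lambda>x. case i of 0 \<Rightarrow> 0 | Suc i' \<Rightarrow> dd e (u k' i' \<eta>) x)
       (\<lambda>s. case i of 0 \<Rightarrow> 0 | Suc i' \<Rightarrow> of_nat (Suc s) * q k' i' (Suc s) - of_nat (Suc (M - k)) * q k' i' s)"
    proof (cases i)
      case 0
      then show ?thesis using lead_zero[OF vs] by simp
    next
      case (Suc i')
      show ?thesis unfolding Suc nat.case
        using lead_dd_normal[OF q[OF k'(1), of i']] unfolding k'(2) .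
    qed
    show ?thesis unfolding Suc nat.case using lead_add[OF B1 B2] unfolding Suc .
  qed
  have G: "lead vs ?N L (\<lambda>x. \<Sum>l=1..m-k. of_nat ((i + l) choose l) * (pole_deriv c l x * u (k + l) (i + l) \<eta> x))
     (\<lambda>s. \<Sum>l=1..m-k. of_nat ((i + l) choose l) * (c * (-1) ^ l * fact (Suc l) * q (k + l) (i + l) s))"
  proof (rule lead_sum[OF vs])
    fix l assume "l \<in> {1..m-k}"
    then have l: "k + l \<le> m" "M - (k + l) + (l + 2) = ?N" using M by auto
    from lead_cmult[OF lead_pole_deriv_mult[OF q[OF l(1)] vs, of l "i + l"]]
    show "lead vs ?N L (\<lambda>x. of_nat ((i + l) choose l) * (pole_deriv c l x * u (k + l) (i + l) \<eta> x))
       (\<lambda>s. of_nat ((i + l) choose l) * (c * (-1) ^ l * fact (Suc l) * q (k + l) (i + l) s))"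
      unfolding l(2) .
  qed
  have "poles_below (\<lambda>k. M - k) L (Suc k)" using P unfolding poles_below_def by blast
  from log_pole_lower_order_terms[OF this, of "M - k" \<eta> i]
  have "log_pole (M - k) L (\<lambda>x. \<Sum>p | k < sum p UNIV \<and> sum p UNIV \<le> m. a p x * H p k \<eta> i x)" by simp
  then have Z: "lead vs ?N L (\<lambda>x. \<Sum>p | k < sum p UNIV \<and> sum p UNIV \<le> m. a p x * H p k \<eta> i x) (\<lambda>_. 0)"
    by (rule lead_of_log_pole[OF _ vs]) simp
  note total = lead_add[OF lead_add[OF lead_add[OF A lead_cmult[OF B, of 2]] G] Z]
  from lead_unique_zero[OF total eqn[OF k], of s]
  have "(of_nat (Suc s) * (of_nat (Suc (Suc s)) * q k i (Suc (Suc s)) - of_nat (M - k) * q k i (Suc s))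
       - of_nat (Suc (M - k)) * (of_nat (Suc s) * q k i (Suc s) - of_nat (M - k) * q k i s)) + 0
     + 2 * (case k of 0 \<Rightarrow> 0 | Suc k' \<Rightarrow> 0 + (case i of 0 \<Rightarrow> 0 | Suc i' \<Rightarrow> of_nat (Suc s) * q k' i' (Suc s) - of_nat (Suc (M - k)) * q k' i' s))
     + (\<Sum>l=1..m-k. of_nat ((i + l) choose l) * (c * (-1) ^ l * fact (Suc l) * q (k + l) (i + l) s)) + 0 = 0" .
  moreover have "q k i (Suc s) = 0" "q k i (Suc (Suc s)) = 0" using above k(1) by simp_all
  moreover have "(case k of 0 \<Rightarrow> 0 | Suc k' \<Rightarrow> 0 + (case i of 0 \<Rightarrow> 0 | Suc i' \<Rightarrow> of_nat (Suc s) * q k' i' (Suc s) - of_nat (Suc (M - k)) * q k' i' s))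
     = - (of_nat (M - k) + 1) * (case k of 0 \<Rightarrow> 0 | Suc k' \<Rightarrow> (case i of 0 \<Rightarrow> 0 | Suc i' \<Rightarrow> q k' i' s))"
    using k(1) above by (cases k; cases i) (simp_all add: left_diff_distrib distrib_right)
  moreover have "(\<Sum>l=1..m-k. of_nat ((i + l) choose l) * (c * (-1) ^ l * fact (Suc l) * q (k + l) (i + l) s))
     = c * (\<Sum>l=1..m-k. (-1) ^ l * fact (Suc l) * of_nat ((i + l) choose l) * q (k + l) (i + l) s)"
    unfolding sum_distrib_left by (intro sum.cong refl) (simp only: mult_ac)
  ultimately show ?thesis by (simp add: algebra_simps)
qed

text \<open>A constant, or its derivative 0, has an expansion of order 0 without logarithms, and
  leading coefficients are unique.\<close>

lemma lead_of_const_top: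
  assumes "tangential vs" "lead vs N L (u m i \<eta>) q" and "N > 0 \<or> s > 0"
  shows "q s = 0"
proof -
  have sm: "smooth_on S (u m i \<eta>)" by (rule u_smooth) simp
  have "\<exists>b. \<forall>x\<in>S. dds vs (u m i \<eta>) x = b"
  proof (cases vs)
    case Nil
    then show ?thesis using top_const by simp
  next
    case (Cons v ws)
    have "dds ws (u m i \<eta>) x = dds ws (\<lambda>_. top i \<eta>) x" if "x \<in> S" for x
      by (rule dds_cong_open[OF S_open top_const that])
    moreover have "\<exists>b. dds ws (\<lambda>_. top i \<eta>) = (\<lambda>_ :: real ^ 'n. b)"
    proof (induction ws)
      case (Cons w ws)
      then obtain b where b: "dds ws (\<lambda>_. top i \<eta>) = (\<lambda>_ :: real ^ 'n. b)" by blast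
      have "dds (w # ws) (\<lambda>_. top i \<eta>) = (\<lambda>_. 0)" unfolding dds_simps b by (rule ext) (rule dd_const)
      then show ?case by blast
    qed auto
    ultimately obtain b where b: "\<And>x. x \<in> S \<Longrightarrow> dds ws (u m i \<eta>) x = b" by auto
    have "dds vs (u m i \<eta>) x = 0" if "x \<in> S" for x
    proof -
      have "dds vs (u m i \<eta>) x = dd v (\<lambda>_. b) x"
        unfolding Cons dds_simps by (rule dd_cong_open[OF S_open that b])
      then show ?thesis by simp
    qed
    then show ?thesis by blast
  qed
  then obtain b where b: "\<And>x. x \<in> S \<Longrightarrow> dds vs (u m i \<eta>) x = b" by blast
  have q: "loglead \<epsilon> N L (on_line (dds vs (u m i \<eta>))) q" using assms(2) by (simp add: lead_def)
  have "loglead \<epsilon> N L (on_line (\<lambda>_. b)) q" by (rule on_line_cong[OF q b])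
  then have qb: "loglead \<epsilon> N L (\<lambda>_. b) q" by (simp add: on_line_def[abs_def])
  have b0: "loglead \<epsilon> 0 L (\<lambda>_. b) (\<lambda>s. if s = 0 then b else 0)"
    by (rule loglead_holomorphic[of "\<lambda>_. b"]) auto
  show ?thesis
  proof (cases "N > 0")
    case True
    show ?thesis using loglead_unique[OF qb loglead_less[OF b0 True] eps] by simp
  next
    case False
    then have "N = 0" "s > 0" using assms(3) by auto
    then show ?thesis using loglead_unique[OF qb[unfolded \<open>N = 0\<close>] b0 eps] by simp
  qed
qed

section \<open>Vanishing of leading coefficients and descent of the pole order\<close>

text \<open>All terms of the leading equation lie on one diagonal k - i = \<kappa>. Along it M - k =
  (M - \<kappa>) - i, which is the shape of the indicial recursion; the diagonal ends at degree m,
  that is at i = m - \<kappa>.\<close>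

lemma leads_recursion:
  assumes M: "m \<le> M" and P: "poles_below (\<lambda>k. M - k) L 0" and vs: "tangential vs" and \<eta>: "e \<bullet> \<eta> = 0"
    and q: "\<And>k i. k \<le> m \<Longrightarrow> lead vs (M - k) L (u k i \<eta>) (q k i)"
    and above: "\<And>k i t. k \<le> m \<Longrightarrow> s < t \<Longrightarrow> q k i t = 0"
    and \<kappa>: "\<kappa> \<le> m" and i: "i \<le> m - \<kappa>"
  shows "indicial_rec (M - \<kappa>) c (m - \<kappa>) (\<lambda>i. if \<kappa> + i \<le> m then q (\<kappa> + i) i s else 0) i = 0"
proof -
  have k: "\<kappa> + i \<le> m" "i \<le> \<kappa> + i" using \<kappa> i by simp_all
  have Mk: "of_nat (M - \<kappa>) - of_nat i = (of_nat (M - (\<kappa> + i)) :: complex)"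
    using k M by (simp add: of_nat_diff)
  have prev: "(case \<kappa> + i of 0 \<Rightarrow> 0 | Suc k' \<Rightarrow> (case i of 0 \<Rightarrow> 0 | Suc i' \<Rightarrow> q k' i' s))
    = (if i = 0 then 0 else (if \<kappa> + (i - 1) \<le> m then q (\<kappa> + (i - 1)) (i - 1) s else 0))"
    using k(1) by (cases i) (simp_all split: nat.split)
  have sums: "(\<Sum>l=1..m-\<kappa>-i. (-1) ^ l * fact (Suc l) * of_nat ((i + l) choose l) * (if \<kappa> + (i + l) \<le> m then q (\<kappa> + (i + l)) (i + l) s else 0))
    = (\<Sum>l=1..m-(\<kappa>+i). (-1) ^ l * fact (Suc l) * of_nat ((i + l) choose l) * q (\<kappa> + i + l) (i + l) s)"
    by (intro sum.cong) (auto simp: add.assoc)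
  note eq = lead_equation[where s = s, OF M P vs \<eta> q k above]
  show ?thesis
    unfolding indicial_rec_def Mk sums if_P[OF k(1)] prev[symmetric] by (rule eq)
qed

text \<open>Powers of the logarithm are treated from the top downwards. For each, a diagonal ends in
  a constant coefficient, whose leading coefficient is 0 when a pole or a logarithm is declared;
  \<open>indicial_rec_low_degree\<close> spreads this zero over the diagonal.\<close>

lemma leads_vanish:
  assumes M: "m \<le> M" and P: "poles_below (\<lambda>k. M - k) L 0" and vs: "tangential vs" and \<eta>: "e \<bullet> \<eta> = 0"
    and q: "\<And>k i. k \<le> m \<Longrightarrow> lead vs (M - k) L (u k i \<eta>) (q k i)"
    and k: "k \<le> m" and s: "m < M \<or> s > 0"
  shows "q k i s = 0"
proof -
  have beyond: "q k i s = 0" if "s > L" "k \<le> m" for k i s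
  proof -
    have "loglead \<epsilon> (M - k) L (on_line (dds vs (u k i \<eta>))) (q k i)" using q[OF that(2)] by (simp add: lead_def)
    then obtain h where h: "loglaurent \<epsilon> (M - k) L (on_line (dds vs (u k i \<eta>))) h" "q k i = (\<lambda>s. h s 0)"
      unfolding loglead_def by blast
    have "h s = (\<lambda>_. 0)" using h(1) that(1) unfolding loglaurent_def by blast
    then show ?thesis unfolding h(2) by simp
  qed
  have big: "q k i s = 0" if "i > k" "k \<le> m" for k i s
    by (rule lead_unique_zero[OF q[OF that(2)]]) (simp add: normal_coeff_eq_0[OF that(1)])
  have "\<forall>k i. k \<le> m \<longrightarrow> q k i s = 0" if "m < M \<or> s > 0" for s
    using that
  \<comment> \<open>The measure reverses the order of the powers of the logarithm. Above L the
    expansion has no terms at all, so \<open>beyond\<close> covers what the truncated difference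
    cannot distinguish.\<close>
  proof (induction "L - s" arbitrary: s rule: less_induct)
    case less
    have above: "q k i t = 0" if "k \<le> m" "s < t" for k i t
    proof (cases "t > L")
      case True
      then show ?thesis using beyond that by simp
    next
      case False
      then have "L - t < L - s" "m < M \<or> t > 0" using that by auto
      then show ?thesis using less.hyps that(1) by blast
    qed
    show ?case
    proof (intro allI impI)
      fix k i assume k: "k \<le> m"
      show "q k i s = 0"
      proof (cases "i \<le> k")
        case True
        define \<kappa> where "\<kappa> = k - i"
        have \<kappa>: "\<kappa> \<le> m" "\<kappa> + i = k" using k True by (simp_all add: \<kappa>_def)
        define b where "b = (\<lambda>i. if \<kappa> + i \<le> m then q (\<kappa> + i) i s else 0)"
        have "b i = 0"
        proof (rule indicial_rec_low_degree)
          show "indicial_rec (M - \<kappa>) c (m - \<kappa>) b i = 0" if "i \<le> m - \<kappa>" for i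
            unfolding b_def by (rule leads_recursion[OF M P vs \<eta> q above \<kappa>(1) that])
          show "m - \<kappa> \<le> M - \<kappa>" using M by simp
          show "b i = 0" if "m - \<kappa> \<le> i" for i
          proof (cases "\<kappa> + i = m")
            case True
            have "q m i s = 0"
              by (rule lead_of_const_top[OF vs q[OF order_refl]]) (use less.prems in auto)
            then show ?thesis by (simp add: b_def True)
          next
            case False
            then show ?thesis using that by (simp add: b_def)
          qed
        qed
        then show ?thesis using k by (simp add: b_def \<kappa>(2))
      qed (use big k in simp)
    qed
  qed
  then show ?thesis using s k by blast
qed

text \<open>The top coefficient is constant, so it has no pole of order \<open>Suc M - m\<close>. The leading coefficients of the
  others then solve the indicial recursion with top coefficient \<open>0\<close>, hence vanish as well.\<close>

lemma poles_descend:
  assumes M: "m \<le> M" and P: "poles_below (\<lambda>k. Suc M - k) L 0"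
  shows "poles_below (\<lambda>k. M - k) L 0"
  unfolding poles_below_def
proof (intro allI impI)
  fix k i \<eta> assume k: "k \<le> m" and \<eta>: "e \<bullet> \<eta> = 0"
  have sk: "Suc M - k = Suc (M - k)" if "k \<le> m" for k using that M by simp
  show "log_pole (M - k) L (u k i \<eta>)"
    unfolding log_pole_def
  proof (intro conjI allI impI)
    show "smooth_on S (u k i \<eta>)" by (rule u_smooth[OF k])
    fix vs assume vs: "tangential vs"
    have "\<exists>q. lead vs (Suc M - k) L (u k i \<eta>) q" if "k \<le> m" for k i
    proof -
      have "log_pole (Suc M - k) L (u k i \<eta>)" using P that \<eta> unfolding poles_below_def by blast
      then show ?thesis using log_poleD[OF _ vs] u_smooth[OF that] unfolding lead_def by blast
    qed
    then obtain q where q: "\<And>k i. k \<le> m \<Longrightarrow> lead vs (Suc M - k) L (u k i \<eta>) (q k i)" by metis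
    have "m \<le> Suc M" "m < Suc M" using M by simp_all
    have "q k i = (\<lambda>_. 0)"
      by (rule ext, rule leads_vanish[OF \<open>m \<le> Suc M\<close> P vs \<eta> q k]) (assumption, rule disjI1, fact)
    then have "loglead \<epsilon> (Suc (M - k)) L (on_line (dds vs (u k i \<eta>))) (\<lambda>_. 0)"
      using q[OF k, of i] by (simp add: lead_def sk[OF k])
    then show "\<exists>q. loglead \<epsilon> (M - k) L (on_line (dds vs (u k i \<eta>))) q" by (rule loglead_lower)
  qed
qed

text \<open>The uniform bound N is contained in the weighted bound with M = m + N, since m + N - k
  \<ge> N for k \<le> m. From there N descents reach M = m.\<close>

lemma poles_sharp: "\<exists>L. poles_below (\<lambda>k. m - k) L 0"
proof -
  obtain N L where NL: "poles_below (\<lambda>_. N) L 0" using poles_bounded by blast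
  have "poles_below (\<lambda>k. (m + n) - k) L 0 \<Longrightarrow> poles_below (\<lambda>k. m - k) L 0" for n
  proof (induction n)
    case (Suc n)
    have "poles_below (\<lambda>k. (m + n) - k) L 0" by (rule poles_descend) (use Suc.prems in simp_all)
    then show ?case by (rule Suc.IH)
  qed simp
  moreover have "poles_below (\<lambda>k. (m + N) - k) L 0"
    unfolding poles_below_def
  proof (intro allI impI)
    fix k i \<eta> assume "k \<le> m" and \<eta>: "e \<bullet> \<eta> = 0"
    then have "log_pole N L (u k i \<eta>)" using NL unfolding poles_below_def by blast
    then show "log_pole (m + N - k) L (u k i \<eta>)" by (rule log_pole_mono) (use \<open>k \<le> m\<close> in simp_all)
  qed
  ultimately show ?thesis by blast
qed

text \<open>At M = m all logarithmic leading coefficients vanish, so the recursion holds at s = 0.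
  On the diagonal \<kappa> = m - N both its parameters equal N, and its last entry is the value of
  the constant top coefficient; for odd N it is 0 by \<open>indicial_rec_odd_degree\<close>.\<close>

theorem odd_normal_coefficient_zero:
  assumes c: "\<And>k::int. c \<noteq> of_int (k * (k + 1))" and \<eta>: "e \<bullet> \<eta> = 0" and "odd N" "N \<le> m" "x \<in> S"
  shows "normal_coeff a m N \<eta> x = 0"
proof -
  obtain L where P: "poles_below (\<lambda>k. m - k) L 0" using poles_sharp by blast
  have vs: "tangential []" by (simp add: tangential_def)
  have "\<exists>q. lead [] (m - k) L (u k i \<eta>) q" if "k \<le> m" for k i
  proof -
    have "log_pole (m - k) L (u k i \<eta>)" using P that \<eta> unfolding poles_below_def by blast
    then show ?thesis using log_poleD[OF _ vs] u_smooth[OF that] unfolding lead_def by blast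
  qed
  then obtain q where q: "\<And>k i. k \<le> m \<Longrightarrow> lead [] (m - k) L (u k i \<eta>) (q k i)" by metis
  have above: "q k i t = 0" if "k \<le> m" and t: "0 < t" for k i t
    by (rule leads_vanish[OF order_refl P vs \<eta> q \<open>k \<le> m\<close>]) (assumption, rule disjI2, rule t)
  define \<kappa> where "\<kappa> = m - N"
  have \<kappa>: "\<kappa> \<le> m" "m - \<kappa> = N" "\<kappa> + N = m" using \<open>N \<le> m\<close> by (simp_all add: \<kappa>_def)
  define b where "b = (\<lambda>i. if \<kappa> + i \<le> m then q (\<kappa> + i) i 0 else 0)"
  have "b N = 0"
  proof (rule indicial_rec_odd_degree[OF _ \<open>odd N\<close> c])
    fix i assume "i \<le> N"
    then have "i \<le> m - \<kappa>" by (simp add: \<kappa>(2))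
    from leads_recursion[OF order_refl P vs \<eta> q above \<kappa>(1) this]
    show "indicial_rec N c N b i = 0" unfolding \<kappa>(2) b_def .
  qed
  then have "q m N 0 = 0" by (simp add: b_def \<kappa>(3))
  have "lead [] 0 L (u m N \<eta>) (q m N)" using q[OF order_refl, of N] by simp
  then have "loglead \<epsilon> 0 L (on_line (u m N \<eta>)) (q m N)" by (simp add: lead_def)
  then have "loglead \<epsilon> 0 L (on_line (\<lambda>_. top N \<eta>)) (q m N)" by (rule on_line_cong[OF _ top_const])
  then have "loglead \<epsilon> 0 L (\<lambda>_. top N \<eta>) (q m N)" by (simp add: on_line_def[abs_def])
  moreover have "loglead \<epsilon> 0 L (\<lambda>_. top N \<eta>) (\<lambda>s. if s = 0 then top N \<eta> else 0)"
    by (rule loglead_holomorphic[of "\<lambda>_. top N \<eta>"]) auto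
  ultimately have "q m N = (\<lambda>s. if s = 0 then top N \<eta> else 0)" by (rule loglead_unique[OF _ _ eps])
  then have "top N \<eta> = 0" using \<open>q m N 0 = 0\<close> by simp
  then show ?thesis using top_const[OF \<open>x \<in> S\<close>] by simp
qed

end

section \<open>Invariance of the principal symbol\<close>

context near_hyperplane
begin

lemma holomorphic_near_power_series:
  assumes "has_power_series f y \<rho>" "\<epsilon> \<le> \<rho>" "S \<subseteq> ball y \<rho>"
  shows "holomorphic_near f"
  unfolding holomorphic_near_def
proof (intro conjI allI)
  show "smooth_on S f" by (rule smooth_on_subset[OF has_power_series_smooth[OF assms(1)] assms(3)])
  fix vs
  obtain k where k: "k holomorphic_on ball 0 \<rho>" "\<And>t. \<bar>t\<bar> < \<rho> \<Longrightarrow> dds vs f (y + t *\<^sub>R e) = k (of_real t)"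
    using has_power_series_line[OF has_power_series_dds[OF assms(1)] norm_e] by blast
  have "k holomorphic_on ball 0 \<epsilon>" by (rule holomorphic_on_subset[OF k(1) subset_ball[OF assms(2)]])
  moreover have "on_line (dds vs f) t = k (of_real t)" if "0 < t" "t < \<epsilon>" for t
    unfolding on_line_def by (rule k(2)) (use that assms(2) in simp)
  ultimately show "\<exists>k. k holomorphic_on ball 0 \<epsilon> \<and> (\<forall>t. 0 < t \<longrightarrow> t < \<epsilon> \<longrightarrow> on_line (dds vs f) t = k (of_real t))"
    by blast
qed

text \<open>The bound on \<epsilon> keeps the complexified line away from the other hyperplane: for
  complex z with modulus below \<epsilon>, \<langle>\<beta>, e\<rangle> z is smaller than
  \<langle>\<beta>, y\<rangle> in modulus.\<close>

lemma holomorphic_near_inner_pole: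
  assumes "\<And>x. x \<in> S \<Longrightarrow> \<beta> \<bullet> x \<noteq> 0" "\<epsilon> * norm \<beta> \<le> \<bar>\<beta> \<bullet> y\<bar>" "\<beta> \<bullet> y \<noteq> 0"
  shows "holomorphic_near (\<lambda>x. K * inner_pole \<beta> l x)"
  unfolding holomorphic_near_def
proof (intro conjI allI)
  show "smooth_on S (\<lambda>x. K * inner_pole \<beta> l x)" by (rule smooth_on_inner_pole[OF S_open assms(1)])
  fix vs
  obtain K' where K': "\<And>x. x \<in> S \<Longrightarrow> dds vs (\<lambda>x. K * inner_pole \<beta> l x) x = K' * inner_pole \<beta> (l + length vs) x"
    using dds_inner_pole[OF S_open assms(1)] by blast
  define k where "k z = K' * (1 / (complex_of_real (\<beta> \<bullet> y) + complex_of_real (\<beta> \<bullet> e) * z) ^ (l + length vs))" for z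
  have nz: "complex_of_real (\<beta> \<bullet> y) + complex_of_real (\<beta> \<bullet> e) * z \<noteq> 0" if "z \<in> ball 0 \<epsilon>" for z
  proof
    assume "complex_of_real (\<beta> \<bullet> y) + complex_of_real (\<beta> \<bullet> e) * z = 0"
    then have "complex_of_real (\<beta> \<bullet> y) = - (complex_of_real (\<beta> \<bullet> e) * z)" by (rule eq_neg_iff_add_eq_0[THEN iffD2])
    then have "\<bar>\<beta> \<bullet> y\<bar> = \<bar>\<beta> \<bullet> e\<bar> * cmod z" by (metis norm_minus_cancel norm_mult norm_of_real)
    also have "\<dots> \<le> norm \<beta> * cmod z"
      using Cauchy_Schwarz_ineq2[of \<beta> e] by (intro mult_right_mono) (simp_all add: norm_e)
    also have "\<dots> < norm \<beta> * \<epsilon>" using that assms(3) by (intro mult_strict_left_mono) auto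
    finally show False using assms(2) by (simp add: mult.commute)
  qed
  have "k holomorphic_on ball 0 \<epsilon>" unfolding k_def[abs_def]
    by (intro holomorphic_intros) (use nz in auto)
  moreover have "on_line (dds vs (\<lambda>x. K * inner_pole \<beta> l x)) t = k (of_real t)" if "0 < t" "t < \<epsilon>" for t
    unfolding on_line_def K'[OF line_in[OF that]] k_def by (simp add: inner_pole_def inner_add_right mult.commute)
  ultimately show "\<exists>k. k holomorphic_on ball 0 \<epsilon> \<and>
      (\<forall>t. 0 < t \<longrightarrow> t < \<epsilon> \<longrightarrow> on_line (dds vs (\<lambda>x. K * inner_pole \<beta> l x)) t = k (of_real t))" by blast
qed

lemma normal_coeff_const:
  assumes const: "\<And>x \<xi>. x \<in> S \<Longrightarrow> symbol_part a m \<xi> x = \<sigma> \<xi>" and "x \<in> S" "z \<in> S"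
  shows "normal_coeff a m i \<eta> x = normal_coeff a m i \<eta> z"
proof (cases "i \<le> m")
  case True
  have "(\<Sum>i\<le>m. (normal_coeff a m i \<eta> x - normal_coeff a m i \<eta> z) * complex_of_real t ^ i) = 0" for t
  proof -
    have "(\<Sum>i\<le>m. complex_of_real t ^ i * normal_coeff a m i \<eta> x) = (\<Sum>i\<le>m. complex_of_real t ^ i * normal_coeff a m i \<eta> z)"
      unfolding symbol_part_eq_normal_coeffs[OF order_refl, symmetric] const[OF assms(2)] const[OF assms(3)] by (rule refl)
    then show ?thesis unfolding left_diff_distrib sum_subtractf by (simp only: mult.commute right_minus_eq)
  qed
  then have "normal_coeff a m i \<eta> x - normal_coeff a m i \<eta> z = 0" using True by (rule real_polynomial_zero)
  then show ?thesis by simp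
next
  case False
  then show ?thesis by (simp add: normal_coeff_eq_0)
qed

lemma symbol_even:
  fixes a :: "('n \<Rightarrow> nat) \<Rightarrow> real ^ 'n \<Rightarrow> complex"
  assumes "open D" "S \<subseteq> D" and a: "\<And>p. sum p UNIV \<le> m \<Longrightarrow> smooth_on D (a p)" and R: "smooth_on D R"
    and comm: "zero_operator_on D (commutator (schroedinger_op R) (diff_op m a))"
    and split: "\<And>x. x \<in> S \<Longrightarrow> R x = pole_deriv c 0 x + Rh x" and Rh: "holomorphic_near Rh"
    and const: "\<And>x \<xi>. x \<in> S \<Longrightarrow> symbol_part a m \<xi> x = \<sigma> \<xi>"
    and c: "\<And>k::int. c \<noteq> of_int (k * (k + 1))" and \<eta>: "e \<bullet> \<eta> = 0"
  shows "\<sigma> (\<eta> + (- \<tau>) *\<^sub>R e) = \<sigma> (\<eta> + \<tau> *\<^sub>R e)"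
proof -
  have x: "y + (\<epsilon> / 2) *\<^sub>R e \<in> S" using eps by (intro line_in) simp_all
  define x0 where "x0 = y + (\<epsilon> / 2) *\<^sub>R e"
  have x0: "x0 \<in> S" using x by (simp add: x0_def)
  obtain H where H: "\<And>p k \<eta> i. holomorphic_near (H p k \<eta> i)"
    "\<And>\<eta> k i x. k \<le> m \<Longrightarrow> i \<le> k \<Longrightarrow> x \<in> S \<Longrightarrow>
      laplacian (normal_coeff a k i \<eta>) x
      + 2 * (case k of 0 \<Rightarrow> 0 | Suc k' \<Rightarrow> dd \<eta> (normal_coeff a k' i \<eta>) x
          + (case i of 0 \<Rightarrow> 0 | Suc i' \<Rightarrow> dd e (normal_coeff a k' i' \<eta>) x))
      + (\<Sum>l=1..m-k. of_nat ((i + l) choose l) * (pole_deriv c l x * normal_coeff a (k + l) (i + l) \<eta> x))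
      + (\<Sum>p | k < sum p UNIV \<and> sum p UNIV \<le> m. a p x * H p k \<eta> i x) = 0"
    using coefficient_equations[OF assms(1-3) R comm split Rh] by blast
  interpret coefficient_system e y \<epsilon> S a m c H "\<lambda>i \<eta>. normal_coeff a m i \<eta> x0"
  proof
    show "smooth_on S (a p)" if "sum p UNIV \<le> m" for p by (rule smooth_on_subset[OF a[OF that] \<open>S \<subseteq> D\<close>])
    show "normal_coeff a m i \<eta> x = normal_coeff a m i \<eta> x0" if "x \<in> S" for i \<eta> x
      by (rule normal_coeff_const[OF const that x0])
  qed (fact H)+
  have \<sigma>: "\<sigma> (\<eta> + \<tau> *\<^sub>R e) = (\<Sum>i\<le>m. complex_of_real \<tau> ^ i * normal_coeff a m i \<eta> x0)" for \<tau>
    using symbol_part_eq_normal_coeffs[OF order_refl, of a m \<eta> \<tau> x0] unfolding const[OF x0] .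
  have "complex_of_real (- \<tau>) ^ i * normal_coeff a m i \<eta> x0 = complex_of_real \<tau> ^ i * normal_coeff a m i \<eta> x0" if "i \<le> m" for i
  proof (cases "even i")
    case False
    then show ?thesis using odd_normal_coefficient_zero[OF c \<eta> False that x0] by simp
  qed simp
  then show ?thesis unfolding \<sigma> by (intro sum.cong refl) simp
qed

end

section \<open>Choice of the base point and reflection invariance\<close>

text \<open>To avoid one more hyperplane, the point moves along w, the projection of \<gamma> to the
  hyperplane of \<alpha>. It is nonzero as \<gamma> is no multiple of \<alpha>. Each vector excludes
  at most one value of t, so a good t remains.\<close>

lemma exists_avoiding_hyperplanes:
  fixes \<alpha> :: "'a::real_inner"
  assumes "finite B" "\<And>\<beta> c. \<beta> \<in> B \<Longrightarrow> \<beta> \<noteq> c *\<^sub>R \<alpha>"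
  shows "\<exists>y. \<alpha> \<bullet> y = 0 \<and> (\<forall>\<beta>\<in>B. \<beta> \<bullet> y \<noteq> 0)"
  using assms
proof (induction B rule: finite_induct)
  case empty
  show ?case by (rule exI[of _ 0]) simp
next
  case (insert \<gamma> B)
  then obtain y where y: "\<alpha> \<bullet> y = 0" "\<And>\<beta>. \<beta> \<in> B \<Longrightarrow> \<beta> \<bullet> y \<noteq> 0" by auto
  define w where "w = \<gamma> - (\<alpha> \<bullet> \<gamma> / (\<alpha> \<bullet> \<alpha>)) *\<^sub>R \<alpha>"
  have aw: "\<alpha> \<bullet> w = 0" by (cases "\<alpha> = 0") (simp_all add: w_def inner_diff_right)
  have "w \<noteq> 0" using insert.prems[of \<gamma>] by (auto simp: w_def)
  moreover have "\<gamma> \<bullet> w = w \<bullet> w"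
  proof -
    have "w \<bullet> w = \<gamma> \<bullet> w - (\<alpha> \<bullet> \<gamma> / (\<alpha> \<bullet> \<alpha>)) * (\<alpha> \<bullet> w)"
      by (subst w_def) (simp add: inner_diff_left)
    then show ?thesis using aw by simp
  qed
  ultimately have gw: "\<gamma> \<bullet> w \<noteq> 0" by simp
  have "finite ((\<lambda>\<beta>. - (\<beta> \<bullet> y) / (\<beta> \<bullet> w)) ` insert \<gamma> B)" using insert.hyps(1) by simp
  then obtain t where t: "t \<notin> (\<lambda>\<beta>. - (\<beta> \<bullet> y) / (\<beta> \<bullet> w)) ` insert \<gamma> B"
    using ex_new_if_finite[OF infinite_UNIV_char_0] by blast
  have "\<beta> \<bullet> (y + t *\<^sub>R w) \<noteq> 0" if "\<beta> \<in> insert \<gamma> B" for \<beta>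
  proof (cases "\<beta> \<bullet> w = 0")
    case True
    then have "\<beta> \<noteq> \<gamma>" using gw by auto
    then show ?thesis using that y(2)[of \<beta>] True by (simp add: inner_add_right)
  next
    case False
    have "t \<noteq> - (\<beta> \<bullet> y) / (\<beta> \<bullet> w)" using t that by blast
    then show ?thesis using False by (simp add: inner_add_right field_simps)
  qed
  moreover have "\<alpha> \<bullet> (y + t *\<^sub>R w) = 0" by (simp add: inner_add_right y(1) aw)
  ultimately show ?case by blast
qed

lemma exists_point_on_hyperplane:
  fixes \<alpha> :: "'a::real_inner"
  assumes "finite B" "\<And>\<beta> c. \<beta> \<in> B \<Longrightarrow> \<beta> \<noteq> c *\<^sub>R \<alpha>" "r > 0"
  shows "\<exists>y\<in>ball 0 r. \<alpha> \<bullet> y = 0 \<and> (\<forall>\<beta>\<in>B. \<beta> \<bullet> y \<noteq> 0)"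
proof -
  obtain y where y: "\<alpha> \<bullet> y = 0" "\<And>\<beta>. \<beta> \<in> B \<Longrightarrow> \<beta> \<bullet> y \<noteq> 0"
    using exists_avoiding_hyperplanes[OF assms(1,2)] by blast
  define s where "s = r / (norm y + 1)"
  have np: "norm y + 1 > 0" by (rule add_nonneg_pos) simp_all
  have "s > 0" using assms(3) np by (simp add: s_def)
  have "norm (s *\<^sub>R y) = s * norm y" using \<open>s > 0\<close> by simp
  also have "\<dots> < s * (norm y + 1)" using \<open>s > 0\<close> by (intro mult_strict_left_mono) simp_all
  also have "\<dots> = r" using np by (simp add: s_def)
  finally have "s *\<^sub>R y \<in> ball 0 r" by simp
  then show ?thesis using y \<open>s > 0\<close> by (intro bexI[of _ "s *\<^sub>R y"]) auto
qed

lemma symbol_reflection_invariant: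
  fixes H :: "(real ^ 'n) set" and \<sigma> :: "real ^ 'n \<Rightarrow> complex"
  assumes "finite H" and "0 \<notin> H" and "mutually_nonparallel H" and "r > 0"
    and Rt: "real_analytic_on Rt (ball 0 r)"
    and D: "D = ball 0 r - (\<Union>\<beta>\<in>H. hyperplane \<beta>)"
    and a: "\<And>p. sum p UNIV \<le> m \<Longrightarrow> real_analytic_on (a p) D"
    and \<sigma>: "\<And>x \<xi>. x \<in> D \<Longrightarrow> principal_symbol m a x \<xi> = \<sigma> \<xi>"
    and "generic H C"
    and comm: "zero_operator_on D (commutator (schroedinger_op (potential H C Rt)) (diff_op m a))"
    and \<alpha>: "\<alpha> \<in> H"
  shows "\<sigma> (reflection \<alpha> \<xi>) = \<sigma> \<xi>"
    and "\<exists>c. \<forall>\<xi>. \<sigma> \<xi> = (\<Sum>p | sum p UNIV = m. c p * complex_of_real (mpower \<xi> p))"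
proof -
  have "\<alpha> \<noteq> 0" using \<alpha> \<open>0 \<notin> H\<close> by auto
  define B where "B = H - {\<alpha>}"
  have finB: "finite B" using \<open>finite H\<close> by (simp add: B_def)
  have "\<beta> \<noteq> c *\<^sub>R \<alpha>" if "\<beta> \<in> B" for \<beta> c
    using \<open>mutually_nonparallel H\<close> \<alpha> that unfolding mutually_nonparallel_def B_def by blast
  from exists_point_on_hyperplane[OF finB this \<open>r > 0\<close>]
  obtain y where y: "y \<in> ball 0 r" "\<alpha> \<bullet> y = 0" "\<And>\<beta>. \<beta> \<in> B \<Longrightarrow> \<beta> \<bullet> y \<noteq> 0" by blast
  obtain \<rho> where \<rho>: "\<rho> > 0" "has_power_series Rt y \<rho>"
    using Rt y(1) unfolding real_analytic_on_def real_analytic_at_def has_power_series_def by metis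
  \<comment> \<open>Small enough for the power series of the regular part at y, for the ball where
    it is analytic, and for avoiding all other hyperplanes by the Cauchy-Schwarz inequality.\<close>
  define \<epsilon> where "\<epsilon> = Min (insert \<rho> (insert (r - norm y) ((\<lambda>\<beta>. \<bar>\<beta> \<bullet> y\<bar> / norm \<beta>) ` B)))"
  have B0: "norm \<beta> > 0" if "\<beta> \<in> B" for \<beta> using that \<open>0 \<notin> H\<close> by (auto simp: B_def)
  have eps: "\<epsilon> > 0" using finB y \<rho>(1) B0 by (simp add: \<epsilon>_def)
  have eps_le: "\<epsilon> \<le> \<rho>" "\<epsilon> \<le> r - norm y" unfolding \<epsilon>_def by (rule Min_le; simp add: finB)+
  have eps_B: "\<epsilon> * norm \<beta> \<le> \<bar>\<beta> \<bullet> y\<bar>" if "\<beta> \<in> B" for \<beta>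
  proof -
    have "\<epsilon> \<le> \<bar>\<beta> \<bullet> y\<bar> / norm \<beta>" unfolding \<epsilon>_def using finB that by (intro Min_le) auto
    then show ?thesis using B0[OF that] by (simp add: field_simps)
  qed
  have B_nz: "\<beta> \<bullet> x \<noteq> 0" if "\<beta> \<in> B" "x \<in> ball y \<epsilon>" for \<beta> x
  proof
    assume "\<beta> \<bullet> x = 0"
    then have "\<bar>\<beta> \<bullet> y\<bar> = \<bar>\<beta> \<bullet> (y - x)\<bar>" by (simp add: inner_diff_right)
    also have "\<dots> \<le> norm \<beta> * norm (y - x)" by (rule Cauchy_Schwarz_ineq2)
    also have "\<dots> < norm \<beta> * \<epsilon>" using that(2) B0[OF that(1)] by (intro mult_strict_left_mono) (simp_all add: dist_norm)
    finally show False using eps_B[OF that(1)] by (simp add: mult.commute)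
  qed
  define e where "e = (1 / norm \<alpha>) *\<^sub>R \<alpha>"
  define S where "S = ball y \<epsilon> \<inter> {x. e \<bullet> x > 0}"
  have \<alpha>e: "\<alpha> = norm \<alpha> *\<^sub>R e" using \<open>\<alpha> \<noteq> 0\<close> by (simp add: e_def)
  have norm_e: "norm e = 1" using \<open>\<alpha> \<noteq> 0\<close> by (simp add: e_def)
  have ey: "e \<bullet> y = 0" using y(2) by (simp add: e_def)
  have ee: "e \<bullet> e = 1" using norm_e by (simp add: norm_eq_1)
  have ball_sub: "ball y \<epsilon> \<subseteq> ball 0 r"
  proof
    fix x assume "x \<in> ball y \<epsilon>"
    then have "norm (x - y) < \<epsilon>" by (simp add: dist_norm norm_minus_commute)
    then have "norm x < r" using norm_triangle_sub[of x y] eps_le(2) by linarith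
    then show "x \<in> ball 0 r" by simp
  qed
  have "S \<subseteq> D"
  proof
    fix x assume x: "x \<in> S"
    then have "\<alpha> \<bullet> x \<noteq> 0" using \<open>\<alpha> \<noteq> 0\<close> by (auto simp: S_def e_def)
    then have "\<beta> \<bullet> x \<noteq> 0" if "\<beta> \<in> H" for \<beta>
      using B_nz[of \<beta> x] x that by (cases "\<beta> = \<alpha>") (auto simp: B_def S_def)
    then show "x \<in> D" using x ball_sub unfolding D S_def hyperplane_def by blast
  qed
  have "closed (hyperplane \<beta>)" for \<beta> :: "real ^ 'n" unfolding hyperplane_def by (rule closed_hyperplane)
  then have "open D" unfolding D using \<open>finite H\<close> by (intro open_Diff open_ball closed_UN) auto
  have D_nz: "\<beta> \<bullet> x \<noteq> 0" if "\<beta> \<in> H" "x \<in> D" for \<beta> x using that unfolding D hyperplane_def by blast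
  interpret near_hyperplane e y \<epsilon> S
  proof
    show "open S" unfolding S_def by (intro open_Int open_ball open_halfspace_gt)
    show "y + t *\<^sub>R e \<in> S" if "0 < t" "t < \<epsilon>" for t
      using that by (simp add: S_def dist_norm norm_e inner_add_right ey ee)
  qed (use norm_e eps ey in \<open>auto simp: S_def\<close>)
  \<comment> \<open>Passing from \<alpha> to the unit normal e divides the constant by
    \<langle>\<alpha>, \<alpha>\<rangle>, which turns genericity into the condition of the indicial
    recursion.\<close>
  define c where "c = C \<alpha> / complex_of_real (\<alpha> \<bullet> \<alpha>)"
  have c: "c \<noteq> of_int (k * (k + 1))" for k :: int
  proof
    assume "c = of_int (k * (k + 1))"
    then have "C \<alpha> = of_int (k * (k + 1)) * complex_of_real (\<alpha> \<bullet> \<alpha>)"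
      using \<open>\<alpha> \<noteq> 0\<close> unfolding c_def by (subst (asm) nonzero_divide_eq_eq) simp_all
    then show False using \<open>generic H C\<close> \<alpha> unfolding generic_def by blast
  qed
  define Rh where "Rh x = (\<Sum>\<beta>\<in>B. C \<beta> * inner_pole \<beta> 2 x) + Rt x" for x
  have Rh: "holomorphic_near Rh"
    unfolding Rh_def[abs_def]
  proof (intro holomorphic_near_add holomorphic_near_sum finB)
    show "holomorphic_near Rt"
      by (rule holomorphic_near_power_series[OF \<rho>(2) eps_le(1)]) (use eps_le(1) in \<open>auto simp: S_def\<close>)
    show "holomorphic_near (\<lambda>x. C \<beta> * inner_pole \<beta> 2 x)" if "\<beta> \<in> B" for \<beta>
      by (rule holomorphic_near_inner_pole[OF B_nz[OF that] eps_B[OF that] y(3)[OF that]]) (simp add: S_def)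
  qed
  have split: "potential H C Rt x = pole_deriv c 0 x + Rh x" for x
  proof -
    have "C \<alpha> / complex_of_real ((\<alpha> \<bullet> x)\<^sup>2) = pole_deriv c 0 x"
    proof -
      have "\<alpha> \<bullet> x = norm \<alpha> * (e \<bullet> x)" by (subst \<alpha>e) simp
      moreover have "\<alpha> \<bullet> \<alpha> = (norm \<alpha>)\<^sup>2" by (simp add: dot_square_norm)
      ultimately show ?thesis unfolding c_def by (simp add: pole_deriv_def inner_pole_def power_mult_distrib power2_eq_square)
    qed
    moreover have "potential H C Rt x = C \<alpha> / complex_of_real ((\<alpha> \<bullet> x)\<^sup>2) + (\<Sum>\<beta>\<in>B. C \<beta> / complex_of_real ((\<beta> \<bullet> x)\<^sup>2)) + Rt x"
      unfolding potential_def B_def by (subst sum.remove[OF \<open>finite H\<close> \<alpha>]) (rule refl)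
    ultimately show ?thesis unfolding Rh_def by (simp add: inner_pole_def)
  qed
  have R: "smooth_on D (potential H C Rt)"
  proof -
    have "smooth_on D (\<lambda>x. C \<beta> / complex_of_real ((\<beta> \<bullet> x)\<^sup>2))" if "\<beta> \<in> H" for \<beta>
      using smooth_on_inner_pole[OF \<open>open D\<close> D_nz[OF that], of "C \<beta>" 2] by (simp add: inner_pole_def)
    moreover have "smooth_on D Rt"
      by (rule smooth_on_subset[OF real_analytic_on_imp_smooth_on[OF open_ball Rt]]) (simp add: D)
    ultimately show ?thesis unfolding potential_def[abs_def]
      by (intro smooth_on_add smooth_on_sum \<open>open D\<close>)
  qed
  have symbol: "symbol_part a m \<xi> x = \<sigma> \<xi>" if "x \<in> D" for x \<xi>
    using \<sigma>[OF that, of \<xi>] by (simp add: symbol_part_def principal_symbol_def)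
  \<comment> \<open>In this decomposition of \<xi>, reflection in \<alpha> is the change of sign of
    \<tau>, so \<open>symbol_even\<close> is the claimed invariance.\<close>
  define \<tau> where "\<tau> = e \<bullet> \<xi>"
  define \<eta> where "\<eta> = \<xi> - \<tau> *\<^sub>R e"
  have \<eta>: "e \<bullet> \<eta> = 0" by (simp add: \<eta>_def \<tau>_def inner_diff_right ee)
  have "\<sigma> (\<eta> + (- \<tau>) *\<^sub>R e) = \<sigma> (\<eta> + \<tau> *\<^sub>R e)"
    by (rule symbol_even[OF \<open>open D\<close> \<open>S \<subseteq> D\<close> real_analytic_on_imp_smooth_on[OF \<open>open D\<close> a] R comm split Rh symbol c \<eta>])
       (use \<open>S \<subseteq> D\<close> in auto)
  moreover have "\<eta> + (- \<tau>) *\<^sub>R e = reflection \<alpha> \<xi>"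
  proof -
    have "(2 * (\<alpha> \<bullet> \<xi>) / (\<alpha> \<bullet> \<alpha>)) *\<^sub>R \<alpha> = (2 * \<tau>) *\<^sub>R e"
      using \<open>\<alpha> \<noteq> 0\<close> by (simp add: \<tau>_def e_def dot_square_norm power2_eq_square)
    then show ?thesis by (simp add: reflection_def \<eta>_def scaleR_left_distrib[of \<tau> \<tau>, symmetric] algebra_simps mult_2)
  qed
  ultimately show "\<sigma> (reflection \<alpha> \<xi>) = \<sigma> \<xi>" by (simp add: \<eta>_def)
  have "y + (\<epsilon> / 2) *\<^sub>R e \<in> D" using line_in[of "\<epsilon> / 2"] eps \<open>S \<subseteq> D\<close> by auto
  from symbol[OF this, symmetric]
  show "\<exists>c. \<forall>\<xi>. \<sigma> \<xi> = (\<Sum>p | sum p UNIV = m. c p * complex_of_real (mpower \<xi> p))"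
    unfolding symbol_part_def by (intro exI[of _ "\<lambda>p. a p (y + (\<epsilon> / 2) *\<^sub>R e)"] allI)
qed

theorem theorem4p4:
  fixes H :: "(real ^ 'n) set"
    and C :: "real ^ 'n \<Rightarrow> complex"
    and Rt :: "real ^ 'n \<Rightarrow> complex"
    and r :: real
    and D :: "(real ^ 'n) set"
    and m0 :: nat
    and a :: "('n \<Rightarrow> nat) \<Rightarrow> real ^ 'n \<Rightarrow> complex"
    and \<sigma> :: "real ^ 'n \<Rightarrow> complex"
  assumes "finite H" and "0 \<notin> H" and "mutually_nonparallel H"
    and "\<And>\<alpha>. \<alpha> \<in> H \<Longrightarrow> C \<alpha> \<noteq> 0"
    and "r > 0" and "real_analytic_on Rt (ball 0 r)"
    and "D = ball 0 r - (\<Union>\<beta>\<in>H. hyperplane \<beta>)"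
    and "\<And>p. sum p UNIV \<le> m0 \<Longrightarrow> real_analytic_on (a p) D"
    and "\<And>x \<xi>. x \<in> D \<Longrightarrow> principal_symbol m0 a x \<xi> = \<sigma> \<xi>"
    and "\<not> (\<exists>q :: complex poly. \<forall>\<xi>. \<sigma> \<xi> = poly q (complex_of_real (\<Sum>i\<in>UNIV. (\<xi> $ i)\<^sup>2)))"
    and "generic H C"
    and "irreducible_set H"
  shows "finite_reflection_group (reflection_group H) \<or>
    \<not> zero_operator_on D (commutator (schroedinger_op (potential H C Rt)) (diff_op m0 a))"
proof (rule disjCI, unfold not_not, rule ccontr)
  assume comm: "zero_operator_on D (commutator (schroedinger_op (potential H C Rt)) (diff_op m0 a))"
    and W: "\<not> finite_reflection_group (reflection_group H)"
  have inv: "\<sigma> (reflection \<alpha> \<xi>) = \<sigma> \<xi>" if "\<alpha> \<in> H" for \<alpha> \<xi>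
    by (rule symbol_reflection_invariant(1)[OF assms(1-3,5-9,11) comm that]) assumption+
  \<comment> \<open>Some \<alpha> in H is required to obtain a point of D from
    \<open>symbol_reflection_invariant\<close>, where evaluating the coefficients of P shows
    \<sigma> to be a homogeneous polynomial.\<close>
  have "H \<noteq> {}"
  proof
    assume "H = {}"
    then have "(UNIV :: (real ^ 'n) set) = {0}" using \<open>irreducible_set H\<close> by (simp add: irreducible_set_def)
    moreover have "axis undefined 1 \<noteq> (0 :: real ^ 'n)" by (simp add: axis_eq_0_iff)
    ultimately show False by blast
  qed
  then obtain \<alpha> where "\<alpha> \<in> H" by blast
  have "\<exists>c. \<forall>\<xi>. \<sigma> \<xi> = (\<Sum>p | sum p UNIV = m0. c p * complex_of_real (mpower \<xi> p))"
    by (rule symbol_reflection_invariant(2)[OF assms(1-3,5-9,11) comm \<open>\<alpha> \<in> H\<close>]) assumption+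
  then obtain c where c: "\<And>\<xi>. \<sigma> \<xi> = (\<Sum>p | sum p UNIV = m0. c p * complex_of_real (mpower \<xi> p))"
    by blast
  from reflection_invariant_radial[OF c \<open>0 \<notin> H\<close> \<open>irreducible_set H\<close> inv W] assms(10)
  show False by blast
qed

end
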